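(* For every closed $\mathrm{ACP}^{\tau}_{\mathrm{drt}}\mathrm{REC}$ term $t$ in which no abstraction operator $\tau_I$ occurs, there exists a closed $\mathrm{ACP}^{\tau}_{\mathrm{drt}}\mathrm{REC}$ term $t'$ that is a closed term of $\mathrm{BPA}^{\tau}_{\mathrm{drt}}\mathrm{REC}$ such that $t=t'$ is derivable from the axioms of $\mathrm{ACP}^{\tau}_{\mathrm{drt}}\mathrm{REC}$.
   Context: Fix a finite set $A$ of basic actions with $\tau,\delta\notin A$, and a commutative and associative function $\gamma:(A\cup\{\tau,\delta\})^2\to A\cup\{\tau,\delta\}$ with $\gamma(\tau,a)=\gamma(\delta,a)=\delta$ for all $a$. The signature of $\mathrm{ACP}^{\tau}_{\mathrm{drt}}$ consists of the constants $\underline{a}$ ($a\in A$), $\underline{\tau}$, $\underline{\delta}$; the binary operators $+$, $\cdot$, $\parallel$, $\lfloor\!\lfloor$ (left merge), $\mid$ (communication merge); and the unary operators $\sigma$ (one-time-slice delay), $\partial_H$ for $H\subseteq A$, $\tau_I$ for $I\subseteq A$ (abstraction), and $\nu$ (time-out). The signature of $\mathrm{BPA}^{\tau}_{\mathrm{drt}}$ is obtained by omitting $\parallel,\lfloor\!\lfloor,\mid,\partial_H$. The axioms of $\mathrm{ACP}^{\tau}_{\mathrm{drt}}$ are ($a,b,c$ range over $A\cup\{\tau,\delta\}$, $H,I\subseteq A$): $x+y=y+x$; $(x+y)+z=x+(y+z)$; $x+x=x$; $(x+y)\cdot z=x\cdot z+y\cdot z$; $(x\cdot y)\cdot z=x\cdot(y\cdot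 z)$; $x+\underline{\delta}=x$; $\underline{\delta}\cdot x=\underline{\delta}$; $\sigma(x)+\sigma(y)=\sigma(x+y)$; $\sigma(x)\cdot y=\sigma(x\cdot y)$; $\partial_H(\underline a)=\underline a$ if $a\notin H$; $\partial_H(\underline a)=\underline\delta$ if $a\in H$; $\partial_H(x+y)=\partial_H(x)+\partial_H(y)$; $\partial_H(x\cdot y)=\partial_H(x)\cdot\partial_H(y)$; $\partial_H(\sigma(x))=\sigma(\partial_H(x))$; $\tau_I(\underline a)=\underline a$ if $a\notin I$; $\tau_I(\underline a)=\underline\tau$ if $a\in I$; $\tau_I(x+y)=\tau_I(x)+\tau_I(y)$; $\tau_I(x\cdot y)=\tau_I(x)\cdot\tau_I(y)$; $\tau_I(\sigma(x))=\sigma(\tau_I(x))$; $x\parallel y=(x\lfloor\!\lfloor y+y\lfloor\!\lfloor x)+x\mid y$; $\underline a\lfloor\!\lfloor x=\underline a\cdot x$; $\underline a\cdot x\lfloor\!\lfloor y=\underline a\cdot(x\parallel y)$; $\sigma(x)\lfloor\!\lfloor\nu(y)=\underline\delta$; $\sigma(x)\lfloor\!\lfloor(\nu(y)+\sigma(z))=\sigma(x\lfloor\!\lfloor z)$; $(x+y)\lfloor\!\lfloor z=x\lfloor\!\lfloor z+y\lfloor\!\lfloor z$; $\underline a\cdot x\mid\underline b=(\underline a\mid\underline b)\cdot x$; $\underline a\mid\underline b\cdot x=(\underline a\mid\underline b)\cdot x$; $\underline a\cdot x\mid\underline b\cdot y=(\underline a\mid\underline b)\cdot(x\parallel y)$;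 $\nu(x)\mid\sigma(y)=\underline\delta$; $\sigma(x)\mid\nu(y)=\underline\delta$; $\sigma(x)\mid\sigma(y)=\sigma(x\mid y)$; $(x+y)\mid z=x\mid z+y\mid z$; $x\mid(y+z)=x\mid y+x\mid z$; $\underline a\mid\underline b=\underline c$ if $\gamma(a,b)=c$; $\nu(\underline a)=\underline a$; $\nu(x+y)=\nu(x)+\nu(y)$; $\nu(x\cdot y)=\nu(x)\cdot y$; $\nu(\sigma(x))=\underline\delta$; $\underline a\cdot\underline\tau=\underline a$; $\underline a\cdot(\underline\tau\cdot(\nu(x)+y)+\nu(x))=\underline a\cdot(\nu(x)+y)$; $\underline a\cdot(\underline\tau\cdot(\nu(x)+y)+y)=\underline a\cdot(\nu(x)+y)$; $\underline a\cdot(\sigma(\underline\tau\cdot x)+\nu(y))=\underline a\cdot(\sigma(x)+\nu(y))$. The axioms of $\mathrm{BPA}^{\tau}_{\mathrm{drt}}$ are those not mentioning $\parallel,\lfloor\!\lfloor,\mid,\partial_H$. Recursion. An occurrence of a variable $X$ in a term $t$ over a signature $\Sigma$ including that of $\mathrm{BPA}^{\tau}_{\mathrm{drt}}$ is guarded if no abstraction operator occurs in $t$ and $t$ has a subterm $\underline a\cdot t'$ ($a\in A$) or $\sigma(t')$ with $t'$ containing the occurrence; $t$ is guarded if all its variable occurrences are. A recursive specification over $\Sigma$ is a set $E=\{X_i=t_i\mid i\in I\}$ with distinct variables $X_i$ and terms $t_i$ over $\Sigma$ with variables in $\mathrm{vars}(E)=\{X_i\}$; for an equation set $\Phi$ containing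 the $\mathrm{BPA}^{\tau}_{\mathrm{drt}}$ axioms, $E$ is guarded modulo $\Phi$ if each $t_i$ can be rewritten to a guarded term using $\Phi$ in either direction and/or $X_j=t_j$ ($j\ne i$) left to right. For $T\in\{\mathrm{ACP}^{\tau}_{\mathrm{drt}},\mathrm{BPA}^{\tau}_{\mathrm{drt}}\}$, the signature/axioms of $T\mathrm{REC}$ are $\bigcup_i\Sigma_i$/$\bigcup_i\Phi_i$, where $\Sigma_0,\Phi_0$ are those of $T$ and $\Sigma_{i+1}$ ($\Phi_{i+1}$) adds, for each $E$ over $\Sigma_i$ guarded modulo $\Phi_i$ and $X\in\mathrm{vars}(E)$, a recursion constant $\langle X\mid E\rangle$ (resp. the equation $\langle X\mid E\rangle=\langle t\mid E\rangle$ for $X=t\in E$, and the conditional equation $E\Rightarrow X=\langle X\mid E\rangle$); $\langle t\mid E\rangle$ is $t$ with each $Y\in\mathrm{vars}(E)$ replaced by $\langle Y\mid E\rangle$. Derivations use conditional equational logic. *)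

theory Defs
  imports Main
begin

text \<open>
  A recursive specification is a set of equations with pairwise distinct left-hand sides, i.e. a
  (possibly infinite) partial map from variables to terms. In \<open>Rec X E\<close>, which stands for the
  constant \<open>\<langle>X|E\<rangle>\<close>, all variables of \<open>E\<close> are bound, so \<open>vars\<close> and \<open>subst\<close> do not enter it.
\<close>

datatype 'a act = Basic 'a | Tau | Delta

datatype 'a unop = Delay | Encap "'a set" | Abstr "'a set" | Timeout

datatype binop = Alt | Seq | Par | LeftMerge | CommMerge

datatype ('a, 'v) trm =
    Var 'v
  | Act "'a act"
  | Unary "'a unop" "('a, 'v) trm"
  | Binary binop "('a, 'v) trm" "('a, 'v) trm"
  | Rec 'v "'v \<Rightarrow> ('a, 'v) trm option"

type_synonym ('a, 'v) spec = "'v \<Rightarrow> ('a, 'v) trm option"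

abbreviation alt (infixl "\<oplus>" 65) where "x \<oplus> y \<equiv> Binary Alt x y"
abbreviation seq (infixr "\<odot>" 75) where "x \<odot> y \<equiv> Binary Seq x y"
abbreviation par (infixl "\<parallel>" 70) where "x \<parallel> y \<equiv> Binary Par x y"
abbreviation lmerge (infixl "\<lhd>" 70) where "x \<lhd> y \<equiv> Binary LeftMerge x y"
abbreviation cmerge (infixl "\<bowtie>" 70) where "x \<bowtie> y \<equiv> Binary CommMerge x y"
abbreviation delay ("\<sigma>") where "\<sigma> x \<equiv> Unary Delay x"
abbreviation encap ("\<partial>") where "\<partial> H x \<equiv> Unary (Encap H) x"
abbreviation abstr ("\<tau>") where "\<tau> I x \<equiv> Unary (Abstr I) x"
abbreviation timeout ("\<nu>") where "\<nu> x \<equiv> Unary Timeout x"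

primrec vars :: "('a, 'v) trm \<Rightarrow> 'v set" where
  "vars (Var X) = {X}"
| "vars (Act a) = {}"
| "vars (Unary f t) = vars t"
| "vars (Binary f s t) = vars s \<union> vars t"
| "vars (Rec X E) = {}"

primrec subst :: "('v \<Rightarrow> ('a, 'v) trm) \<Rightarrow> ('a, 'v) trm \<Rightarrow> ('a, 'v) trm" where
  "subst f (Var X) = f X"
| "subst f (Act a) = Act a"
| "subst f (Unary g t) = Unary g (subst f t)"
| "subst f (Binary g s t) = Binary g (subst f s) (subst f t)"
| "subst f (Rec X E) = Rec X E"

text \<open>The term \<open>\<langle>t|E\<rangle>\<close>.\<close>

definition rec_inst :: "('a, 'v) spec \<Rightarrow> ('a, 'v) trm \<Rightarrow> ('a, 'v) trm" where
  "rec_inst E = subst (\<lambda>Y. if Y \<in> dom E then Rec Y E else Var Y)"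

text \<open>
  Abstraction operators in the right-hand sides of \<open>E\<close> count as occurring in \<open>\<langle>X|E\<rangle>\<close>.
\<close>

primrec abs_free :: "('a, 'v) trm \<Rightarrow> bool" where
  "abs_free (Var X) = True"
| "abs_free (Act a) = True"
| "abs_free (Unary f t) = ((\<forall>I. f \<noteq> Abstr I) \<and> abs_free t)"
| "abs_free (Binary f s t) = (abs_free s \<and> abs_free t)"
| "abs_free (Rec X E) = (\<forall>Y. pred_option (\<lambda>b. b) (map_option abs_free (E Y)))"

lemma abs_free_Rec: "abs_free (Rec X E) \<longleftrightarrow> (\<forall>t \<in> ran E. abs_free t)"
  by (auto simp: ran_def option.pred_map pred_option_def elem_set)

definition acts :: "'a set \<Rightarrow> 'a act set" where
  "acts A = Basic ` A \<union> {Tau, Delta}"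

definition comm_fun :: "'a set \<Rightarrow> ('a act \<Rightarrow> 'a act \<Rightarrow> 'a act) \<Rightarrow> bool" where
  "comm_fun A \<gamma> \<longleftrightarrow>
     (\<forall>a\<in>acts A. \<forall>b\<in>acts A. \<gamma> a b \<in> acts A) \<and>
     (\<forall>a\<in>acts A. \<forall>b\<in>acts A. \<gamma> a b = \<gamma> b a) \<and>
     (\<forall>a\<in>acts A. \<forall>b\<in>acts A. \<forall>c\<in>acts A. \<gamma> (\<gamma> a b) c = \<gamma> a (\<gamma> b c)) \<and>
     (\<forall>a\<in>acts A. \<gamma> Tau a = Delta \<and> \<gamma> Delta a = Delta)"

datatype ptheory = ACP | BPA

fun unops :: "ptheory \<Rightarrow> 'a set \<Rightarrow> 'a unop set" where
  "unops BPA A = {Delay, Timeout} \<union> Abstr ` Pow A"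
| "unops ACP A = {Delay, Timeout} \<union> Abstr ` Pow A \<union> Encap ` Pow A"

fun binops :: "ptheory \<Rightarrow> binop set" where
  "binops BPA = {Alt, Seq}"
| "binops ACP = UNIV"

text \<open>
  The stages \<open>\<Sigma>\<^sub>i\<close>, \<open>\<Phi>\<^sub>i\<close> are determined by the set \<open>S\<close> of those specifications whose recursion
  constants and recursion axioms have been added so far; \<open>terms T A S\<close> and \<open>derives T A \<gamma> S\<close>
  are the terms over, and derivability from, the stage given by \<open>S\<close>.
\<close>

inductive_set "terms" :: "ptheory \<Rightarrow> 'a set \<Rightarrow> ('a, 'v) spec set \<Rightarrow> ('a, 'v) trm set"
  for T A S where
  "Var X \<in> terms T A S"
| "a \<in> acts A \<Longrightarrow> Act a \<in> terms T A S"
| "f \<in> unops T A \<Longrightarrow> t \<in> terms T A S \<Longrightarrow> Unary f t \<in> terms T A S"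
| "f \<in> binops T \<Longrightarrow> s \<in> terms T A S \<Longrightarrow> t \<in> terms T A S \<Longrightarrow> Binary f s t \<in> terms T A S"
| "E \<in> S \<Longrightarrow> X \<in> dom E \<Longrightarrow> Rec X E \<in> terms T A S"

text \<open>
  All substitution instances of the (unconditional) axioms of \<open>ACP\<^sup>\<tau>\<^sub>d\<^sub>r\<^sub>t\<close>. The restriction to
  \<open>a, b \<in> A \<union> {\<tau>, \<delta>}\<close> and \<open>H, I \<subseteq> A\<close> comes from \<open>derives\<close>, which only uses instances both sides of
  which are terms over the signature at hand; for \<open>BPA\<close> this leaves precisely the instances of
  the axioms that do not mention the omitted operators.
\<close>

inductive axiom_inst :: "('a act \<Rightarrow> 'a act \<Rightarrow> 'a act) \<Rightarrow> ('a, 'v) trm \<Rightarrow> ('a, 'v) trm \<Rightarrow> bool"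
  for \<gamma> where
  "axiom_inst \<gamma> (x \<oplus> y) (y \<oplus> x)"
| "axiom_inst \<gamma> ((x \<oplus> y) \<oplus> z) (x \<oplus> (y \<oplus> z))"
| "axiom_inst \<gamma> (x \<oplus> x) x"
| "axiom_inst \<gamma> ((x \<oplus> y) \<odot> z) ((x \<odot> z) \<oplus> (y \<odot> z))"
| "axiom_inst \<gamma> ((x \<odot> y) \<odot> z) (x \<odot> (y \<odot> z))"
| "axiom_inst \<gamma> (x \<oplus> Act Delta) x"
| "axiom_inst \<gamma> (Act Delta \<odot> x) (Act Delta)"
| "axiom_inst \<gamma> (\<sigma> x \<oplus> \<sigma> y) (\<sigma> (x \<oplus> y))"
| "axiom_inst \<gamma> (\<sigma> x \<odot> y) (\<sigma> (x \<odot> y))"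
| "a \<notin> Basic ` H \<Longrightarrow> axiom_inst \<gamma> (\<partial> H (Act a)) (Act a)"
| "a \<in> Basic ` H \<Longrightarrow> axiom_inst \<gamma> (\<partial> H (Act a)) (Act Delta)"
| "axiom_inst \<gamma> (\<partial> H (x \<oplus> y)) (\<partial> H x \<oplus> \<partial> H y)"
| "axiom_inst \<gamma> (\<partial> H (x \<odot> y)) (\<partial> H x \<odot> \<partial> H y)"
| "axiom_inst \<gamma> (\<partial> H (\<sigma> x)) (\<sigma> (\<partial> H x))"
| "a \<notin> Basic ` I \<Longrightarrow> axiom_inst \<gamma> (\<tau> I (Act a)) (Act a)"
| "a \<in> Basic ` I \<Longrightarrow> axiom_inst \<gamma> (\<tau> I (Act a)) (Act Tau)"
| "axiom_inst \<gamma> (\<tau> I (x \<oplus> y)) (\<tau> I x \<oplus> \<tau> I y)"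
| "axiom_inst \<gamma> (\<tau> I (x \<odot> y)) (\<tau> I x \<odot> \<tau> I y)"
| "axiom_inst \<gamma> (\<tau> I (\<sigma> x)) (\<sigma> (\<tau> I x))"
| "axiom_inst \<gamma> (x \<parallel> y) (((x \<lhd> y) \<oplus> (y \<lhd> x)) \<oplus> (x \<bowtie> y))"
| "axiom_inst \<gamma> (Act a \<lhd> x) (Act a \<odot> x)"
| "axiom_inst \<gamma> ((Act a \<odot> x) \<lhd> y) (Act a \<odot> (x \<parallel> y))"
| "axiom_inst \<gamma> (\<sigma> x \<lhd> \<nu> y) (Act Delta)"
| "axiom_inst \<gamma> (\<sigma> x \<lhd> (\<nu> y \<oplus> \<sigma> z)) (\<sigma> (x \<lhd> z))"
| "axiom_inst \<gamma> ((x \<oplus> y) \<lhd> z) ((x \<lhd> z) \<oplus> (y \<lhd> z))"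
| "axiom_inst \<gamma> ((Act a \<odot> x) \<bowtie> Act b) ((Act a \<bowtie> Act b) \<odot> x)"
| "axiom_inst \<gamma> (Act a \<bowtie> (Act b \<odot> x)) ((Act a \<bowtie> Act b) \<odot> x)"
| "axiom_inst \<gamma> ((Act a \<odot> x) \<bowtie> (Act b \<odot> y)) ((Act a \<bowtie> Act b) \<odot> (x \<parallel> y))"
| "axiom_inst \<gamma> (\<nu> x \<bowtie> \<sigma> y) (Act Delta)"
| "axiom_inst \<gamma> (\<sigma> x \<bowtie> \<nu> y) (Act Delta)"
| "axiom_inst \<gamma> (\<sigma> x \<bowtie> \<sigma> y) (\<sigma> (x \<bowtie> y))"
| "axiom_inst \<gamma> ((x \<oplus> y) \<bowtie> z) ((x \<bowtie> z) \<oplus> (y \<bowtie> z))"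
| "axiom_inst \<gamma> (x \<bowtie> (y \<oplus> z)) ((x \<bowtie> y) \<oplus> (x \<bowtie> z))"
| "\<gamma> a b = c \<Longrightarrow> axiom_inst \<gamma> (Act a \<bowtie> Act b) (Act c)"
| "axiom_inst \<gamma> (\<nu> (Act a)) (Act a)"
| "axiom_inst \<gamma> (\<nu> (x \<oplus> y)) (\<nu> x \<oplus> \<nu> y)"
| "axiom_inst \<gamma> (\<nu> (x \<odot> y)) (\<nu> x \<odot> y)"
| "axiom_inst \<gamma> (\<nu> (\<sigma> x)) (Act Delta)"
| "axiom_inst \<gamma> (Act a \<odot> Act Tau) (Act a)"
| "axiom_inst \<gamma> (Act a \<odot> ((Act Tau \<odot> (\<nu> x \<oplus> y)) \<oplus> \<nu> x)) (Act a \<odot> (\<nu> x \<oplus> y))"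
| "axiom_inst \<gamma> (Act a \<odot> ((Act Tau \<odot> (\<nu> x \<oplus> y)) \<oplus> y)) (Act a \<odot> (\<nu> x \<oplus> y))"
| "axiom_inst \<gamma> (Act a \<odot> (\<sigma> (Act Tau \<odot> x) \<oplus> \<nu> y)) (Act a \<odot> (\<sigma> x \<oplus> \<nu> y))"

inductive derives ::
  "ptheory \<Rightarrow> 'a set \<Rightarrow> ('a act \<Rightarrow> 'a act \<Rightarrow> 'a act) \<Rightarrow> ('a, 'v) spec set \<Rightarrow>
   ('a, 'v) trm \<Rightarrow> ('a, 'v) trm \<Rightarrow> bool"
  for T A \<gamma> S where
  refl: "t \<in> terms T A S \<Longrightarrow> derives T A \<gamma> S t t"
| sym: "derives T A \<gamma> S s t \<Longrightarrow> derives T A \<gamma> S t s"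
| trans: "derives T A \<gamma> S s t \<Longrightarrow> derives T A \<gamma> S t u \<Longrightarrow> derives T A \<gamma> S s u"
| cong_Unary: "f \<in> unops T A \<Longrightarrow> derives T A \<gamma> S s t \<Longrightarrow> derives T A \<gamma> S (Unary f s) (Unary f t)"
| cong_Binary: "f \<in> binops T \<Longrightarrow> derives T A \<gamma> S s t \<Longrightarrow> derives T A \<gamma> S s' t' \<Longrightarrow>
    derives T A \<gamma> S (Binary f s s') (Binary f t t')"
| ax: "axiom_inst \<gamma> s t \<Longrightarrow> s \<in> terms T A S \<Longrightarrow> t \<in> terms T A S \<Longrightarrow> derives T A \<gamma> S s t"
| RDP: "E \<in> S \<Longrightarrow> E X = Some t \<Longrightarrow> derives T A \<gamma> S (Rec X E) (rec_inst E t)"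
| RSP: "E \<in> S \<Longrightarrow> (\<And>Y u. E Y = Some u \<Longrightarrow> derives T A \<gamma> S (f Y) (subst f u)) \<Longrightarrow>
    X \<in> dom E \<Longrightarrow> derives T A \<gamma> S (f X) (Rec X E)"

text \<open>
  The variables that have an occurrence outside all subterms \<open>a \<cdot> t'\<close> (\<open>a \<in> A\<close>) and \<open>\<sigma>(t')\<close>.
\<close>

fun exposed :: "('a, 'v) trm \<Rightarrow> 'v set" where
  "exposed (Var X) = {X}"
| "exposed (Act a) = {}"
| "exposed (Unary Delay t) = {}"
| "exposed (Unary f t) = exposed t"
| "exposed (Binary Seq (Act (Basic a)) t) = {}"
| "exposed (Binary f s t) = exposed s \<union> exposed t"
| "exposed (Rec X E) = {}"

text \<open>
  Absence of abstraction operators is part of guardedness of a variable occurrence; hence a term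
  without variable occurrences is guarded in any case.
\<close>

definition guarded :: "('a, 'v) trm \<Rightarrow> bool" where
  "guarded t \<longleftrightarrow> vars t = {} \<or> (abs_free t \<and> exposed t = {})"

text \<open>\<open>replace1 Y u s s'\<close>: exactly one occurrence of \<open>Y\<close> in \<open>s\<close> is replaced by \<open>u\<close>.\<close>

inductive replace1 :: "'v \<Rightarrow> ('a, 'v) trm \<Rightarrow> ('a, 'v) trm \<Rightarrow> ('a, 'v) trm \<Rightarrow> bool"
  for Y u where
  "replace1 Y u (Var Y) u"
| "replace1 Y u s s' \<Longrightarrow> replace1 Y u (Unary f s) (Unary f s')"
| "replace1 Y u s s' \<Longrightarrow> replace1 Y u (Binary f s t) (Binary f s' t)"
| "replace1 Y u t t' \<Longrightarrow> replace1 Y u (Binary f s t) (Binary f s t')"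

definition rewrite_step ::
  "ptheory \<Rightarrow> 'a set \<Rightarrow> ('a act \<Rightarrow> 'a act \<Rightarrow> 'a act) \<Rightarrow> ('a, 'v) spec set \<Rightarrow> ('a, 'v) spec \<Rightarrow> 'v \<Rightarrow>
   ('a, 'v) trm \<Rightarrow> ('a, 'v) trm \<Rightarrow> bool" where
  "rewrite_step T A \<gamma> S E X s s' \<longleftrightarrow>
     derives T A \<gamma> S s s' \<or> (\<exists>Y u. Y \<noteq> X \<and> E Y = Some u \<and> replace1 Y u s s')"

definition guarded_modulo ::
  "ptheory \<Rightarrow> 'a set \<Rightarrow> ('a act \<Rightarrow> 'a act \<Rightarrow> 'a act) \<Rightarrow> ('a, 'v) spec set \<Rightarrow> ('a, 'v) spec \<Rightarrow> bool" where
  "guarded_modulo T A \<gamma> S E \<longleftrightarrow>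
     (\<forall>X t. E X = Some t \<longrightarrow> (\<exists>t'. (rewrite_step T A \<gamma> S E X)\<^sup>*\<^sup>* t t' \<and> guarded t'))"

definition spec_over :: "ptheory \<Rightarrow> 'a set \<Rightarrow> ('a, 'v) spec set \<Rightarrow> ('a, 'v) spec \<Rightarrow> bool" where
  "spec_over T A S E \<longleftrightarrow> (\<forall>t \<in> ran E. t \<in> terms T A S \<and> vars t \<subseteq> dom E)"

primrec stage ::
  "ptheory \<Rightarrow> 'a set \<Rightarrow> ('a act \<Rightarrow> 'a act \<Rightarrow> 'a act) \<Rightarrow> nat \<Rightarrow> ('a, 'v) spec set" where
  "stage T A \<gamma> 0 = {}"
| "stage T A \<gamma> (Suc i) = stage T A \<gamma> i \<union>
     {E. spec_over T A (stage T A \<gamma> i) E \<and> guarded_modulo T A \<gamma> (stage T A \<gamma> i) E}"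

definition rec_specs ::
  "ptheory \<Rightarrow> 'a set \<Rightarrow> ('a act \<Rightarrow> 'a act \<Rightarrow> 'a act) \<Rightarrow> ('a, 'v) spec set" where
  "rec_specs T A \<gamma> = (\<Union>i. stage T A \<gamma> i)"

definition closed_REC_terms ::
  "ptheory \<Rightarrow> 'a set \<Rightarrow> ('a act \<Rightarrow> 'a act \<Rightarrow> 'a act) \<Rightarrow> ('a, 'v) trm set" where
  "closed_REC_terms T A \<gamma> = {t \<in> terms T A (rec_specs T A \<gamma>). vars t = {}}"

definition REC_derives ::
  "ptheory \<Rightarrow> 'a set \<Rightarrow> ('a act \<Rightarrow> 'a act \<Rightarrow> 'a act) \<Rightarrow> ('a, 'v) trm \<Rightarrow> ('a, 'v) trm \<Rightarrow> bool" where
  "REC_derives T A \<gamma> = derives T A \<gamma> (rec_specs T A \<gamma>)"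

end

theory Submission
  imports Defs "HOL-Library.Countable_Set"
begin

text \<open>
  Suppose that every member of a set of closed terms equals a tree, that is, a finite sum of
  constants and of prefixed terms \<open>a\<cdot>x\<close>, \<open>\<sigma>(x)\<close> and \<open>\<tau>\<cdot>h\<close>, where \<open>x\<close> is again in the set and \<open>h\<close> is a
  tree. The terms reachable from a given one are countably many, and with a variable for each of
  them the trees form a guarded specification over \<open>BPA\<^sup>\<tau>\<^sub>d\<^sub>r\<^sub>t\<close>; RSP identifies the term with its
  solution. So the point is to find trees.

  If two basic actions communicate to \<open>\<tau>\<close>, RSP proves \<open>\<tau>\<cdot>r = \<tau>\<cdot>\<delta>\<close> for all closed \<open>r\<close>, and
  head normal forms of closed terms are trees.

  Otherwise a trace model shows which head normal forms can be unfolded to trees. A recursion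
  constant is interpreted by the least solution, and a marker in the traces, produced by
  abstraction only, indicates unboundedly many silent steps. The model satisfies RSP, every closed
  term without the marker at its root equals a tree, and abstraction-free terms do not have the
  marker at all. The model is needed because a right-hand side is guarded as soon as it can be
  rewritten to a closed term, and this term may contain abstraction.
\<close>

section \<open>Trace semantics\<close>

text \<open>The obstruction shows in \<open>\<tau> I\<close> applied to the solution of X =
  a\<cdot>X with a \<in> I: unfolding gives \<tau> followed by the same term, so no number of
  unfoldings reaches a guard. A tree, by contrast, nests its \<tau> prefixes finitely and never has
  unboundedly many silent steps at its root. If nothing communicates to \<tau>, divergence at the
  root is exactly what separates closed terms from trees, so the claim about closed terms has two
  layers: always a head normal form, and a tree unless the root diverges. The layers depend on each
  other, as a diverging operand may occur in a non-diverging term, where only its head normal form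
  is available.

  The criterion has to survive every derivation, RSP included. Absence of abstraction does not: an
  axiom read backwards introduces it. An invariant in a sound model does, and soundness carries the
  absence of \<open>Dv\<close> from an abstraction-free term to the trees found for it.

  The first step is kept apart from the rest because +, \<nu> and the merges distinguish
  \<tau>\<cdot>x from x, whereas behind an action the two are equal.\<close>

datatype ending = Part | Tick | Dv

text \<open>
  A trace of a process keeps the time steps at the root and the first action exactly, but drops all
  later silent steps; this is the information preserved by rooted branching bisimilarity that the
  operators need. \<open>Idle k\<close> stands for \<open>k + 1\<close> time steps. \<open>Run k \<alpha> w e\<close> stands for \<open>k\<close> time
  steps, then the action \<open>\<alpha>\<close> (\<open>None\<close> is \<open>\<tau>\<close>), then \<open>w\<close>, in which \<open>None\<close> is a time step.
  The ending \<open>Dv\<close> records that unboundedly many silent steps are possible.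
\<close>

datatype 'a rtrace = Idle nat | Run nat "'a option" "'a option list" ending

type_synonym 'a wtrace = "'a option list \<times> ending"

definition lab :: "'a option \<Rightarrow> 'a option list" where
  "lab \<alpha> = (case \<alpha> of None \<Rightarrow> [] | Some a \<Rightarrow> [Some a])"

lemma lab_simps [simp]: "lab None = []" "lab (Some a) = [Some a]"
  by (simp_all add: lab_def)

fun weak :: "'a rtrace \<Rightarrow> 'a wtrace" where
  "weak (Idle k) = (replicate (Suc k) None, Part)"
| "weak (Run k \<alpha> w e) = (replicate k None @ lab \<alpha> @ w, e)"

text \<open>What remains visible of a process once an action precedes it: its silent first steps are
  no longer at the root. The empty trace is supplied even for \<delta>, so that a\<cdot>\<delta> has
  the trace that stops after a.\<close>

definition wk :: "'a rtrace set \<Rightarrow> 'a wtrace set" where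
  "wk P = insert ([], Part) (weak ` P)"

lemma wk_Nil [simp]: "([], Part) \<in> wk P"
  by (simp add: wk_def)

lemma wk_Un: "wk (P \<union> Q) = wk P \<union> wk Q"
  by (auto simp: wk_def)

lemma wk_mono: "P \<subseteq> Q \<Longrightarrow> wk P \<subseteq> wk Q"
  by (auto simp: wk_def)

lemma wk_IdleI: "Idle k \<in> P \<Longrightarrow> (replicate (Suc k) None, Part) \<in> wk P"
  by (force simp: wk_def image_iff)

lemma wk_RunI: "Run k \<alpha> w e \<in> P \<Longrightarrow> (replicate k None @ lab \<alpha> @ w, e) \<in> wk P"
  by (force simp: wk_def image_iff)

lemma wk_cases:
  assumes "p \<in> wk P"
  obtains "p = ([], Part)" | k where "Idle k \<in> P" "p = (replicate (Suc k) None, Part)"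
  | k \<alpha> w e where "Run k \<alpha> w e \<in> P" "p = (replicate k None @ lab \<alpha> @ w, e)"
proof -
  from assms consider "p = ([], Part)" | r where "r \<in> P" "p = weak r"
    by (auto simp: wk_def)
  then show thesis
  proof cases
    case (2 r)
    then show thesis by (cases r) (auto intro: that)
  qed (rule that)
qed

lemma rset_eqI:
  assumes "\<And>k. Idle k \<in> P \<longleftrightarrow> Idle k \<in> Q"
    and "\<And>k \<alpha> w e. Run k \<alpha> w e \<in> P \<longleftrightarrow> Run k \<alpha> w e \<in> Q"
  shows "P = Q"
proof (rule set_eqI)
  fix r show "r \<in> P \<longleftrightarrow> r \<in> Q" by (cases r) (simp_all add: assms)
qed

lemma rset_subI:
  assumes "\<And>k. Idle k \<in> P \<Longrightarrow> Idle k \<in> Q"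
    and "\<And>k \<alpha> w e. Run k \<alpha> w e \<in> P \<Longrightarrow> Run k \<alpha> w e \<in> Q"
  shows "P \<subseteq> Q"
proof
  fix r assume "r \<in> P" then show "r \<in> Q" by (cases r) (simp_all add: assms)
qed

text \<open>\<open>Tick\<close> is successful termination, \<open>Part\<close> a trace broken off.
  \<delta> has no trace at all, not even \<open>Idle\<close>: the constants do not let time
  pass.\<close>

fun actD :: "'a act \<Rightarrow> 'a rtrace set" where
  "actD (Basic a) = {Run 0 (Some a) [] Tick, Run 0 (Some a) [] Part}"
| "actD Tau = {Run 0 None [] Tick, Run 0 None [] Part}"
| "actD Delta = {}"

definition delayD :: "'a rtrace set \<Rightarrow> 'a rtrace set" where
  "delayD P = insert (Idle 0) ({Idle (Suc k) |k. Idle k \<in> P} \<union>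
    {Run (Suc k) \<alpha> w e |k \<alpha> w e. Run k \<alpha> w e \<in> P})"

lemma delayD_iff [simp]:
  "Idle 0 \<in> delayD P"
  "Idle (Suc k) \<in> delayD P \<longleftrightarrow> Idle k \<in> P"
  "Run 0 \<alpha> w e \<notin> delayD P"
  "Run (Suc k) \<alpha> w e \<in> delayD P \<longleftrightarrow> Run k \<alpha> w e \<in> P"
  by (auto simp: delayD_def)

definition timeoutD :: "'a rtrace set \<Rightarrow> 'a rtrace set" where
  "timeoutD P = {Run 0 \<alpha> w e |\<alpha> w e. Run 0 \<alpha> w e \<in> P}"

lemma timeoutD_iff [simp]:
  "Idle k \<notin> timeoutD P"
  "Run k \<alpha> w e \<in> timeoutD P \<longleftrightarrow> k = 0 \<and> Run 0 \<alpha> w e \<in> P"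
  by (auto simp: timeoutD_def)

definition encapD :: "'a set \<Rightarrow> 'a rtrace set \<Rightarrow> 'a rtrace set" where
  "encapD H P = {Idle k |k. Idle k \<in> P} \<union>
    {Run k \<alpha> w e |k \<alpha> w e. Run k \<alpha> w e \<in> P \<and> set (\<alpha> # w) \<inter> Some ` H = {}}"

lemma encapD_iff [simp]:
  "Idle k \<in> encapD H P \<longleftrightarrow> Idle k \<in> P"
  "Run k \<alpha> w e \<in> encapD H P \<longleftrightarrow> Run k \<alpha> w e \<in> P \<and> set (\<alpha> # w) \<inter> Some ` H = {}"
  unfolding encapD_def by blast+

definition seqW :: "'a wtrace set \<Rightarrow> 'a wtrace set \<Rightarrow> 'a wtrace set" where
  "seqW U V = {(w, e). e \<noteq> Tick \<and> (w, e) \<in> U} \<union> {(u @ v, e) |u v e. (u, Tick) \<in> U \<and> (v, e) \<in> V}"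

definition after :: "'a rtrace set \<Rightarrow> nat \<Rightarrow> 'a option \<Rightarrow> 'a wtrace set" where
  "after P k \<alpha> = {(w, e). Run k \<alpha> w e \<in> P}"

lemma after_iff [simp]: "(w, e) \<in> after P k \<alpha> \<longleftrightarrow> Run k \<alpha> w e \<in> P"
  by (simp add: after_def)

text \<open>The second factor enters through \<open>wk\<close>, since an action of the first always
  precedes it. For the same reason idling at the root depends on the first factor alone.\<close>

definition seqD :: "'a rtrace set \<Rightarrow> 'a rtrace set \<Rightarrow> 'a rtrace set" where
  "seqD P Q = {Idle k |k. Idle k \<in> P} \<union>
    {Run k \<alpha> w e |k \<alpha> w e. (w, e) \<in> seqW (after P k \<alpha>) (wk Q)}"

lemma seqD_iff [simp]:
  "Idle k \<in> seqD P Q \<longleftrightarrow> Idle k \<in> P"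
  "Run k \<alpha> w e \<in> seqD P Q \<longleftrightarrow> (w, e) \<in> seqW (after P k \<alpha>) (wk Q)"
  by (auto simp: seqD_def)

definition hide :: "'a set \<Rightarrow> 'a option list \<Rightarrow> 'a option list" where
  "hide I = filter (\<lambda>x. x \<notin> Some ` I)"

definition hide_lab :: "'a set \<Rightarrow> 'a option \<Rightarrow> 'a option" where
  "hide_lab I \<alpha> = (if \<alpha> \<in> Some ` I then None else \<alpha>)"

text \<open>
  Divergence is approximated by unboundedness of the number of hidden actions. In contrast to the
  existence of an infinite hidden run, this is determined by the finite traces, and solutions of
  guarded specifications are therefore unique.
\<close>

definition unbounded :: "'a set \<Rightarrow> 'a wtrace set \<Rightarrow> 'a option list \<Rightarrow> bool" where
  "unbounded I U w \<longleftrightarrow> (\<forall>n. \<exists>v e. n \<le> length v \<and> set v \<subseteq> Some ` I \<and> (w @ v, e) \<in> U)"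

definition abstrW :: "'a set \<Rightarrow> 'a wtrace set \<Rightarrow> 'a wtrace set" where
  "abstrW I U = {(hide I w, e) |w e. (w, e) \<in> U} \<union> {(hide I w, Dv) |w. unbounded I U w}"

text \<open>A hidden first action becomes \<open>None\<close> instead of vanishing, because a silent
  step at the root stays observable. Unboundedness is counted after this step.\<close>

definition abstrD :: "'a set \<Rightarrow> 'a rtrace set \<Rightarrow> 'a rtrace set" where
  "abstrD I P = {Idle k |k. Idle k \<in> P} \<union>
    {Run k (hide_lab I \<alpha>) w e |k \<alpha> w e. (w, e) \<in> abstrW I (after P k \<alpha>)}"

lemma abstrD_iff [simp]:
  "Idle k \<in> abstrD I P \<longleftrightarrow> Idle k \<in> P"
  "Run k \<beta> w e \<in> abstrD I P \<longleftrightarrow> (\<exists>\<alpha>. \<beta> = hide_lab I \<alpha> \<and> (w, e) \<in> abstrW I (after P k \<alpha>))"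
  by (auto simp: abstrD_def)

text \<open>\<open>resid k Q\<close>: the weak traces of what is left of \<open>Q\<close> after \<open>k\<close> initial time steps.\<close>

inductive_set resid :: "nat \<Rightarrow> 'a rtrace set \<Rightarrow> 'a wtrace set" for k Q where
  "k = 0 \<or> Idle (k - 1) \<in> Q \<Longrightarrow> ([], Part) \<in> resid k Q"
| "Idle (k + j) \<in> Q \<Longrightarrow> (replicate (Suc j) None, Part) \<in> resid k Q"
| "Run (k + j) \<alpha> w e \<in> Q \<Longrightarrow> (replicate j None @ lab \<alpha> @ w, e) \<in> resid k Q"

text \<open>Communications that yield \<tau> have no place in this relation;
  \<open>no_tau_comm\<close> excludes them wherever the model is shown to be sound.\<close>

definition comm :: "'a set \<Rightarrow> ('a act \<Rightarrow> 'a act \<Rightarrow> 'a act) \<Rightarrow> 'a \<Rightarrow> 'a \<Rightarrow> 'a \<Rightarrow> bool" where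
  "comm A \<gamma> a b c \<longleftrightarrow> a \<in> A \<and> b \<in> A \<and> \<gamma> (Basic a) (Basic b) = Basic c"

text \<open>A component that has terminated lets the other go on alone, through time steps as well.
  One that is merely broken off can be overtaken by actions, but not by a time step, which both have
  to take.\<close>

inductive mg :: "('a \<Rightarrow> 'a \<Rightarrow> 'a \<Rightarrow> bool) \<Rightarrow> 'a wtrace \<Rightarrow> 'a wtrace \<Rightarrow> 'a wtrace \<Rightarrow> bool" for C where
  tickL: "mg C ([], Tick) q q"
| tickR: "mg C p ([], Tick) p"
| nil: "e \<noteq> Tick \<Longrightarrow> f \<noteq> Tick \<Longrightarrow>
    mg C ([], e) ([], f) ([], if e = Dv \<or> f = Dv then Dv else Part)"
| left: "mg C (u, e) q (w, g) \<Longrightarrow> mg C (Some a # u, e) q (Some a # w, g)"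
| right: "mg C p (v, f) (w, g) \<Longrightarrow> mg C p (Some a # v, f) (Some a # w, g)"
| time: "mg C (u, e) (v, f) (w, g) \<Longrightarrow> mg C (None # u, e) (None # v, f) (None # w, g)"
| comm: "mg C (u, e) (v, f) (w, g) \<Longrightarrow> C a b c \<Longrightarrow> mg C (Some a # u, e) (Some b # v, f) (Some c # w, g)"

definition mgS :: "('a \<Rightarrow> 'a \<Rightarrow> 'a \<Rightarrow> bool) \<Rightarrow> 'a wtrace set \<Rightarrow> 'a wtrace set \<Rightarrow> 'a wtrace set" where
  "mgS C U V = {r. \<exists>p\<in>U. \<exists>q\<in>V. mg C p q r}"

definition lmergeD :: "('a \<Rightarrow> 'a \<Rightarrow> 'a \<Rightarrow> bool) \<Rightarrow> 'a rtrace set \<Rightarrow> 'a rtrace set \<Rightarrow> 'a rtrace set" where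
  "lmergeD C P Q = {Idle k |k. Idle k \<in> P \<and> Idle k \<in> Q} \<union>
    {Run k \<alpha> w e |k \<alpha> w e. (w, e) \<in> mgS C (after P k \<alpha>) (resid k Q)}"

lemma lmergeD_iff [simp]:
  "Idle k \<in> lmergeD C P Q \<longleftrightarrow> Idle k \<in> P \<and> Idle k \<in> Q"
  "Run k \<alpha> w e \<in> lmergeD C P Q \<longleftrightarrow> (w, e) \<in> mgS C (after P k \<alpha>) (resid k Q)"
  by (auto simp: lmergeD_def)

definition cmergeD :: "('a \<Rightarrow> 'a \<Rightarrow> 'a \<Rightarrow> bool) \<Rightarrow> 'a rtrace set \<Rightarrow> 'a rtrace set \<Rightarrow> 'a rtrace set" where
  "cmergeD C P Q = {Idle k |k. Idle k \<in> P \<and> Idle k \<in> Q} \<union>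
    {Run k (Some c) w e |k a b c w e. C a b c \<and> (w, e) \<in> mgS C (after P k (Some a)) (after Q k (Some b))}"

lemma cmergeD_iff [simp]:
  "Idle k \<in> cmergeD C P Q \<longleftrightarrow> Idle k \<in> P \<and> Idle k \<in> Q"
  "Run k \<gamma> w e \<in> cmergeD C P Q \<longleftrightarrow> (\<exists>a b c. \<gamma> = Some c \<and> C a b c \<and>
    (w, e) \<in> mgS C (after P k (Some a)) (after Q k (Some b)))"
  by (auto simp: cmergeD_def)

definition parD :: "('a \<Rightarrow> 'a \<Rightarrow> 'a \<Rightarrow> bool) \<Rightarrow> 'a rtrace set \<Rightarrow> 'a rtrace set \<Rightarrow> 'a rtrace set" where
  "parD C P Q = lmergeD C P Q \<union> lmergeD C Q P \<union> cmergeD C P Q"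

fun unD :: "'a unop \<Rightarrow> 'a rtrace set \<Rightarrow> 'a rtrace set" where
  "unD Delay = delayD"
| "unD (Encap H) = encapD H"
| "unD (Abstr I) = abstrD I"
| "unD Timeout = timeoutD"

fun binD :: "('a \<Rightarrow> 'a \<Rightarrow> 'a \<Rightarrow> bool) \<Rightarrow> binop \<Rightarrow> 'a rtrace set \<Rightarrow> 'a rtrace set \<Rightarrow> 'a rtrace set" where
  "binD C Alt = (\<union>)"
| "binD C Seq = seqD"
| "binD C Par = parD C"
| "binD C LeftMerge = lmergeD C"
| "binD C CommMerge = cmergeD C"

definition tick_closed :: "'a rtrace set \<Rightarrow> bool" where
  "tick_closed P \<longleftrightarrow> (\<forall>k \<alpha> w. Run k \<alpha> w Tick \<in> P \<longrightarrow> Run k \<alpha> w Part \<in> P)"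

definition tick_close :: "'a rtrace set \<Rightarrow> 'a rtrace set" where
  "tick_close P = P \<union> {Run k \<alpha> w Part |k \<alpha> w. Run k \<alpha> w Tick \<in> P}"

text \<open>
  Closing the values of variables makes all denotations \<open>tick_closed\<close>, as the axioms for the merge
  of constants require.
\<close>

primrec den :: "('a \<Rightarrow> 'a \<Rightarrow> 'a \<Rightarrow> bool) \<Rightarrow> ('a, 'v) trm \<Rightarrow> ('v \<Rightarrow> 'a rtrace set) \<Rightarrow> 'a rtrace set" where
  "den C (Var X) = (\<lambda>\<rho>. tick_close (\<rho> X))"
| "den C (Act a) = (\<lambda>\<rho>. actD a)"
| "den C (Unary f t) = (\<lambda>\<rho>. unD f (den C t \<rho>))"
| "den C (Binary f s t) = (\<lambda>\<rho>. binD C f (den C s \<rho>) (den C t \<rho>))"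
| "den C (Rec X E) = (\<lambda>\<rho>. lfp (\<lambda>r Y. case map_option (den C) (E Y) of None \<Rightarrow> {} | Some d \<Rightarrow> d r) X)"

section \<open>Monotonicity of the denotation\<close>

lemma unbounded_mono: "unbounded I U w \<Longrightarrow> U \<subseteq> V \<Longrightarrow> unbounded I V w"
  unfolding unbounded_def by blast

lemma abstrW_mono: "U \<subseteq> V \<Longrightarrow> abstrW I U \<subseteq> abstrW I V"
  unfolding abstrW_def using unbounded_mono by blast

lemma seqW_mono: "U \<subseteq> U' \<Longrightarrow> V \<subseteq> V' \<Longrightarrow> seqW U V \<subseteq> seqW U' V'"
  unfolding seqW_def by blast

lemma mgS_mono: "U \<subseteq> U' \<Longrightarrow> V \<subseteq> V' \<Longrightarrow> mgS C U V \<subseteq> mgS C U' V'"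
  unfolding mgS_def by blast

lemma after_mono: "P \<subseteq> Q \<Longrightarrow> after P k \<alpha> \<subseteq> after Q k \<alpha>"
  by (auto simp: after_def)

lemma resid_mono: "P \<subseteq> Q \<Longrightarrow> resid k P \<subseteq> resid k Q"
  by (auto elim!: resid.cases intro: resid.intros)

lemma delayD_mono: "P \<subseteq> Q \<Longrightarrow> delayD P \<subseteq> delayD Q"
  unfolding delayD_def by blast

lemma timeoutD_mono: "P \<subseteq> Q \<Longrightarrow> timeoutD P \<subseteq> timeoutD Q"
  unfolding timeoutD_def by blast

lemma encapD_mono: "P \<subseteq> Q \<Longrightarrow> encapD H P \<subseteq> encapD H Q"
  by (rule rset_subI) auto

lemma abstrD_mono:
  assumes "P \<subseteq> Q"
  shows "abstrD I P \<subseteq> abstrD I Q"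
proof (rule rset_subI)
  show "Run k \<beta> w e \<in> abstrD I Q" if "Run k \<beta> w e \<in> abstrD I P" for k \<beta> w e
    using that abstrW_mono[OF after_mono[OF assms]] unfolding abstrD_iff by blast
qed (use assms in auto)

lemma seqD_mono:
  assumes "P \<subseteq> P'" "Q \<subseteq> Q'"
  shows "seqD P Q \<subseteq> seqD P' Q'"
proof (rule rset_subI)
  show "Run k \<beta> w e \<in> seqD P' Q'" if "Run k \<beta> w e \<in> seqD P Q" for k \<beta> w e
    using that seqW_mono[OF after_mono[OF assms(1)] wk_mono[OF assms(2)]] unfolding seqD_iff by blast
qed (use assms in auto)

lemma lmergeD_mono:
  assumes "P \<subseteq> P'" "Q \<subseteq> Q'"
  shows "lmergeD C P Q \<subseteq> lmergeD C P' Q'"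
proof (rule rset_subI)
  show "Run k \<beta> w e \<in> lmergeD C P' Q'" if "Run k \<beta> w e \<in> lmergeD C P Q" for k \<beta> w e
    using that mgS_mono[OF after_mono[OF assms(1)] resid_mono[OF assms(2)]] unfolding lmergeD_iff by blast
qed (use assms in auto)

lemma cmergeD_mono:
  assumes "P \<subseteq> P'" "Q \<subseteq> Q'"
  shows "cmergeD C P Q \<subseteq> cmergeD C P' Q'"
proof (rule rset_subI)
  show "Run k \<beta> w e \<in> cmergeD C P' Q'" if "Run k \<beta> w e \<in> cmergeD C P Q" for k \<beta> w e
    using that mgS_mono[OF after_mono[OF assms(1)] after_mono[OF assms(2)]] unfolding cmergeD_iff by blast
qed (use assms in auto)

lemma parD_mono: "P \<subseteq> P' \<Longrightarrow> Q \<subseteq> Q' \<Longrightarrow> parD C P Q \<subseteq> parD C P' Q'"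
  unfolding parD_def by (intro Un_mono lmergeD_mono cmergeD_mono)

lemma tick_close_mono: "P \<subseteq> Q \<Longrightarrow> tick_close P \<subseteq> tick_close Q"
  unfolding tick_close_def by blast

lemma den_mono: "\<rho> \<le> \<rho>' \<Longrightarrow> den C t \<rho> \<subseteq> den C t \<rho>'"
proof (induction t)
  case (Unary f t)
  then show ?case
    by (cases f) (simp_all add: delayD_mono timeoutD_mono encapD_mono abstrD_mono)
next
  case (Binary f s t)
  then show ?case
    by (cases f) (simp_all add: le_supI1 le_supI2 seqD_mono lmergeD_mono cmergeD_mono parD_mono)
qed (auto simp: le_fun_def tick_close_mono)

definition rec_env :: "('a \<Rightarrow> 'a \<Rightarrow> 'a \<Rightarrow> bool) \<Rightarrow> ('a, 'v) spec \<Rightarrow> 'v \<Rightarrow> 'a rtrace set" where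
  "rec_env C E = lfp (\<lambda>r Y. case E Y of None \<Rightarrow> {} | Some u \<Rightarrow> den C u r)"

lemma den_Rec: "den C (Rec X E) \<rho> = rec_env C E X"
  unfolding rec_env_def den.simps
  by (rule arg_cong[where f = "\<lambda>F. lfp F X"]) (auto simp: fun_eq_iff split: option.split)

declare den.simps(5) [simp del]
declare den_Rec [simp]

lemma rec_env_mono: "mono (\<lambda>r Y. case E Y of None \<Rightarrow> {} | Some u \<Rightarrow> den C u r)"
  by (intro monoI le_funI) (simp add: den_mono split: option.split)

lemma rec_env_unfold: "rec_env C E Y = (case E Y of None \<Rightarrow> {} | Some u \<Rightarrow> den C u (rec_env C E))"
  unfolding rec_env_def by (subst lfp_unfold[OF rec_env_mono]) simp

section \<open>Closure of denotations under breaking off terminated traces\<close>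

lemma tick_closed_tick_close: "tick_closed (tick_close P)"
  by (auto simp: tick_closed_def tick_close_def)

lemma tick_close_id: "tick_closed P \<Longrightarrow> tick_close P = P"
  by (auto simp: tick_closed_def tick_close_def)

lemma tick_closed_wk: "tick_closed P \<Longrightarrow> (w, Tick) \<in> wk P \<Longrightarrow> (w, Part) \<in> wk P"
  by (erule wk_cases) (auto simp: tick_closed_def intro: wk_RunI)

text \<open>In a terminated merge one component finishes last; breaking off that component breaks
  off the merge. This gives closure of the merge operators.\<close>

lemma mg_Tick:
  assumes "mg C p q r" "snd r = Tick"
  shows "snd p = Tick \<and> snd q = Tick \<and>
    (mg C (fst p, Part) q (fst r, Part) \<or> mg C p (fst q, Part) (fst r, Part))"
  using assms by induction (auto intro: mg.intros split: if_splits)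

lemma mgS_Tick:
  assumes "\<And>w. (w, Tick) \<in> U \<Longrightarrow> (w, Part) \<in> U" "\<And>w. (w, Tick) \<in> V \<Longrightarrow> (w, Part) \<in> V" "(w, Tick) \<in> mgS C U V"
  shows "(w, Part) \<in> mgS C U V"
proof -
  from assms(3) obtain p q where "p \<in> U" "q \<in> V" "mg C p q (w, Tick)" by (auto simp: mgS_def)
  moreover from mg_Tick[OF this(3)] obtain u v where "p = (u, Tick)" "q = (v, Tick)"
    "mg C (u, Part) q (w, Part) \<or> mg C p (v, Part) (w, Part)"
    by (cases p; cases q) auto
  ultimately show ?thesis using assms(1,2) unfolding mgS_def by blast
qed

lemma tick_closed_resid: "tick_closed Q \<Longrightarrow> (w, Tick) \<in> resid k Q \<Longrightarrow> (w, Part) \<in> resid k Q"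
  by (erule resid.cases) (auto simp: tick_closed_def intro: resid.intros)

lemma tick_closed_lmergeD: "tick_closed P \<Longrightarrow> tick_closed Q \<Longrightarrow> tick_closed (lmergeD C P Q)"
  unfolding tick_closed_def[of "lmergeD C P Q"] lmergeD_iff
  by (intro allI impI, rule mgS_Tick) (auto simp: tick_closed_def[of P] intro: tick_closed_resid)

lemma tick_closed_cmergeD:
  assumes "tick_closed P" "tick_closed Q"
  shows "tick_closed (cmergeD C P Q)"
proof -
  have "(w, Part) \<in> mgS C (after P k \<alpha>) (after Q k \<beta>)" if "(w, Tick) \<in> mgS C (after P k \<alpha>) (after Q k \<beta>)" for w k \<alpha> \<beta>
    by (rule mgS_Tick[OF _ _ that]) (use assms in \<open>auto simp: tick_closed_def\<close>)
  then show ?thesis unfolding tick_closed_def[of "cmergeD C P Q"] cmergeD_iff by blast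
qed

lemma tick_closed_delayD: "tick_closed P \<Longrightarrow> tick_closed (delayD P)"
  by (auto simp: tick_closed_def delayD_def)

lemma tick_closed_seqD:
  assumes "tick_closed P" "tick_closed Q"
  shows "tick_closed (seqD P Q)"
  unfolding tick_closed_def[of "seqD P Q"]
proof (intro allI impI)
  fix k \<alpha> w assume "Run k \<alpha> w Tick \<in> seqD P Q"
  then obtain u v where "w = u @ v" "Run k \<alpha> u Tick \<in> P" "(v, Tick) \<in> wk Q" by (auto simp: seqW_def)
  then show "Run k \<alpha> w Part \<in> seqD P Q"
    using tick_closed_wk[OF assms(2)] by (auto simp: seqW_def)
qed

lemma tick_closed_abstrD: "tick_closed P \<Longrightarrow> tick_closed (abstrD I P)"
  unfolding tick_closed_def abstrD_iff abstrW_def by fastforce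

lemma tick_closed_den: "tick_closed (den C t \<rho>)"
proof (induction t arbitrary: \<rho>)
  case (Var X)
  then show ?case by (simp add: tick_closed_tick_close)
next
  case (Act a)
  then show ?case by (cases a) (auto simp: tick_closed_def)
next
  case (Unary f t)
  then show ?case
    by (cases f) (simp_all add: tick_closed_delayD tick_closed_abstrD, simp_all add: tick_closed_def)
next
  case (Binary f s t)
  have "tick_closed (P \<union> Q)" if "tick_closed P" "tick_closed Q" for P Q :: "'a rtrace set"
    using that by (auto simp: tick_closed_def)
  with Binary show ?case
    by (cases f) (simp_all add: tick_closed_seqD tick_closed_lmergeD tick_closed_cmergeD parD_def)
next
  case (Rec X E)
  have "tick_closed (rec_env C E X)"
    using Rec[of "E X"] by (subst rec_env_unfold) (auto split: option.split simp: tick_closed_def[of "{}"])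
  then show ?case by simp
qed

lemma den_subst: "den C (subst f t) \<rho> = den C t (\<lambda>X. den C (f X) \<rho>)"
  by (induction t) (auto simp: tick_close_id tick_closed_den)

lemma den_vars_cong: "(\<And>X. X \<in> vars t \<Longrightarrow> \<rho> X = \<rho>' X) \<Longrightarrow> den C t \<rho> = den C t \<rho>'"
  by (induction t) auto

section \<open>Merging of weak traces\<close>

lemma seqW_assoc: "([], Part) \<in> V \<Longrightarrow> seqW (seqW U V) W = seqW U (seqW V W)"
  unfolding seqW_def by (auto; metis append.assoc)

lemma wk_seqD: "wk (seqD P Q) = seqW (wk P) (wk Q)"
proof (rule set_eqI, rule prod.exhaust)
  fix p w e assume p: "p = (w :: 'a option list, e :: ending)"
  show "p \<in> wk (seqD P Q) \<longleftrightarrow> p \<in> seqW (wk P) (wk Q)"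
  proof
    assume "p \<in> wk (seqD P Q)"
    then show "p \<in> seqW (wk P) (wk Q)"
    proof (cases rule: wk_cases)
      case (3 k \<alpha> w e)
      then show ?thesis by (fastforce simp: seqW_def dest: wk_RunI)
    qed (auto simp: seqW_def dest: wk_IdleI)
  next
    assume "p \<in> seqW (wk P) (wk Q)"
    then consider "e \<noteq> Tick" "(w, e) \<in> wk P"
      | u v where "w = u @ v" "(u, Tick) \<in> wk P" "(v, e) \<in> wk Q"
      by (auto simp: seqW_def p)
    then show "p \<in> wk (seqD P Q)"
    proof cases
      case 1
      from 1(2) show ?thesis
      proof (cases rule: wk_cases)
        case (2 k) then show ?thesis using wk_IdleI[of k "seqD P Q"] p by simp
      next
        case (3 k \<alpha> w' e')
        then show ?thesis using wk_RunI[of k \<alpha> w' e' "seqD P Q"] p 1 by (simp add: seqW_def)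
      qed (simp add: p)
    next
      case 2
      from 2(2) show ?thesis
      proof (cases rule: wk_cases)
        case (3 k \<alpha> w' e')
        then have "Run k \<alpha> (w' @ v) e \<in> seqD P Q" using 2 by (auto simp: seqW_def)
        from wk_RunI[OF this] show ?thesis using 3 2 p by simp
      qed auto
    qed
  qed
qed

lemma wk_delayD: "wk (delayD P) = insert ([], Part) ((\<lambda>(w, e). (None # w, e)) ` wk P)"
proof (intro equalityI subsetI)
  fix p assume "p \<in> wk (delayD P)"
  then show "p \<in> insert ([], Part) ((\<lambda>(w, e). (None # w, e)) ` wk P)"
  proof (cases rule: wk_cases)
    case (2 k)
    then show ?thesis
      by (cases k) (auto intro: image_eqI[of _ _ "([], Part)"] image_eqI[of _ _ "(replicate k None, Part)"] dest: wk_IdleI)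
  next
    case (3 k \<alpha> w e)
    then show ?thesis
      by (cases k) (auto intro: image_eqI[of _ _ "(replicate (k - 1) None @ lab \<alpha> @ w, e)"] dest: wk_RunI)
  qed simp
next
  fix p assume "p \<in> insert ([], Part) ((\<lambda>(w, e). (None # w, e)) ` wk P)"
  then consider "p = ([], Part)" | w e where "p = (None # w, e)" "(w, e) \<in> wk P" by auto
  then show "p \<in> wk (delayD P)"
  proof cases
    case 2
    from 2(2) show ?thesis
    proof (cases rule: wk_cases)
      case 1 then show ?thesis using 2 wk_IdleI[of 0 "delayD P"] by simp
    next
      case (2 k) then show ?thesis using \<open>p = _\<close> wk_IdleI[of "Suc k" "delayD P"] by simp
    next
      case (3 k \<alpha> w e) then show ?thesis using \<open>p = _\<close> wk_RunI[of "Suc k" \<alpha> w e "delayD P"] by simp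
    qed
  qed simp
qed

lemma mgSI: "p \<in> U \<Longrightarrow> q \<in> V \<Longrightarrow> mg C p q r \<Longrightarrow> r \<in> mgS C U V"
  by (auto simp: mgS_def)

lemma mg_sym:
  assumes "\<forall>a b c. C a b c \<longrightarrow> C b a c" "mg C p q r"
  shows "mg C q p r"
  using assms(2)
proof induction
  case (nil e f)
  then show ?case using mg.nil[of f e C] by (simp add: disj_commute)
qed (auto intro: mg.intros assms(1)[rule_format])

lemma mg_TickL [simp]: "mg C ([], Tick) q r \<longleftrightarrow> r = q"
proof
  assume "mg C ([], Tick) q r"
  then show "r = q" by (induction "([] :: 'a option list, Tick)" q r rule: mg.induct) auto
qed (auto intro: mg.intros)

lemma mg_TickR [simp]: "mg C p ([], Tick) r \<longleftrightarrow> r = p"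
proof
  assume "mg C p ([], Tick) r"
  then show "r = p" by (induction p "([] :: 'a option list, Tick)" r rule: mg.induct) auto
qed (auto intro: mg.intros)

inductive_cases mg_None_NoneE: "mg C (None # u, e) (None # v, f) r"
inductive_cases mg_Some_NoneE: "mg C (Some a # u, e) (None # v, f) r"
inductive_cases mg_Some_SomeE: "mg C (Some a # u, e) (Some b # v, f) r"
inductive_cases mg_Nil_NoneE: "mg C ([], Part) (None # v, f) r"
inductive_cases mg_None_SomeE: "mg C (None # u, e) (Some b # v, f) r"
inductive_cases mg_Nil_SomeE: "mg C ([], Part) (Some b # v, f) r"
inductive_cases mg_Nil_NilE: "mg C ([], Part) ([], f) r"

lemma mg_replicate:
  "mg C (replicate k None @ u, e) (replicate k None @ v, f) (w, g) \<longleftrightarrow>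
   (\<exists>w'. w = replicate k None @ w' \<and> mg C (u, e) (v, f) (w', g))"
proof (induction k arbitrary: w)
  case (Suc k)
  show ?case
    using Suc by (auto elim!: mg_None_NoneE intro: mg.time)
qed auto

lemma mg_lab: "mg C (u, e) q (w, g) \<Longrightarrow> mg C (lab \<alpha> @ u, e) q (lab \<alpha> @ w, g)"
  by (cases \<alpha>) (auto intro: mg.left)

lemma resid_wk: "(v, f) \<in> resid k Q \<Longrightarrow> (replicate k None @ v, f) \<in> wk Q"
proof (erule resid.cases, goal_cases)
  case 1
  then show ?case using wk_IdleI[of "k - 1" Q] by (cases k) auto
next
  case (2 j)
  then show ?case using wk_IdleI[of "k + j" Q] by (simp add: replicate_add replicate_app_Cons_same)
next
  case (3 j \<alpha> w e)
  then show ?case using wk_RunI[of "k + j" \<alpha> w e Q] by (simp add: replicate_add)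
qed

lemma wk_lmergeD_sub: "wk (lmergeD C P Q) \<subseteq> mgS C (wk P) (wk Q)"
proof
  fix p assume "p \<in> wk (lmergeD C P Q)"
  then show "p \<in> mgS C (wk P) (wk Q)"
  proof (cases rule: wk_cases)
    case 1
    then show ?thesis using mg.nil[of Part Part C] by (fastforce simp: mgS_def)
  next
    case (2 k)
    have "mg C (replicate (Suc k) None @ [], Part) (replicate (Suc k) None @ [], Part) (replicate (Suc k) None, Part)"
      unfolding mg_replicate using mg.nil[of Part Part C] by auto
    then show ?thesis using 2 by (force simp: mgS_def dest: wk_IdleI)
  next
    case (3 k \<alpha> w g)
    then obtain u e v f where uv: "Run k \<alpha> u e \<in> P" "(v, f) \<in> resid k Q" "mg C (u, e) (v, f) (w, g)"
      by (auto simp: mgS_def)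
    have "mg C (replicate k None @ lab \<alpha> @ u, e) (replicate k None @ v, f) (replicate k None @ lab \<alpha> @ w, g)"
      unfolding mg_replicate using mg_lab[OF uv(3)] by blast
    then show ?thesis using wk_RunI[OF uv(1)] resid_wk[OF uv(2)] 3 by (auto simp: mgS_def)
  qed
qed

lemma wk_cmergeD_sub: "wk (cmergeD C P Q) \<subseteq> mgS C (wk P) (wk Q)"
proof
  fix p assume "p \<in> wk (cmergeD C P Q)"
  then show "p \<in> mgS C (wk P) (wk Q)"
  proof (cases rule: wk_cases)
    case 1
    then show ?thesis using mg.nil[of Part Part C] by (fastforce simp: mgS_def)
  next
    case (2 k)
    have "mg C (replicate (Suc k) None @ [], Part) (replicate (Suc k) None @ [], Part) (replicate (Suc k) None, Part)"
      unfolding mg_replicate using mg.nil[of Part Part C] by auto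
    then show ?thesis using 2 by (force simp: mgS_def dest: wk_IdleI)
  next
    case (3 k \<alpha> w g)
    then obtain a b c u e v f where uv: "Run k (Some a) u e \<in> P" "Run k (Some b) v f \<in> Q" "C a b c"
      "mg C (u, e) (v, f) (w, g)" "\<alpha> = Some c"
      by (auto simp: mgS_def)
    have "mg C (replicate k None @ lab (Some a) @ u, e) (replicate k None @ lab (Some b) @ v, f) (replicate k None @ lab \<alpha> @ w, g)"
      unfolding mg_replicate using mg.comm[OF uv(4,3)] uv(5) by auto
    then show ?thesis using wk_RunI[OF uv(1)] wk_RunI[OF uv(2)] 3 by (auto simp: mgS_def)
  qed
qed

lemma mgS_sym: "\<forall>a b c. C a b c \<longrightarrow> C b a c \<Longrightarrow> mgS C U V = mgS C V U"
  unfolding mgS_def using mg_sym[of C] by blast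

lemma cmergeD_sym_sub:
  assumes sym: "\<forall>a b c. C a b c \<longrightarrow> C b a c"
  shows "cmergeD C P Q \<subseteq> cmergeD C Q P"
proof (rule rset_subI)
  fix k \<alpha> w e
  assume "Run k \<alpha> w e \<in> cmergeD C P Q"
  then obtain a b c where "\<alpha> = Some c" "C a b c" "(w, e) \<in> mgS C (after P k (Some a)) (after Q k (Some b))"
    unfolding cmergeD_iff by blast
  then show "Run k \<alpha> w e \<in> cmergeD C Q P"
    unfolding cmergeD_iff mgS_sym[OF sym, of "after Q _ _"] using sym
    by (intro exI[of _ b] exI[of _ a] exI[of _ c]) simp
qed simp

text \<open>\<open>idles P m\<close>: \<open>P\<close> admits \<open>m\<close> initial time steps.\<close>

definition idles :: "'a rtrace set \<Rightarrow> nat \<Rightarrow> bool" where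
  "idles P m \<longleftrightarrow> m = 0 \<or> Idle (m - 1) \<in> P"

lemma wk_cases':
  assumes "p \<in> wk P"
  obtains m where "idles P m" "p = (replicate m None, Part)"
  | k \<alpha> w e where "Run k \<alpha> w e \<in> P" "p = (replicate k None @ lab \<alpha> @ w, e)"
  using assms
proof (cases rule: wk_cases)
  case 1 then show thesis using that(1)[of 0] by (simp add: idles_def)
next
  case (2 k) then show thesis using that(1)[of "Suc k"] by (simp add: idles_def)
qed (rule that(2))

lemma idles_resid: "idles P (k + m) \<Longrightarrow> (replicate m None, Part) \<in> resid k P"
proof (cases m)
  case (Suc j)
  assume "idles P (k + m)"
  then show ?thesis using resid.intros(2)[of k j P] Suc by (simp add: idles_def)
qed (auto simp: idles_def intro: resid.intros)

lemma wk_idles: "idles P m \<Longrightarrow> (replicate m None, Part) \<in> wk P"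
  using resid_wk[OF idles_resid[of P 0 m]] by simp

lemma wk_lmergeDI:
  assumes "Run k \<alpha> u e \<in> P" "q \<in> resid k Q" "mg C (u, e) q (w, g)"
  shows "(replicate k None @ lab \<alpha> @ w, g) \<in> wk (lmergeD C P Q)"
  using assms by (intro wk_RunI) (auto simp: mgS_def)

lemma replicate_le: "k \<le> j \<Longrightarrow> replicate j x = replicate k x @ replicate (j - k) x"
  by (simp flip: replicate_add)

text \<open>A merge of weak traces belongs to one of the three summands according to who moves
  first. The component with fewer initial time steps, or with a silent first action, can be
  scheduled first; if both stand before visible actions in the same time slice, the first symbol of
  the merge decides.\<close>

lemma mgS_sub_parD:
  assumes sym: "\<forall>a b c. C a b c \<longrightarrow> C b a c"
  shows "mgS C (wk P) (wk Q) \<subseteq> wk (parD C P Q)"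
proof
  have idle_run: "r \<in> wk (lmergeD C P' Q')"
    if "Run k \<alpha> u e \<in> P'" "idles Q' m" "mg C (replicate m None, Part) (replicate k None @ lab \<alpha> @ u, e) r"
    for k \<alpha> u e m P' Q' r
  proof (cases "k \<le> m")
    case True
    obtain w g where r: "r = (w, g)" by (cases r)
    with True that(3) obtain w' where w': "w = replicate k None @ w'"
      "mg C (replicate (m - k) None, Part) (lab \<alpha> @ u, e) (w', g)"
      by (auto simp: replicate_le[OF True] mg_replicate)
    have res: "(replicate (m - k) None, Part) \<in> resid k Q'"
      using idles_resid[of Q' k "m - k"] that(2) True by simp
    show ?thesis
    proof (cases \<alpha>)
      case None
      then show ?thesis using wk_lmergeDI[OF that(1) res mg_sym[OF sym]] w' r by simp
    next
      case (Some a)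
      obtain w'' where "w' = Some a # w''" "mg C (replicate (m - k) None, Part) (u, e) (w'', g)"
        using w'(2) Some by (cases "m - k") (auto elim: mg_Nil_SomeE mg_None_SomeE)
      then show ?thesis using wk_lmergeDI[OF that(1) res mg_sym[OF sym]] w' r Some by simp
    qed
  next
    \<comment> \<open>The idling component stops while the other still has a time step to take. Time
      passes only jointly, so there is no such merge.\<close>
    case False
    then obtain i where "k - m = Suc i" by (cases "k - m") auto
    then have "mg C (replicate m None @ [], Part) (replicate m None @ None # (replicate i None @ lab \<alpha> @ u), e) r"
      using that(3) False by (simp add: replicate_le[of m k])
    then show ?thesis using mg_replicate[of C m "[]" Part _ e "fst r" "snd r"]
      by (auto elim: mg_Nil_NoneE simp del: append_Nil2)
  qed
  have run_run: "r \<in> wk (parD C P' Q')"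
    if "Run k \<alpha> u e \<in> P'" "Run j \<beta> v f \<in> Q'" "k \<le> j"
      "mg C (replicate k None @ lab \<alpha> @ u, e) (replicate j None @ lab \<beta> @ v, f) r"
    for k \<alpha> u e j \<beta> v f P' Q' r
  proof -
    note kj = that(3)
    obtain w g where r: "r = (w, g)" by (cases r)
    with that(3,4) obtain w' where w': "w = replicate k None @ w'"
      "mg C (lab \<alpha> @ u, e) (replicate (j - k) None @ lab \<beta> @ v, f) (w', g)"
      by (auto simp: replicate_le[OF kj] mg_replicate)
    have res: "(replicate (j - k) None @ lab \<beta> @ v, f) \<in> resid k Q'"
      using resid.intros(3)[of k "j - k" \<beta> v f Q'] that by simp
    have L: "mg C (u, e) (replicate (j - k) None @ lab \<beta> @ v, f) (w'', g) \<Longrightarrow> w' = lab \<alpha> @ w'' \<Longrightarrow>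
      r \<in> wk (parD C P' Q')" for w''
      using wk_lmergeDI[OF that(1) res] r w' by (simp add: parD_def wk_Un)
    show ?thesis
    proof (cases \<alpha>)
      \<comment> \<open>A silent first action leaves no symbol in the weak trace and can therefore
        be scheduled first.\<close>
      case None
      then show ?thesis using L[of w'] w'(2) by simp
    next
      case (Some a)
      show ?thesis
      proof (cases "j = k")
        \<comment> \<open>The partner still has a time step ahead of it, so the first symbol of the
          merge is the action of this component.\<close>
        case False
        then obtain i where i: "j - k = Suc i" using kj by (cases "j - k") auto
        then obtain w'' where "w' = Some a # w''"
            "mg C (u, e) (replicate (j - k) None @ lab \<beta> @ v, f) (w'', g)"
          using w'(2) Some by (auto elim: mg_Some_NoneE)
        then show ?thesis using L[of w''] Some by simp
      next
        case True
        have res': "(lab \<alpha> @ u, e) \<in> resid j P'"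
          using resid.intros(3)[of j 0 \<alpha> u e P'] that True by simp
        have R: "mg C (lab \<alpha> @ u, e) (v, f) (w'', g) \<Longrightarrow> w' = lab \<beta> @ w'' \<Longrightarrow>
          r \<in> wk (parD C P' Q')" for w''
          using wk_lmergeDI[OF that(2) res' mg_sym[OF sym]] r w' True by (simp add: parD_def wk_Un)
        show ?thesis
        proof (cases \<beta>)
          case None
          then show ?thesis using R[of w'] w'(2) True by simp
        next
          case (Some b)
          from w'(2) have "mg C (Some a # u, e) (Some b # v, f) (w', g)"
            using True Some \<open>\<alpha> = Some a\<close> by simp
          then consider w'' where "mg C (u, e) (Some b # v, f) (w'', g)" "w' = Some a # w''"
            | w'' where "mg C (Some a # u, e) (v, f) (w'', g)" "w' = Some b # w''"
            | w'' c where "mg C (u, e) (v, f) (w'', g)" "w' = Some c # w''" "C a b c"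
            by (auto elim: mg_Some_SomeE)
          then show ?thesis
          proof cases
            case 1 then show ?thesis using L \<open>\<alpha> = Some a\<close> Some True by simp
          next
            case 2 then show ?thesis using R \<open>\<alpha> = Some a\<close> Some by simp
          next
            case 3
            then have "Run k (Some c) w'' g \<in> cmergeD C P' Q'"
              unfolding cmergeD_iff using that(1,2) True Some \<open>\<alpha> = Some a\<close>
              by (intro exI[of _ a] exI[of _ b] exI[of _ c] conjI mgSI[of "(u, e)" _ "(v, f)"]) simp_all
            from wk_RunI[OF this] show ?thesis using 3 r w' by (simp add: parD_def wk_Un)
          qed
        qed
      qed
    qed
  qed
  have parD_sym: "parD C Q P = parD C P Q"
  proof -
    have "cmergeD C Q P = cmergeD C P Q"
      by (intro subset_antisym cmergeD_sym_sub sym)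
    then show ?thesis by (auto simp: parD_def)
  qed
  fix r assume "r \<in> mgS C (wk P) (wk Q)"
  then obtain p q where pq: "p \<in> wk P" "q \<in> wk Q" "mg C p q r" by (auto simp: mgS_def)
  from pq(1) show "r \<in> wk (parD C P Q)"
  proof (cases rule: wk_cases')
    case (1 m)
    from pq(2) show ?thesis
    proof (cases rule: wk_cases')
      case (2 k \<alpha> w e)
      then show ?thesis using idle_run[OF 2(1) 1(1)] pq(3) 1 by (simp add: parD_def wk_Un)
    next
      case (1 n)
      note m = \<open>idles P m\<close> \<open>p = _\<close>
      obtain w g where r: "r = (w, g)" by (cases r)
      \<comment> \<open>Two idling components merge only if they idle equally long, as every time
        step is joint.\<close>
      have "n = m \<and> r = (replicate m None, Part)"
        using pq(3)[unfolded m 1 r] r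
      proof (induction m arbitrary: n w r)
        case 0
        then show ?case by (cases n) (auto elim: mg_Nil_NilE mg_Nil_NoneE)
      next
        case (Suc m)
        show ?case
        proof (cases n)
          case 0
          then show ?thesis using mg_sym[OF sym Suc.prems(1)] by (auto elim: mg_Nil_NoneE)
        next
          case (Suc n')
          then show ?thesis using Suc.prems Suc.IH[of n' _ "(_, g)"]
            by (fastforce elim!: mg_None_NoneE)
        qed
      qed
      then have "idles (parD C P Q) m" "r = (replicate m None, Part)"
        using m 1 by (auto simp: idles_def parD_def)
      then show ?thesis by (simp add: wk_idles)
    qed
  next
    case (2 k \<alpha> u e)
    note p = this
    from pq(2) show ?thesis
    proof (cases rule: wk_cases')
      case (1 m)
      then show ?thesis using idle_run[OF p(1) 1(1) mg_sym[OF sym pq(3)[unfolded p 1]]] 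
        by (simp add: parD_def wk_Un)
    next
      case (2 j \<beta> v f)
      show ?thesis
      proof (cases "k \<le> j")
        case True
        then show ?thesis using run_run[OF p(1) 2(1)] pq(3) p 2 by simp
      next
        case False
        then show ?thesis using run_run[OF 2(1) p(1) _ mg_sym[OF sym pq(3)[unfolded p 2]]] parD_sym by simp
      qed
    qed
  qed
qed

text \<open>Behind an action, parallel composition thus acts on weak traces alone. The merge axioms
  with a parallel composition behind a prefix rest on this.\<close>

lemma wk_parD:
  assumes "\<forall>a b c. C a b c \<longrightarrow> C b a c"
  shows "wk (parD C P Q) = mgS C (wk P) (wk Q)"
  using mgS_sub_parD[OF assms, of P Q] wk_lmergeD_sub[of C P Q] wk_lmergeD_sub[of C Q P] wk_cmergeD_sub[of C P Q]
    mgS_sym[OF assms, of "wk P" "wk Q"]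
  by (simp add: parD_def wk_Un subset_antisym)

section \<open>Abstraction\<close>

text \<open>\<open>unbounded\<close> supplies a witness for each bound, possibly decomposed
  differently each time; this exchange of quantifiers yields one decomposition for all bounds. If
  each candidate failed at some bound, all would fail at the maximum of these bounds.\<close>

lemma pigeonhole_antimono:
  fixes Q :: "nat \<Rightarrow> 'b \<Rightarrow> bool"
  assumes "finite F" and ex: "\<And>n. \<exists>a\<in>F. Q n a" and anti: "\<And>m n a. m \<le> n \<Longrightarrow> Q n a \<Longrightarrow> Q m a"
  shows "\<exists>a\<in>F. \<forall>n. Q n a"
proof (rule ccontr)
  assume "\<not> ?thesis"
  then obtain N where N: "\<And>a. a \<in> F \<Longrightarrow> \<not> Q (N a) a" by metis
  obtain a where "a \<in> F" "Q (Max (N ` F)) a" using ex by blast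
  moreover have "N a \<le> Max (N ` F)" using \<open>a \<in> F\<close> assms(1) by simp
  ultimately show False using N anti by blast
qed

lemma hide_append [simp]: "hide I (u @ v) = hide I u @ hide I v"
  by (simp add: hide_def)

lemma hide_Nil [simp]: "hide I [] = []"
  by (simp add: hide_def)

lemma hide_hidden: "set v \<subseteq> Some ` I \<Longrightarrow> hide I v = []"
  by (auto simp: hide_def filter_empty_conv)

lemma hide_replicate_None [simp]: "hide I (replicate k None) = replicate k None"
  by (simp add: hide_def image_iff)

lemma hide_Cons_None [simp]: "hide I (None # w) = None # hide I w"
  by (simp add: hide_def image_iff)

lemma hide_lab [simp]: "hide I (lab \<alpha>) = lab (hide_lab I \<alpha>)"
  by (cases \<alpha>) (auto simp: hide_def hide_lab_def)

lemma append_eq_prefix: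
  "w @ v = x @ y \<Longrightarrow> length x \<le> length w \<Longrightarrow> w = x @ drop (length x) w \<and> y = drop (length x) w @ v"
  by (auto simp: append_eq_append_conv2)

lemma abstrWI: "(w, e) \<in> U \<Longrightarrow> (hide I w, e) \<in> abstrW I U"
  unfolding abstrW_def by blast

text \<open>Hidden continuations of \<open>w\<close> come from the first factor, or from the second,
  which starts either inside \<open>w\<close> or amid the hidden actions. These are finitely many
  cases, so one of them provides arbitrarily long continuations.\<close>

lemma unbounded_seqW:
  assumes "unbounded I (seqW U V) w"
  shows "unbounded I U w \<or> (\<exists>u. (u, Tick) \<in> U \<and> hide I u = hide I w \<and> unbounded I V []) \<or>
    (\<exists>u v. w = u @ v \<and> (u, Tick) \<in> U \<and> unbounded I V v)"
proof -
  define long where "long U w n \<longleftrightarrow> (\<exists>v e. n \<le> length v \<and> set v \<subseteq> Some ` I \<and> (w @ v, e) \<in> U)"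
    for U :: "'a wtrace set" and w n
  have unb: "unbounded I U w \<longleftrightarrow> (\<forall>n. long U w n)" for U w
    by (simp add: unbounded_def long_def)
  have anti: "m \<le> n \<Longrightarrow> long U w n \<Longrightarrow> long U w m" for m n U w
    unfolding long_def using le_trans by blast
  \<comment> \<open>Index 0: the first factor supplies the hidden actions. Index 1: it terminates at
    or after the end of \<open>w\<close>, and only its trace up to hiding is recorded, since the
    exact one may change with \<open>n\<close>. Index j \<ge> 2: it terminates after j - 2 symbols
    of \<open>w\<close>.\<close>
  define Q where "Q n j = (if j = 0 then long U w n
      else if j = 1 then (\<exists>u. (u, Tick) \<in> U \<and> hide I u = hide I w) \<and> long V [] n
      else (take (j - 2) w, Tick) \<in> U \<and> long V (drop (j - 2) w) n)" for n j :: nat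
  have "\<exists>j\<in>{..length w + 2}. Q n j" for n
  proof -
    \<comment> \<open>Twice the length, because the first factor may terminate within
      \<open>v\<close>; then one of the two pieces still has length \<open>n\<close>.\<close>
    obtain v e where v: "2 * n \<le> length v" "set v \<subseteq> Some ` I" "(w @ v, e) \<in> seqW U V"
      using assms unfolding unbounded_def by blast
    from v(3) consider "(w @ v, e) \<in> U" | v1 v2 where "w @ v = v1 @ v2" "(v1, Tick) \<in> U" "(v2, e) \<in> V"
      by (auto simp: seqW_def)
    then show ?thesis
    proof cases
      case 1
      then have "long U w n" unfolding long_def using v by (intro exI[of _ v] exI[of _ e]) simp
      then show ?thesis by (intro bexI[of _ 0]) (simp_all add: Q_def)
    next
      case 2
      from 2(1) consider u where "v1 = w @ u" "v = u @ v2" | u where "w = v1 @ u" "v2 = u @ v"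
        by (auto simp: append_eq_append_conv2)
      then show ?thesis
      proof cases
        case (1 u)
        then have "n \<le> length u \<or> n \<le> length v2" using v(1) by auto
        then show ?thesis
        proof
          assume "n \<le> length u"
          then have "long U w n" unfolding long_def using v 1 2 by (intro exI[of _ u] exI[of _ Tick]) simp
          then show ?thesis by (intro bexI[of _ 0]) (simp_all add: Q_def)
        next
          assume "n \<le> length v2"
          then have "long V [] n" unfolding long_def using v 1 2 by (intro exI[of _ v2] exI[of _ e]) simp
          moreover have "hide I v1 = hide I w" using 1 v(2) by (simp add: hide_hidden)
          ultimately show ?thesis using 2 by (intro bexI[of _ 1]) (auto simp: Q_def)
        qed
      next
        case (2 u)
        have "long V u n" unfolding long_def using v 2 \<open>(v2, e) \<in> V\<close> by (intro exI[of _ v] exI[of _ e]) simp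
        then show ?thesis using 2 \<open>(v1, Tick) \<in> U\<close>
          by (intro bexI[of _ "length v1 + 2"]) (auto simp: Q_def)
      qed
    qed
  qed
  moreover have "Q m j" if "m \<le> n" "Q n j" for m n j
    using that anti[OF that(1)] unfolding Q_def by (auto split: if_splits)
  ultimately obtain j where j: "\<And>n. Q n j"
    using pigeonhole_antimono[of "{..length w + 2}" Q] by blast
  show ?thesis
  proof (cases "j \<le> 1")
    case True
    then consider "j = 0" | "j = 1" by linarith
    then show ?thesis
    proof cases
      case 2
      then have "(\<exists>u. (u, Tick) \<in> U \<and> hide I u = hide I w) \<and> long V [] n" for n
        using j[of n] unfolding Q_def by simp
      then show ?thesis unfolding unb by blast
    qed (use j in \<open>simp add: unb Q_def\<close>)
  next
    case False
    then have "(take (j - 2) w, Tick) \<in> U" "unbounded I V (drop (j - 2) w)"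
      using j unfolding unb Q_def by auto
    then show ?thesis by (metis append_take_drop_id)
  qed
qed

lemma abstrW_seqW:
  assumes p0: "([], Part) \<in> V"
  shows "abstrW I (seqW U V) = seqW (abstrW I U) (abstrW I V)"
proof (rule subset_antisym; rule subsetI)
  fix p assume "p \<in> abstrW I (seqW U V)"
  then consider w e where "p = (hide I w, e)" "(w, e) \<in> seqW U V"
    | w where "p = (hide I w, Dv)" "unbounded I (seqW U V) w"
    by (auto simp: abstrW_def)
  then show "p \<in> seqW (abstrW I U) (abstrW I V)"
  proof cases
    case 1
    then show ?thesis by (auto simp: seqW_def abstrW_def; metis hide_append)
  next
    case 2
    from unbounded_seqW[OF 2(2)] show ?thesis
    proof (elim disjE exE conjE)
      assume "unbounded I U w"
      then show ?thesis using 2 by (auto simp: seqW_def abstrW_def)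
    next
      fix u assume "(u, Tick) \<in> U" "hide I u = hide I w" "unbounded I V []"
      then have "(hide I w, Tick) \<in> abstrW I U" "([], Dv) \<in> abstrW I V"
        by (auto simp: abstrW_def) (metis hide_Nil)
      then show ?thesis using 2 unfolding seqW_def by force
    next
      fix u v assume "w = u @ v" "(u, Tick) \<in> U" "unbounded I V v"
      then have "(hide I u, Tick) \<in> abstrW I U" "(hide I v, Dv) \<in> abstrW I V" "hide I w = hide I u @ hide I v"
        by (auto simp: abstrW_def)
      then show ?thesis using 2 unfolding seqW_def by force
    qed
  qed
next
  fix p assume "p \<in> seqW (abstrW I U) (abstrW I V)"
  then consider w e where "p = (w, e)" "e \<noteq> Tick" "(w, e) \<in> abstrW I U"
    | u v e where "p = (u @ v, e)" "(u, Tick) \<in> abstrW I U" "(v, e) \<in> abstrW I V"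
    by (auto simp: seqW_def)
  then show "p \<in> abstrW I (seqW U V)"
  proof cases
    case 1
    from 1(3) consider w' where "w = hide I w'" "(w', e) \<in> U" | w' where "w = hide I w'" "e = Dv" "unbounded I U w'"
      by (auto simp: abstrW_def)
    then show ?thesis
    proof cases
      case (1 w')
      then show ?thesis using \<open>p = _\<close> \<open>e \<noteq> Tick\<close> by (auto simp: abstrW_def seqW_def)
    next
      case (2 w')
      have "unbounded I (seqW U V) w'"
        unfolding unbounded_def
      proof
        fix n
        obtain v f where v: "n \<le> length v" "set v \<subseteq> Some ` I" "(w' @ v, f) \<in> U"
          using 2(3) unfolding unbounded_def by blast
        \<comment> \<open>A terminated trace of \<open>U\<close> is not by itself one of the
          composition; continuing it with the empty trace in \<open>V\<close> turns
          \<open>Tick\<close> into \<open>Part\<close>.\<close>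
        have "(w' @ v, if f = Tick then Part else f) \<in> seqW U V"
          using v(3) p0 unfolding seqW_def by force
        then show "\<exists>v e. n \<le> length v \<and> set v \<subseteq> Some ` I \<and> (w' @ v, e) \<in> seqW U V"
          using v by blast
      qed
      then show ?thesis using 2 \<open>p = _\<close> by (auto simp: abstrW_def)
    qed
  next
    case 2
    from 2(2) obtain u' where u': "u = hide I u'" "(u', Tick) \<in> U" by (auto simp: abstrW_def)
    from 2(3) consider v' where "v = hide I v'" "(v', e) \<in> V" | v' where "v = hide I v'" "e = Dv" "unbounded I V v'"
      by (auto simp: abstrW_def)
    then show ?thesis
    proof cases
      case (1 v')
      then have "(u' @ v', e) \<in> seqW U V" using u' unfolding seqW_def by blast
      then show ?thesis using 1 u' 2 by (force simp: abstrW_def)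
    next
      case (2 v')
      have "unbounded I (seqW U V) (u' @ v')"
        using 2(3) u'(2) unfolding unbounded_def seqW_def by simp blast
      then show ?thesis using 2 u' \<open>p = _\<close> by (force simp: abstrW_def)
    qed
  qed
qed

text \<open>On the left the first action is fixed before unboundedness is asked for, on the right it
  may change with the bound. As \<open>I\<close> is finite, some first action occurs for all
  bounds.\<close>

lemma wk_abstrD:
  assumes "finite I"
  shows "wk (abstrD I P) = abstrW I (wk P)"
proof (rule subset_antisym; rule subsetI)
  fix p assume "p \<in> wk (abstrD I P)"
  then show "p \<in> abstrW I (wk P)"
  proof (cases rule: wk_cases)
    case 1
    then show ?thesis using abstrWI[OF wk_Nil] by simp
  next
    case (2 k)
    then have "(replicate (Suc k) None, Part) \<in> wk P" using wk_IdleI[of k P] by simp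
    from abstrWI[OF this, of I] show ?thesis using 2 hide_replicate_None[of I "Suc k"] by simp
  next
    case (3 k \<beta> w e)
    then obtain \<alpha> where \<alpha>: "\<beta> = hide_lab I \<alpha>" "(w, e) \<in> abstrW I (after P k \<alpha>)" by auto
    then consider w' where "w = hide I w'" "Run k \<alpha> w' e \<in> P"
      | w' where "w = hide I w'" "e = Dv" "unbounded I (after P k \<alpha>) w'"
      by (auto simp: abstrW_def)
    then show ?thesis
    proof cases
      case (1 w')
      then show ?thesis using wk_RunI[OF 1(2)] 3 \<alpha>
        unfolding abstrW_def by (auto intro!: exI[of _ "replicate k None @ lab \<alpha> @ w'"])
    next
      case (2 w')
      have "unbounded I (wk P) (replicate k None @ lab \<alpha> @ w')"
        using 2(3) wk_RunI[of k \<alpha> _ _ P] unfolding unbounded_def by (simp, blast)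
      then show ?thesis using 2 3 \<alpha>
        unfolding abstrW_def by (auto intro!: exI[of _ "replicate k None @ lab \<alpha> @ w'"])
    qed
  qed
next
  fix p assume "p \<in> abstrW I (wk P)"
  then consider w e where "p = (hide I w, e)" "(w, e) \<in> wk P" | w where "p = (hide I w, Dv)" "unbounded I (wk P) w"
    by (auto simp: abstrW_def)
  then show "p \<in> wk (abstrD I P)"
  proof cases
    case 1
    from 1(2) show ?thesis
    proof (cases rule: wk_cases)
      case (2 k)
      then show ?thesis using 1 wk_IdleI[of k "abstrD I P"] by simp
    next
      case (3 k \<alpha> w' e')
      then have "Run k (hide_lab I \<alpha>) (hide I w') e' \<in> abstrD I P" by (auto simp: abstrW_def)
      from wk_RunI[OF this] show ?thesis using 1 3 by simp
    qed (use 1 in simp)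
  next
    case 2
    define Q where "Q n = (\<lambda>(k, \<alpha>, w0). \<exists>v e. n \<le> length v \<and> set v \<subseteq> Some ` I \<and> Run k \<alpha> (w0 @ v) e \<in> P \<and>
      hide I w = hide I (replicate k None @ lab \<alpha> @ w0))" for n
    \<comment> \<open>The ways to place the root of a trace relative to \<open>w\<close>: number of
      time steps, first action, suffix of \<open>w\<close> after it. The first action may also lie
      just beyond \<open>w\<close>, hence the hidden labels.\<close>
    define F where "F = {..length w} \<times> insert None (set w \<union> Some ` I) \<times> (\<lambda>i. drop i w) ` {..length w}"
    have "\<exists>x\<in>F. Q n x" for n
    proof -
      \<comment> \<open>One symbol more than required, because the first symbol of \<open>v\<close>
        may turn out to be the first action of the process.\<close>
      obtain v e where v: "Suc n \<le> length v" "set v \<subseteq> Some ` I" "(w @ v, e) \<in> wk P"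
        using 2(2) unfolding unbounded_def by blast
      from v(3) obtain k \<alpha> w' where r: "Run k \<alpha> w' e \<in> P" "w @ v = replicate k None @ lab \<alpha> @ w'"
      proof (cases rule: wk_cases)
        case (2 k)
        then have "None \<in> set v" using v(1)
          by (metis Pair_inject append_Nil2 append_eq_append_conv last_appendR last_in_set last_replicate le_zero_eq list.size(3) nat.distinct(1) prod.inject)
        then show thesis using v(2) by auto
      qed (use v(1) that in auto)
      have kw: "k \<le> length w"
      proof (rule ccontr)
        assume "\<not> k \<le> length w"
        then have "(w @ v) ! length w = None" using r(2) by (simp add: nth_append)
        moreover have "(w @ v) ! length w \<in> set v" using v(1) by (cases v) (simp_all add: nth_append)
        ultimately show False using v(2) by auto
      qed
      show ?thesis
      proof (cases "length (replicate k None @ lab \<alpha>) \<le> length w")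
        case True
        define i where "i = length (replicate k None @ lab \<alpha>)"
        have w: "w = (replicate k None @ lab \<alpha>) @ drop i w" and w': "w' = drop i w @ v"
          using append_eq_prefix[of w v "replicate k None @ lab \<alpha>" w'] r(2) True unfolding i_def
          by simp_all
        have "\<alpha> \<in> insert None (set w \<union> Some ` I)"
        proof (cases \<alpha>)
          case (Some a)
          have "\<alpha> \<in> set ((replicate k None @ lab \<alpha>) @ drop i w)" using Some by simp
          then have "\<alpha> \<in> set w" unfolding w[symmetric] .
          then show ?thesis by simp
        qed simp
        then have "(k, \<alpha>, drop i w) \<in> F" using kw True unfolding F_def i_def by auto
        moreover have "Q n (k, \<alpha>, drop i w)"
          unfolding Q_def using v r w' w by (auto intro!: exI[of _ v] exI[of _ e] simp flip: hide_append)
        ultimately show ?thesis by blast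
      next
        case False
        then obtain a where a: "\<alpha> = Some a" "k = length w" using kw by (cases \<alpha>) auto
        then have w: "w = replicate k None" "v = Some a # w'" using r(2) by auto
        then have "(k, \<alpha>, []) \<in> F" unfolding F_def using a v(2) by (auto intro: image_eqI[of _ _ "length w"])
        moreover have "Q n (k, \<alpha>, [])"
          unfolding Q_def prod.case
        proof (intro exI conjI)
          show "n \<le> length w'" "set w' \<subseteq> Some ` I" using v w(2) by auto
          show "Run k \<alpha> ([] @ w') e \<in> P" using r by simp
          have "hide_lab I \<alpha> = None" using v(2) w(2) a(1) by (simp add: hide_lab_def)
          then show "hide I w = hide I (replicate k None @ lab \<alpha> @ [])" by (subst w(1)) simp
        qed
        ultimately show ?thesis by blast
      qed
    qed
    moreover have "finite F" using assms by (simp add: F_def)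
    moreover have "Q m x" if "m \<le> n" "Q n x" for m n x
      using that unfolding Q_def by (auto split: prod.splits) (meson le_trans)
    ultimately obtain x where x: "\<And>n. Q n x" using pigeonhole_antimono[of F Q] by blast
    obtain k \<alpha> w0 where xe: "x = (k, \<alpha>, w0)" by (cases x)
    have "unbounded I (after P k \<alpha>) w0"
      using x unfolding Q_def xe unbounded_def by simp blast
    then have "Run k (hide_lab I \<alpha>) (hide I w0) Dv \<in> abstrD I P" by (auto simp: abstrW_def)
    moreover have "hide I w = replicate k None @ lab (hide_lab I \<alpha>) @ hide I w0"
      using x[of 0] unfolding Q_def xe by auto
    ultimately show ?thesis using 2 wk_RunI by metis
  qed
qed

section \<open>Soundness of the axioms\<close>

lemma seqW_simps [simp]:
  "seqW {} V = {}" "seqW {([], Tick), ([], Part)} V = insert ([], Part) V"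
  by (auto simp: seqW_def)

lemma seqW_Un: "seqW (U \<union> U') V = seqW U V \<union> seqW U' V"
  unfolding seqW_def by blast

lemma mg_Part: "mg C p q r \<Longrightarrow> p = ([], Part) \<Longrightarrow> fst r = fst q \<and> (snd r = snd q \<or> snd q = Tick \<and> snd r = Part)"
  by (induction rule: mg.induct) (auto, metis ending.exhaust)

lemma mgS_empty [simp]: "mgS C {} V = {}" "mgS C U {} = {}"
  by (auto simp: mgS_def)

text \<open>Merging the broken-off empty trace with a terminated one breaks the latter off, and
  \<open>V\<close> has to contain the result.\<close>

lemma mgS_act:
  assumes "\<And>w. (w, Tick) \<in> V \<Longrightarrow> (w, Part) \<in> V"
  shows "mgS C {([], Tick), ([], Part)} V = V"
proof (rule subset_antisym; rule subsetI)
  fix r assume "r \<in> mgS C {([], Tick), ([], Part)} V"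
  then consider "r \<in> V" | q where "q \<in> V" "mg C ([], Part) q r" by (auto simp: mgS_def)
  then show "r \<in> V"
  proof cases
    case 2
    then show ?thesis using mg_Part[OF 2(2) HOL.refl] assms by (cases q; cases r) auto
  qed
qed (auto simp: mgS_def)

lemma mgS_act':
  assumes "\<And>w. (w, Tick) \<in> V \<Longrightarrow> (w, Part) \<in> V" "\<forall>a b c. C a b c \<longrightarrow> C b a c"
  shows "mgS C V {([], Tick), ([], Part)} = V"
  using mgS_act[OF assms(1)] mgS_sym[OF assms(2)] by metis

lemma mgS_Un: "mgS C (U \<union> U') V = mgS C U V \<union> mgS C U' V" "mgS C U (V \<union> V') = mgS C U V \<union> mgS C U V'"
  unfolding mgS_def by blast+

lemma after_empty [simp]: "after {} k \<alpha> = {}"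
  by (simp add: after_def)

lemma after_Un: "after (P \<union> Q) k \<alpha> = after P k \<alpha> \<union> after Q k \<alpha>"
  by (auto simp: after_def)

lemma after_seqD [simp]: "after (seqD P Q) k \<alpha> = seqW (after P k \<alpha>) (wk Q)"
  by (auto simp: after_def)

lemma after_delayD [simp]: "after (delayD P) 0 \<alpha> = {}" "after (delayD P) (Suc k) \<alpha> = after P k \<alpha>"
  by (auto simp: after_def)

lemma after_timeoutD [simp]: "after (timeoutD P) k \<alpha> = (if k = 0 then after P k \<alpha> else {})"
  by (auto simp: after_def)

lemma after_actD: "after (actD a) k \<alpha> =
    (if k = 0 \<and> a = (case \<alpha> of None \<Rightarrow> Tau | Some c \<Rightarrow> Basic c) then {([], Tick), ([], Part)} else {})"
  by (cases a) (auto simp: after_def split: option.splits)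

lemma after_insert: "after {Run j \<beta> v f, Run j \<beta> v g} k \<alpha> = (if j = k \<and> \<beta> = \<alpha> then {(v, f), (v, g)} else {})"
  by (auto simp: after_def)

lemma Idle_actD [simp]: "Idle k \<notin> actD a"
  by (cases a) auto

lemma Run_iff_after: "Run k \<alpha> w e \<in> P \<longleftrightarrow> (w, e) \<in> after P k \<alpha>"
  by simp

lemma resid_0 [simp]: "resid 0 Q = wk Q"
proof
  show "resid 0 Q \<subseteq> wk Q" using resid_wk[of _ _ 0 Q] by auto
  show "wk Q \<subseteq> resid 0 Q"
  proof
    fix p assume "p \<in> wk Q"
    then show "p \<in> resid 0 Q"
    proof (cases rule: wk_cases)
      case (2 k)
      then show ?thesis using resid.intros(2)[of 0 k Q] by simp
    next
      case (3 k \<alpha> w e)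
      then show ?thesis using resid.intros(3)[of 0 k \<alpha> w e Q] by simp
    qed (simp add: resid.intros)
  qed
qed

text \<open>The first time step discards the timed-out summand and uses up one \<sigma>; the left
  merge axiom for delayed processes reduces to this.\<close>

lemma resid_Suc: "resid (Suc k) (timeoutD P \<union> delayD Q) = resid k Q"
proof (rule subset_antisym; rule subrelI)
  fix v f assume "(v, f) \<in> resid (Suc k) (timeoutD P \<union> delayD Q)"
  then show "(v, f) \<in> resid k Q"
  proof (cases rule: resid.cases)
    case 1
    then show ?thesis by (cases k) (auto intro: resid.intros)
  next
    case (2 j)
    then show ?thesis using resid.intros(2)[of k j Q] by simp
  next
    case (3 j \<alpha> w)
    then show ?thesis using resid.intros(3)[of k j \<alpha> w f Q] by simp
  qed
next
  fix v f assume "(v, f) \<in> resid k Q"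
  then show "(v, f) \<in> resid (Suc k) (timeoutD P \<union> delayD Q)"
  proof (cases rule: resid.cases)
    case 1
    then show ?thesis by (cases k) (auto intro!: resid.intros)
  next
    case (2 j)
    then show ?thesis using resid.intros(2)[of "Suc k" j "timeoutD P \<union> delayD Q"] by simp
  next
    case (3 j \<alpha> w)
    then show ?thesis using resid.intros(3)[of "Suc k" j \<alpha> w f "timeoutD P \<union> delayD Q"] by simp
  qed
qed

lemma resid_timeoutD [simp]: "resid (Suc k) (timeoutD P) = {}"
  by (auto elim: resid.cases)

lemma wk_encapD: "wk (encapD H P) = {(w, e) \<in> wk P. set w \<inter> Some ` H = {}}"
proof (rule subset_antisym; rule subsetI)
  fix p assume "p \<in> wk (encapD H P)"
  then show "p \<in> {(w, e) \<in> wk P. set w \<inter> Some ` H = {}}"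
  proof (cases rule: wk_cases)
    case (2 k)
    then show ?thesis using wk_IdleI[of k P] by auto
  next
    case (3 k \<alpha> w e)
    then show ?thesis using wk_RunI[of k \<alpha> w e P] by (cases \<alpha>) (auto split: if_splits)
  qed simp
next
  fix p assume "p \<in> {(w, e) \<in> wk P. set w \<inter> Some ` H = {}}"
  then obtain w e where p: "p = (w, e)" "set w \<inter> Some ` H = {}" "(w, e) \<in> wk P" by auto
  from p(3) show "p \<in> wk (encapD H P)"
  proof (cases rule: wk_cases)
    case (2 k)
    then show ?thesis using wk_IdleI[of k "encapD H P"] p by simp
  next
    case (3 k \<alpha> w' e')
    then show ?thesis using wk_RunI[of k \<alpha> w' e' "encapD H P"] p by (cases \<alpha>) auto
  qed (use p in simp)
qed

lemma seqD_Un: "seqD (P \<union> Q) R = seqD P R \<union> seqD Q R"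
  by (rule rset_eqI) (auto simp: after_Un seqW_Un)

lemma seqD_assoc: "seqD (seqD P Q) R = seqD P (seqD Q R)"
  by (rule rset_eqI) (simp_all add: wk_seqD seqW_assoc)

lemma seqD_empty: "seqD {} R = {}"
  by (rule rset_eqI) simp_all

lemma delayD_Un: "delayD P \<union> delayD Q = delayD (P \<union> Q)"
  by (auto simp: delayD_def)

lemma seqD_delayD: "seqD (delayD P) Q = delayD (seqD P Q)"
proof (rule rset_eqI)
  show "Idle k \<in> seqD (delayD P) Q \<longleftrightarrow> Idle k \<in> delayD (seqD P Q)" for k
    by (cases k) simp_all
  show "Run k \<alpha> w e \<in> seqD (delayD P) Q \<longleftrightarrow> Run k \<alpha> w e \<in> delayD (seqD P Q)" for k \<alpha> w e
    by (cases k) simp_all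
qed

lemma encapD_Un: "encapD H (P \<union> Q) = encapD H P \<union> encapD H Q"
  by (rule rset_eqI) auto

lemma encapD_seqD: "encapD H (seqD P Q) = seqD (encapD H P) (encapD H Q)"
  by (rule rset_eqI) (simp, auto simp: seqW_def wk_encapD Int_Un_distrib2, blast+)

lemma encapD_delayD: "encapD H (delayD P) = delayD (encapD H P)"
proof (rule rset_eqI)
  show "Idle k \<in> encapD H (delayD P) \<longleftrightarrow> Idle k \<in> delayD (encapD H P)" for k
    by (cases k) simp_all
  show "Run k \<alpha> w e \<in> encapD H (delayD P) \<longleftrightarrow> Run k \<alpha> w e \<in> delayD (encapD H P)" for k \<alpha> w e
    by (cases k) simp_all
qed

lemma encapD_actD:
  "a \<notin> Basic ` H \<Longrightarrow> encapD H (actD a) = actD a" "a \<in> Basic ` H \<Longrightarrow> encapD H (actD a) = {}"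
  by (cases a; rule rset_eqI; force)+

lemma unbounded_Un: "unbounded I (U \<union> V) w \<Longrightarrow> unbounded I U w \<or> unbounded I V w"
proof -
  assume *: "unbounded I (U \<union> V) w"
  define Q where "Q n W = (\<exists>v (e :: ending). n \<le> length v \<and> set v \<subseteq> Some ` I \<and> (w @ v, e) \<in> W)" for n W
  have "\<exists>W\<in>{U, V}. \<forall>n. Q n W"
  proof (rule pigeonhole_antimono)
    show "\<exists>W\<in>{U, V}. Q n W" for n
      using * unfolding unbounded_def Q_def by blast
    show "Q m W" if "m \<le> n" "Q n W" for m n W
      using that unfolding Q_def using le_trans by blast
  qed simp
  then show ?thesis unfolding unbounded_def Q_def by auto
qed

lemma abstrW_Un: "abstrW I (U \<union> V) = abstrW I U \<union> abstrW I V"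
proof -
  have "unbounded I (U \<union> V) w \<longleftrightarrow> unbounded I U w \<or> unbounded I V w" for w
    using unbounded_Un unbounded_mono[of I U w "U \<union> V"] unbounded_mono[of I V w "U \<union> V"] by blast
  then show ?thesis unfolding abstrW_def by auto
qed

lemma abstrW_empty [simp]: "abstrW I {} = {}"
  by (auto simp: abstrW_def unbounded_def)

lemma abstrW_act [simp]: "abstrW I {([], Tick), ([], Part)} = {([], Tick), ([], Part)}"
proof -
  have "\<not> unbounded I {([], Tick), ([], Part)} w" for w
    unfolding unbounded_def by (auto intro!: exI[of _ 1])
  moreover have "{(hide I w, e) |w e. (w, e) \<in> {([], Tick), ([], Part)}} = {([], Tick), ([], Part)}"
    by auto
  ultimately show ?thesis unfolding abstrW_def by simp
qed

lemma abstrD_Un: "abstrD I (P \<union> Q) = abstrD I P \<union> abstrD I Q"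
  by (rule rset_eqI) (auto simp: after_Un abstrW_Un)

lemma abstrD_seqD: "finite I \<Longrightarrow> abstrD I (seqD P Q) = seqD (abstrD I P) (abstrD I Q)"
  by (rule rset_eqI) (auto simp: abstrW_seqW wk_abstrD, auto simp: seqW_def after_def)

lemma abstrD_delayD: "abstrD I (delayD P) = delayD (abstrD I P)"
proof (rule rset_eqI)
  show "Idle k \<in> abstrD I (delayD P) \<longleftrightarrow> Idle k \<in> delayD (abstrD I P)" for k
    by (cases k) simp_all
  show "Run k \<alpha> w e \<in> abstrD I (delayD P) \<longleftrightarrow> Run k \<alpha> w e \<in> delayD (abstrD I P)" for k \<alpha> w e
    by (cases k) simp_all
qed

lemma abstrD_actD:
  "a \<notin> Basic ` I \<Longrightarrow> abstrD I (actD a) = actD a" "a \<in> Basic ` I \<Longrightarrow> abstrD I (actD a) = actD Tau"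
  by (cases a; rule rset_eqI; auto simp: after_insert hide_lab_def split: if_splits)+

lemma timeoutD_Un: "timeoutD (P \<union> Q) = timeoutD P \<union> timeoutD Q"
  by (rule rset_eqI) auto

lemma timeoutD_seqD: "timeoutD (seqD P Q) = seqD (timeoutD P) Q"
  by (rule rset_eqI) auto

lemma timeoutD_delayD: "timeoutD (delayD P) = {}"
  by (rule rset_eqI) auto

lemma timeoutD_actD: "timeoutD (actD a) = actD a"
  by (cases a; rule rset_eqI; auto)

lemma lmergeD_actD: "tick_closed Q \<Longrightarrow> lmergeD C (actD a) Q = seqD (actD a) Q"
  by (rule rset_eqI) (auto simp: after_actD mgS_act tick_closed_wk)

lemma lmergeD_actD_seqD:
  assumes "\<forall>a b c. C a b c \<longrightarrow> C b a c"
  shows "lmergeD C (seqD (actD a) P) Q = seqD (actD a) (parD C P Q)"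
  by (rule rset_eqI) (auto simp: after_actD insert_absorb wk_parD[OF assms, symmetric])

lemma lmergeD_delayD_timeoutD: "lmergeD C (delayD P) (timeoutD Q) = {}"
proof (rule rset_eqI)
  show "Run k \<alpha> w e \<in> lmergeD C (delayD P) (timeoutD Q) \<longleftrightarrow> Run k \<alpha> w e \<in> {}" for k \<alpha> w e
    by (cases k) simp_all
qed simp

lemma lmergeD_delayD_delayD: "lmergeD C (delayD P) (timeoutD Q \<union> delayD R) = delayD (lmergeD C P R)"
proof (rule rset_eqI)
  show "Idle k \<in> lmergeD C (delayD P) (timeoutD Q \<union> delayD R) \<longleftrightarrow> Idle k \<in> delayD (lmergeD C P R)" for k
    by (cases k) simp_all
  show "Run k \<alpha> w e \<in> lmergeD C (delayD P) (timeoutD Q \<union> delayD R) \<longleftrightarrow>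
      Run k \<alpha> w e \<in> delayD (lmergeD C P R)" for k \<alpha> w e
    by (cases k) (simp_all add: after_Un resid_Suc)
qed

lemma lmergeD_Un: "lmergeD C (P \<union> Q) R = lmergeD C P R \<union> lmergeD C Q R"
  by (rule rset_eqI) (auto simp: after_Un mgS_Un)

lemma cmergeD_Un:
  "cmergeD C (P \<union> Q) R = cmergeD C P R \<union> cmergeD C Q R"
  "cmergeD C P (Q \<union> R) = cmergeD C P Q \<union> cmergeD C P R"
  by (rule rset_eqI; auto simp: after_Un mgS_Un)+

lemma cmergeD_timeoutD_delayD:
  "cmergeD C (timeoutD P) (delayD Q) = {}" "cmergeD C (delayD P) (timeoutD Q) = {}"
  by (rule rset_eqI; auto split: if_splits)+

lemma cmergeD_delayD: "cmergeD C (delayD P) (delayD Q) = delayD (cmergeD C P Q)"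
proof (rule rset_eqI)
  show "Idle k \<in> cmergeD C (delayD P) (delayD Q) \<longleftrightarrow> Idle k \<in> delayD (cmergeD C P Q)" for k
    by (cases k) simp_all
  show "Run k \<alpha> w e \<in> cmergeD C (delayD P) (delayD Q) \<longleftrightarrow> Run k \<alpha> w e \<in> delayD (cmergeD C P Q)" for k \<alpha> w e
    by (cases k) simp_all
qed

text \<open>Communication to \<tau> would let two guards cancel to a silent step. Merges could then
  be shorter than their components, and guarded specifications could have several solutions;
  \<open>tau_collapse\<close> exploits this.\<close>

definition no_tau_comm :: "'a set \<Rightarrow> ('a act \<Rightarrow> 'a act \<Rightarrow> 'a act) \<Rightarrow> bool" where
  "no_tau_comm A \<gamma> \<longleftrightarrow> (\<forall>a\<in>A. \<forall>b\<in>A. \<gamma> (Basic a) (Basic b) \<noteq> Tau)"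

lemma comm_sym: "comm_fun A \<gamma> \<Longrightarrow> \<forall>a b c. comm A \<gamma> a b c \<longrightarrow> comm A \<gamma> b a c"
  by (auto simp: comm_def comm_fun_def acts_def)

lemma comm_fun_Tau_Delta:
  assumes "comm_fun A \<gamma>" "a \<in> acts A"
  shows "\<gamma> Tau a = Delta" "\<gamma> Delta a = Delta" "\<gamma> a Tau = Delta" "\<gamma> a Delta = Delta"
proof -
  have "Tau \<in> acts A" "Delta \<in> acts A" by (auto simp: acts_def)
  then show "\<gamma> Tau a = Delta" "\<gamma> Delta a = Delta" "\<gamma> a Tau = Delta" "\<gamma> a Delta = Delta"
    using assms unfolding comm_fun_def by metis+
qed

lemma after_cmergeD_actD:
  "after (cmergeD C (actD a) (actD b)) k \<alpha> =
    (if k = 0 \<and> (\<exists>a' b' c. a = Basic a' \<and> b = Basic b' \<and> \<alpha> = Some c \<and> C a' b' c)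
     then {([], Tick), ([], Part)} else {})"
proof -
  have "(w, e) \<in> after (cmergeD C (actD a) (actD b)) k \<alpha> \<longleftrightarrow> k = 0 \<and> (w, e) \<in> {([], Tick), ([], Part)} \<and>
      (\<exists>a' b' c. a = Basic a' \<and> b = Basic b' \<and> \<alpha> = Some c \<and> C a' b' c)" for w e
  proof -
    have *: "mgS C {([], Tick), ([], Part)} {([], Tick), ([], Part)} = {([], Tick), ([], Part)}"
      by (rule mgS_act) auto
    show ?thesis
      unfolding after_iff cmergeD_iff after_actD option.case
      by (cases "k = 0") (auto simp: *)
  qed
  then show ?thesis
    by (intro set_eqI) (simp add: split_paired_all del: after_iff)
qed

lemma Run_cmergeD_seqD: "Run k \<alpha> w e \<in> seqD (cmergeD C (actD a) (actD b)) P \<longleftrightarrow> k = 0 \<and> (w, e) \<in> wk P \<and>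
    (\<exists>a' b' c. a = Basic a' \<and> b = Basic b' \<and> \<alpha> = Some c \<and> C a' b' c)"
  by (auto simp: after_cmergeD_actD insert_absorb)

lemma cmergeD_actD:
  assumes "comm_fun A \<gamma>" "no_tau_comm A \<gamma>" "a \<in> acts A" "b \<in> acts A"
  shows "cmergeD (comm A \<gamma>) (actD a) (actD b) = actD (\<gamma> a b)"
proof (cases "\<exists>a' b'. a = Basic a' \<and> b = Basic b'")
  case True
  then obtain a' b' where ab: "a = Basic a'" "b = Basic b'" by blast
  then have "a' \<in> A" "b' \<in> A" using assms by (auto simp: acts_def)
  then have *: "\<gamma> a b \<noteq> Tau" "comm A \<gamma> a' b' c \<longleftrightarrow> \<gamma> a b = Basic c" for c
    using assms ab by (auto simp: no_tau_comm_def comm_def)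
  show ?thesis
    by (rule rset_eqI) (use * ab in \<open>simp_all add: Run_iff_after after_cmergeD_actD after_actD
      del: after_iff actD.simps split: option.split\<close>)
next
  case False
  then have "\<gamma> a b = Delta" using comm_fun_Tau_Delta[OF assms(1)] assms(3,4)
    by (cases a; cases b) auto
  then show ?thesis using False
    by (intro rset_eqI) (auto simp: Run_iff_after after_cmergeD_actD simp del: after_iff actD.simps(1,2))
qed

lemma cmergeD_seqD_actD:
  assumes "\<forall>a b c. C a b c \<longrightarrow> C b a c" "tick_closed P"
  shows "cmergeD C (seqD (actD a) P) (actD b) = seqD (cmergeD C (actD a) (actD b)) P"
    and "cmergeD C (actD a) (seqD (actD b) P) = seqD (cmergeD C (actD a) (actD b)) P"
proof -
  have *: "mgS C (wk P) {([], Tick), ([], Part)} = wk P" "mgS C {([], Tick), ([], Part)} (wk P) = wk P"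
    by (rule mgS_act' mgS_act; use assms tick_closed_wk in blast)+
  show "cmergeD C (seqD (actD a) P) (actD b) = seqD (cmergeD C (actD a) (actD b)) P"
    by (rule rset_eqI, simp, unfold Run_cmergeD_seqD cmergeD_iff after_seqD after_actD option.case)
      (auto simp: * insert_absorb split: if_splits)
  show "cmergeD C (actD a) (seqD (actD b) P) = seqD (cmergeD C (actD a) (actD b)) P"
    by (rule rset_eqI, simp, unfold Run_cmergeD_seqD cmergeD_iff after_seqD after_actD option.case)
      (auto simp: * insert_absorb split: if_splits)
qed

lemma cmergeD_seqD_seqD:
  assumes "\<forall>a b c. C a b c \<longrightarrow> C b a c"
  shows "cmergeD C (seqD (actD a) P) (seqD (actD b) Q) = seqD (cmergeD C (actD a) (actD b)) (parD C P Q)"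
  by (rule rset_eqI, simp, unfold Run_cmergeD_seqD wk_parD[OF assms] cmergeD_iff after_seqD after_actD option.case)
    (auto simp: insert_absorb split: if_splits)

lemma seqD_wk_cong: "wk P = wk Q \<Longrightarrow> seqD R P = seqD R Q"
  by (rule rset_eqI) simp_all

lemma wk_seqD_Tau: "wk (seqD (actD Tau) P) = wk P"
  by (simp add: wk_seqD) (simp add: wk_def insert_absorb)

lemma seqD_Tau: "seqD (actD a) (actD Tau) = actD a"
  by (rule rset_eqI) (auto simp: Run_iff_after after_actD wk_def simp del: after_iff split: if_splits)

lemma terms_iff [simp]:
  "Var X \<in> terms T A S"
  "Act a \<in> terms T A S \<longleftrightarrow> a \<in> acts A"
  "Unary f t \<in> terms T A S \<longleftrightarrow> f \<in> unops T A \<and> t \<in> terms T A S"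
  "Binary g s t \<in> terms T A S \<longleftrightarrow> g \<in> binops T \<and> s \<in> terms T A S \<and> t \<in> terms T A S"
  "Rec X E \<in> terms T A S \<longleftrightarrow> E \<in> S \<and> X \<in> dom E"
  by (auto intro: terms.intros elim: terms.cases)

lemma axiom_inst_den:
  assumes "axiom_inst \<gamma> s t" "s \<in> terms ACP A S" "t \<in> terms ACP A S"
    and "finite A" "comm_fun A \<gamma>" "no_tau_comm A \<gamma>"
  shows "den (comm A \<gamma>) s \<rho> = den (comm A \<gamma>) t \<rho>"
proof -
  note sym = comm_sym[OF assms(5)]
  have fin: "finite I" if "Abstr I \<in> unops ACP A" for I
    using that assms(4) by (auto intro: finite_subset)
  \<comment> \<open>These two identities cover the branching and the delayed \<tau> axioms: in each
    of them the removed silent step lies behind a first factor.\<close>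
  have *: "seqD R (seqD (actD Tau) P \<union> Q) = seqD R (P \<union> Q)" for R P Q :: "'a rtrace set"
    by (rule seqD_wk_cong) (simp add: wk_Un wk_seqD_Tau del: actD.simps)
  have **: "seqD R (delayD (seqD (actD Tau) P) \<union> Q) = seqD R (delayD P \<union> Q)" for R P Q :: "'a rtrace set"
    by (rule seqD_wk_cong) (simp add: wk_Un wk_delayD wk_seqD_Tau del: actD.simps)
  show ?thesis
    using assms(1-3)
    by cases (simp_all del: actD.simps(1,2) unops.simps add: seqD_Un seqD_assoc seqD_empty delayD_Un
        seqD_delayD encapD_Un encapD_seqD encapD_delayD encapD_actD abstrD_Un abstrD_seqD fin abstrD_delayD
        abstrD_actD timeoutD_Un timeoutD_seqD timeoutD_delayD timeoutD_actD parD_def[symmetric]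
        lmergeD_actD tick_closed_den lmergeD_actD_seqD[OF sym] lmergeD_delayD_timeoutD lmergeD_delayD_delayD
        lmergeD_Un cmergeD_Un cmergeD_timeoutD_delayD cmergeD_delayD cmergeD_actD[OF assms(5,6)]
        cmergeD_seqD_actD[OF sym] cmergeD_seqD_seqD[OF sym] seqD_Tau * **, simp_all add: Un_ac)
qed

section \<open>Soundness of RDP and RSP\<close>

text \<open>Length is measured on weak traces, where actions and time steps count but later silent
  steps do not; this matches guardedness by basic actions and \<sigma>, not by \<tau>.\<close>

definition sub_upto :: "nat \<Rightarrow> 'a rtrace set \<Rightarrow> 'a rtrace set \<Rightarrow> bool" where
  "sub_upto n P Q \<longleftrightarrow> (\<forall>r\<in>P. length (fst (weak r)) < n \<longrightarrow> r \<in> Q)"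

lemma sub_uptoI:
  assumes "\<And>k. Idle k \<in> P \<Longrightarrow> Suc k < n \<Longrightarrow> Idle k \<in> Q"
    and "\<And>k \<alpha> w e. Run k \<alpha> w e \<in> P \<Longrightarrow> k + length (lab \<alpha>) + length w < n \<Longrightarrow> Run k \<alpha> w e \<in> Q"
  shows "sub_upto n P Q"
  unfolding sub_upto_def
proof
  fix r assume "r \<in> P"
  then show "length (fst (weak r)) < n \<longrightarrow> r \<in> Q" by (cases r) (auto intro: assms)
qed

lemma sub_upto_Idle: "sub_upto n P Q \<Longrightarrow> Idle k \<in> P \<Longrightarrow> Suc k < n \<Longrightarrow> Idle k \<in> Q"
  by (force simp: sub_upto_def)

lemma sub_upto_Run: "sub_upto n P Q \<Longrightarrow> Run k \<alpha> w e \<in> P \<Longrightarrow> k + length (lab \<alpha>) + length w < n \<Longrightarrow> Run k \<alpha> w e \<in> Q"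
  by (force simp: sub_upto_def)

lemma sub_upto_wk: "sub_upto n P Q \<Longrightarrow> (w, e) \<in> wk P \<Longrightarrow> length w < n \<Longrightarrow> (w, e) \<in> wk Q"
  by (erule wk_cases) (auto dest: sub_upto_Idle sub_upto_Run intro: wk_IdleI[simplified] wk_RunI)

lemma sub_upto_resid:
  assumes "sub_upto n P Q" "(v, f) \<in> resid k P" "k + length v < n"
  shows "(v, f) \<in> resid k Q"
  using assms(2)
proof (cases rule: resid.cases)
  case 1
  then show ?thesis using sub_upto_Idle[OF assms(1), of "k - 1"] assms(3) by (cases k) (auto intro: resid.intros)
next
  case (2 j)
  then show ?thesis using sub_upto_Idle[OF assms(1), of "k + j"] assms(3) resid.intros(2)[of k j Q] by simp
next
  case (3 j \<alpha> w)
  then show ?thesis using sub_upto_Run[OF assms(1), of "k + j" \<alpha> w f] assms(3) resid.intros(3)[of k j \<alpha> w f Q] by simp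
qed

text \<open>A joint step takes one symbol from each side and emits one. Therefore a bound on the
  merge bounds both components, and the merge operators do not lose depth.\<close>

lemma mg_length: "mg C p q r \<Longrightarrow> length (fst p) \<le> length (fst r) \<and> length (fst q) \<le> length (fst r)"
  by (induction rule: mg.induct) auto

lemma sub_upto_seqD:
  assumes "sub_upto n P P'" "sub_upto n Q Q'"
  shows "sub_upto n (seqD P Q) (seqD P' Q')"
proof (rule sub_uptoI)
  fix k \<alpha> w e assume *: "Run k \<alpha> w e \<in> seqD P Q" "k + length (lab \<alpha>) + length w < n"
  then consider "e \<noteq> Tick" "Run k \<alpha> w e \<in> P" | u v where "w = u @ v" "Run k \<alpha> u Tick \<in> P" "(v, e) \<in> wk Q"
    by (auto simp: seqW_def)
  then show "Run k \<alpha> w e \<in> seqD P' Q'"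
  proof cases
    case 1
    then show ?thesis using sub_upto_Run[OF assms(1)] * by (auto simp: seqW_def)
  next
    case 2
    then show ?thesis using sub_upto_Run[OF assms(1)] sub_upto_wk[OF assms(2)] * by (fastforce simp: seqW_def)
  qed
qed (use sub_upto_Idle[OF assms(1)] in simp)

lemma sub_upto_lmergeD:
  assumes "sub_upto n P P'" "sub_upto n Q Q'"
  shows "sub_upto n (lmergeD C P Q) (lmergeD C P' Q')"
proof (rule sub_uptoI)
  fix k \<alpha> w g assume *: "Run k \<alpha> w g \<in> lmergeD C P Q" "k + length (lab \<alpha>) + length w < n"
  then obtain u e v f where "Run k \<alpha> u e \<in> P" "(v, f) \<in> resid k Q" "mg C (u, e) (v, f) (w, g)"
    by (auto simp: mgS_def)
  moreover from this(3) have "length u \<le> length w" "length v \<le> length w" using mg_length by force+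
  ultimately show "Run k \<alpha> w g \<in> lmergeD C P' Q'"
    using sub_upto_Run[OF assms(1), of k \<alpha> u e] sub_upto_resid[OF assms(2), of v f k] *(2)
      mgSI[of "(u, e)" "after P' k \<alpha>" "(v, f)" "resid k Q'" C "(w, g)"] by simp
qed (use sub_upto_Idle[OF assms(1)] sub_upto_Idle[OF assms(2)] in simp)

lemma sub_upto_cmergeD:
  assumes "sub_upto n P P'" "sub_upto n Q Q'"
  shows "sub_upto n (cmergeD C P Q) (cmergeD C P' Q')"
proof (rule sub_uptoI)
  fix k \<alpha> w g assume *: "Run k \<alpha> w g \<in> cmergeD C P Q" "k + length (lab \<alpha>) + length w < n"
  then obtain a b c u e v f where ab: "\<alpha> = Some c" "C a b c" and "Run k (Some a) u e \<in> P"
      "Run k (Some b) v f \<in> Q" "mg C (u, e) (v, f) (w, g)"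
    by (auto simp: mgS_def)
  moreover from this(5) have "length u \<le> length w" "length v \<le> length w" using mg_length by force+
  ultimately have "(w, g) \<in> mgS C (after P' k (Some a)) (after Q' k (Some b))"
    using sub_upto_Run[OF assms(1), of k "Some a" u e] sub_upto_Run[OF assms(2), of k "Some b" v f] *(2)
    by (intro mgSI[of "(u, e)" _ "(v, f)"]) simp_all
  then show "Run k \<alpha> w g \<in> cmergeD C P' Q'"
    unfolding cmergeD_iff using ab by blast
qed (use sub_upto_Idle[OF assms(1)] sub_upto_Idle[OF assms(2)] in simp)

lemma sub_upto_Un: "sub_upto n P P' \<Longrightarrow> sub_upto n Q Q' \<Longrightarrow> sub_upto n (P \<union> Q) (P' \<union> Q')"
  by (auto simp: sub_upto_def)

lemma sub_upto_binD: "sub_upto n P P' \<Longrightarrow> sub_upto n Q Q' \<Longrightarrow> sub_upto n (binD C f P Q) (binD C f P' Q')"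
  by (cases f) (simp_all add: sub_upto_Un sub_upto_seqD sub_upto_lmergeD sub_upto_cmergeD parD_def)

lemma sub_upto_delayD: "sub_upto n P Q \<Longrightarrow> sub_upto (Suc n) (delayD P) (delayD Q)"
  by (rule sub_uptoI) (auto simp: delayD_def dest: sub_upto_Idle sub_upto_Run)

lemma sub_upto_mono: "sub_upto n P Q \<Longrightarrow> m \<le> n \<Longrightarrow> sub_upto m P Q"
  by (auto simp: sub_upto_def)

lemma sub_upto_unD:
  assumes "sub_upto n P Q" "\<And>I. f \<noteq> Abstr I"
  shows "sub_upto n (unD f P) (unD f Q)"
proof (cases f)
  case Delay
  then show ?thesis using sub_upto_mono[OF sub_upto_delayD[OF assms(1)]] by simp
next
  case (Encap H)
  then show ?thesis by (auto intro!: sub_uptoI dest: sub_upto_Idle[OF assms(1)] sub_upto_Run[OF assms(1)])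
next
  case Timeout
  then show ?thesis using sub_upto_Run[OF assms(1), of 0] by (auto intro!: sub_uptoI)
qed (use assms in simp)

lemma sub_upto_refl: "sub_upto n P P"
  by (simp add: sub_upto_def)

lemma sub_upto_tick_close: "sub_upto n P Q \<Longrightarrow> sub_upto n (tick_close P) (tick_close Q)"
  by (rule sub_uptoI) (auto simp: tick_close_def dest: sub_upto_Idle sub_upto_Run)

text \<open>Abstraction is excluded because it loses depth: hiding shortens traces, and
  \<open>Dv\<close> depends on arbitrarily long ones.\<close>

lemma sub_upto_den:
  assumes "abs_free s" "\<And>X. sub_upto n (\<rho> X) (\<rho>' X)"
  shows "sub_upto n (den C s \<rho>) (den C s \<rho>')"
  using assms(1)
  by (induction s) (auto simp: sub_upto_refl sub_upto_binD sub_upto_tick_close assms(2) intro!: sub_upto_unD)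

lemma sub_upto_prefix: "sub_upto n P Q \<Longrightarrow> sub_upto (Suc n) (seqD (actD (Basic a)) P) (seqD (actD (Basic a)) Q)"
  by (rule sub_uptoI) (auto simp: after_actD simp del: actD.simps dest: sub_upto_wk split: if_splits option.splits)

lemma sub_upto_den_guarded:
  assumes "abs_free s" "exposed s = {}" "\<And>X. sub_upto n (\<rho> X) (\<rho>' X)"
  shows "sub_upto (Suc n) (den C s \<rho>) (den C s \<rho>')"
  using assms(1,2)
proof (induction s)
  case (Unary f t)
  then show ?case
  proof (cases f)
    case Delay
    then show ?thesis using sub_upto_delayD[OF sub_upto_den[OF _ assms(3)]] Unary by simp
  qed (auto intro!: sub_upto_unD[of _ _ _ "Encap _", simplified] sub_upto_unD[of _ _ _ Timeout, simplified])
next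
  case (Binary f s t)
  show ?case
  proof (cases "\<exists>a. f = Seq \<and> s = Act (Basic a)")
    case True
    then show ?thesis using sub_upto_prefix[OF sub_upto_den[OF _ assms(3)]] Binary.prems by (auto simp del: actD.simps)
  next
    case False
    then have "exposed (Binary f s t) = exposed s \<union> exposed t"
    proof (cases s)
      case (Act a)
      then show ?thesis using False by (cases f; cases a) simp_all
    qed (cases f; simp)+
    then show ?thesis using Binary by (auto intro: sub_upto_binD)
  qed
qed (auto simp: sub_upto_refl)

section \<open>Uniqueness of solutions\<close>

definition env_sol :: "('a \<Rightarrow> 'a \<Rightarrow> 'a \<Rightarrow> bool) \<Rightarrow> ('a, 'v) spec \<Rightarrow> ('v \<Rightarrow> 'a rtrace set) \<Rightarrow> bool" where
  "env_sol C E r \<longleftrightarrow> (\<forall>Y. r Y = (case E Y of None \<Rightarrow> {} | Some u \<Rightarrow> den C u r))"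

lemma env_sol_rec_env: "env_sol C E (rec_env C E)"
  unfolding env_sol_def by (metis rec_env_unfold)

lemma env_sol_tick_closed: "env_sol C E r \<Longrightarrow> tick_close (r Y) = r Y"
  unfolding env_sol_def
  by (metis (no_types, lifting) option.case_eq_if tick_closed_den tick_close_id tick_close_def
      empty_iff tick_closed_def)

lemma den_replace1: "replace1 Y u s s' \<Longrightarrow> tick_close (r Y) = den C u r \<Longrightarrow> den C s r = den C s' r"
  by (induction rule: replace1.induct) auto

text \<open>
  Guarded terms produce one more symbol than they read, so two solutions agree on traces of
  every length.
\<close>

lemma env_sol_unique:
  assumes sound: "\<And>s t \<rho>. derives ACP A \<gamma> S s t \<Longrightarrow> den C s \<rho> = den C t \<rho>"
    and "guarded_modulo ACP A \<gamma> S E" "env_sol C E r" "env_sol C E r'"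
  shows "r = r'"
proof -
  have rew: "den C s r = den C t r" if "(rewrite_step ACP A \<gamma> S E X)\<^sup>*\<^sup>* s t" "env_sol C E r" for X s t r
    using that
  proof (induction rule: rtranclp_induct)
    case (step y z)
    have "den C u r = tick_close (r Y)" if "E Y = Some u" for Y u
      using step.prems that env_sol_tick_closed[OF step.prems, of Y] unfolding env_sol_def by (metis option.case(2))
    then have "den C y r = den C z r"
      using step(2) sound den_replace1 unfolding rewrite_step_def by metis
    with step show ?case by simp
  qed simp
  have "\<exists>t'. guarded t' \<and> r X = den C t' r \<and> r' X = den C t' r'" if X: "E X = Some u" for X u
  proof -
    obtain t' where "(rewrite_step ACP A \<gamma> S E X)\<^sup>*\<^sup>* u t'" "guarded t'"
      using assms(2) X unfolding guarded_modulo_def by blast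
    then show ?thesis using rew assms(3,4) X unfolding env_sol_def
      by (intro exI[of _ t']) (metis option.case(2))
  qed
  then obtain g where g: "\<And>X u. E X = Some u \<Longrightarrow> guarded (g X) \<and> r X = den C (g X) r \<and> r' X = den C (g X) r'"
    by metis
  have *: "sub_upto n (r1 X) (r2 X)" if "\<And>X. E X = None \<Longrightarrow> r1 X = {}"
      "\<And>X u. E X = Some u \<Longrightarrow> guarded (g X) \<and> r1 X = den C (g X) r1 \<and> r2 X = den C (g X) r2" for n X r1 r2
  proof (induction n arbitrary: X)
    case (Suc n)
    show ?case
    proof (cases "E X")
      case (Some u)
      then have X: "guarded (g X)" "r1 X = den C (g X) r1" "r2 X = den C (g X) r2" using that by blast+
      show ?thesis
      proof (cases "vars (g X) = {}")
        \<comment> \<open>A closed witness has the same value in both environments, even if it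
          contains abstraction; here no depth has to be gained.\<close>
        case True
        then have "den C (g X) r1 = den C (g X) r2" by (intro den_vars_cong) simp
        then show ?thesis using X by (simp add: sub_upto_refl)
      next
        case False
        then have "abs_free (g X)" "exposed (g X) = {}" using X(1) by (auto simp: guarded_def)
        from sub_upto_den_guarded[OF this Suc, of C] show ?thesis using X by simp
      qed
    qed (simp add: that sub_upto_def)
  qed (simp add: sub_upto_def)
  have none: "r X = {}" "r' X = {}" if "E X = None" for X using assms(3,4) that unfolding env_sol_def by simp_all
  have "sub_upto n (r X) (r' X)" "sub_upto n (r' X) (r X)" for n X
    by (rule *; use none g in blast)+
  then have "r X \<subseteq> r' X" "r' X \<subseteq> r X" for X
    unfolding sub_upto_def by blast+
  then show ?thesis by (intro ext subset_antisym)
qed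

lemma derives_den:
  assumes "derives ACP A \<gamma> S s t" "finite A" "comm_fun A \<gamma>" "no_tau_comm A \<gamma>"
    and vars: "\<And>E X u. E \<in> S \<Longrightarrow> E X = Some u \<Longrightarrow> vars u \<subseteq> dom E"
    and uniq: "\<And>E r r'. E \<in> S \<Longrightarrow> env_sol (comm A \<gamma>) E r \<Longrightarrow> env_sol (comm A \<gamma>) E r' \<Longrightarrow> r = r'"
  shows "den (comm A \<gamma>) s \<rho> = den (comm A \<gamma>) t \<rho>"
  using assms(1)
proof (induction arbitrary: \<rho>)
  case (ax s t)
  then show ?case using axiom_inst_den assms(2-4) by blast
next
  case (RDP E X t)
  have "den (comm A \<gamma>) (rec_inst E t) \<rho> = den (comm A \<gamma>) t (rec_env (comm A \<gamma>) E)"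
    unfolding rec_inst_def den_subst
    by (rule den_vars_cong) (use vars[OF RDP] in auto)
  then show ?case using RDP by (subst den_Rec, subst rec_env_unfold) simp
next
  case (RSP E f X)
  \<comment> \<open>The premises of RSP say that the denotations of the terms \<open>f Y\<close>
    solve \<open>E\<close>. Uniqueness identifies them with the least solution.\<close>
  define r where "r Y = (if Y \<in> dom E then den (comm A \<gamma>) (f Y) \<rho> else {})" for Y
  have "env_sol (comm A \<gamma>) E r"
    unfolding env_sol_def
  proof
    fix Y show "r Y = (case E Y of None \<Rightarrow> {} | Some u \<Rightarrow> den (comm A \<gamma>) u r)"
    proof (cases "E Y")
      case (Some u)
      have "den (comm A \<gamma>) u r = den (comm A \<gamma>) u (\<lambda>Y. den (comm A \<gamma>) (f Y) \<rho>)"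
        by (rule den_vars_cong) (use vars[OF RSP(1) Some] in \<open>auto simp: r_def\<close>)
      then show ?thesis using RSP.IH[OF Some, of \<rho>] Some by (auto simp: r_def den_subst)
    qed (auto simp: r_def)
  qed
  then have "r = rec_env (comm A \<gamma>) E" using uniq[OF RSP(1) _ env_sol_rec_env] by blast
  then show ?case using \<open>X \<in> dom E\<close> by (metis den_Rec r_def)
qed simp_all

lemma stage_mono: "i \<le> j \<Longrightarrow> stage T A \<gamma> i \<subseteq> stage T A \<gamma> j"
  by (rule lift_Suc_mono_le) auto

lemma stage_vars: "E \<in> stage T A \<gamma> i \<Longrightarrow> E X = Some u \<Longrightarrow> vars u \<subseteq> dom E"
  by (induction i) (auto simp: spec_over_def ran_def)

text \<open>Soundness and uniqueness advance together: uniqueness for the specifications of a stage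
  makes its RSP sound, and soundness of its derivations makes the rewriting to guarded form
  harmless, which gives uniqueness at the next stage.\<close>

lemma stage_unique:
  assumes "finite A" "comm_fun A \<gamma>" "no_tau_comm A \<gamma>" "E \<in> stage ACP A \<gamma> i"
    "env_sol (comm A \<gamma>) E r" "env_sol (comm A \<gamma>) E r'"
  shows "r = r'"
  using assms(4-)
proof (induction i arbitrary: E r r')
  case (Suc i)
  show ?case
  proof (cases "E \<in> stage ACP A \<gamma> i")
    case False
    then have "guarded_modulo ACP A \<gamma> (stage ACP A \<gamma> i) E" using Suc.prems by simp
    moreover have "den (comm A \<gamma>) s \<rho> = den (comm A \<gamma>) t \<rho>"
      if "derives ACP A \<gamma> (stage ACP A \<gamma> i) s t" for s t and \<rho> :: "'b \<Rightarrow> 'a rtrace set"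
      using derives_den[OF that assms(1-3)] stage_vars[of _ ACP A \<gamma> i] Suc.IH by blast
    ultimately show ?thesis using env_sol_unique Suc.prems(2,3) by blast
  qed (use Suc in blast)
qed simp

theorem REC_derives_den:
  assumes "REC_derives ACP A \<gamma> s t" "finite A" "comm_fun A \<gamma>" "no_tau_comm A \<gamma>"
  shows "den (comm A \<gamma>) s \<rho> = den (comm A \<gamma>) t \<rho>"
proof (rule derives_den[OF assms(1)[unfolded REC_derives_def] assms(2-4)])
  fix E :: "'b \<Rightarrow> ('a, 'b) trm option" assume "E \<in> rec_specs ACP A \<gamma>"
  then obtain i where "E \<in> stage ACP A \<gamma> i" by (auto simp: rec_specs_def)
  note i = this
  show "vars u \<subseteq> dom E" if "E X = Some u" for X u
    using stage_vars[OF i that] .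
  show "r = r'" if "env_sol (comm A \<gamma>) E r" "env_sol (comm A \<gamma>) E r'" for r r'
    using stage_unique[OF assms(2-4) i that] .
qed

section \<open>Absence of divergence without abstraction\<close>

definition no_div :: "'a rtrace set \<Rightarrow> bool" where
  "no_div P \<longleftrightarrow> (\<forall>k \<alpha> w. Run k \<alpha> w Dv \<notin> P)"

lemma mg_Dv: "mg C p q r \<Longrightarrow> snd r = Dv \<Longrightarrow> snd p = Dv \<or> snd q = Dv"
  by (induction rule: mg.induct) (auto split: if_splits)

lemma wk_no_div: "no_div P \<Longrightarrow> (w, Dv) \<notin> wk P"
  by (auto simp: no_div_def elim: wk_cases)

lemma resid_no_div: "no_div P \<Longrightarrow> (w, Dv) \<notin> resid k P"
  by (auto simp: no_div_def elim: resid.cases)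

lemma no_div_Un: "no_div (P \<union> Q) \<longleftrightarrow> no_div P \<and> no_div Q"
  by (auto simp: no_div_def)

lemma mgS_Dv:
  assumes "(w, Dv) \<in> mgS C U V"
  shows "\<exists>v. (v, Dv) \<in> U \<or> (v, Dv) \<in> V"
proof -
  obtain p q where "p \<in> U" "q \<in> V" "mg C p q (w, Dv)" using assms unfolding mgS_def by blast
  then show ?thesis using mg_Dv[of C p q "(w, Dv)"] by (cases p; cases q) auto
qed

lemma no_div_binD:
  assumes "no_div P" "no_div Q"
  shows "no_div (binD C f P Q)"
proof -
  have l: "no_div (lmergeD C P Q)" if "no_div P" "no_div Q" for P Q :: "'a rtrace set"
    using that resid_no_div[OF that(2)] mgS_Dv[of _ C "after P _ _" "resid _ Q"]
    by (fastforce simp: no_div_def[of "lmergeD C P Q"] no_div_def[of P])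
  have c: "no_div (cmergeD C P Q)"
    using assms mgS_Dv[of _ C "after P _ _" "after Q _ _"]
    by (fastforce simp: no_div_def)
  have "no_div (seqD P Q)"
    using assms wk_no_div[OF assms(2)] by (auto simp: no_div_def[of "seqD P Q"] no_div_def[of P] seqW_def)
  with l c assms show ?thesis
    by (cases f) (simp_all add: no_div_Un parD_def)
qed

lemma no_div_unD: "no_div P \<Longrightarrow> (\<And>I. f \<noteq> Abstr I) \<Longrightarrow> no_div (unD f P)"
  by (cases f) (auto simp: no_div_def delayD_def)

lemma no_div_tick_close: "no_div P \<Longrightarrow> no_div (tick_close P)"
  by (auto simp: no_div_def tick_close_def)

text \<open>
  Only abstraction creates \<open>Dv\<close>, hence the traces without \<open>Dv\<close> of the least solution of an
  abstraction-free specification already form a pre-fixed point.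
\<close>

lemma abs_free_no_div:
  assumes "abs_free t" "\<And>X. no_div (\<rho> X)"
  shows "no_div (den C t \<rho>)"
  using assms
proof (induction t arbitrary: \<rho>)
  case (Act a)
  then show ?case by (cases a) (auto simp: no_div_def)
next
  case (Unary f t)
  then show ?case by (auto intro!: no_div_unD)
next
  case (Rec X E)
  define r where "r Y = {x \<in> rec_env C E Y. \<forall>k \<alpha> w. x \<noteq> Run k \<alpha> w Dv}" for Y
  have "rec_env C E \<le> r"
    unfolding rec_env_def
  proof (rule lfp_lowerbound, rule le_funI)
    fix Y
    have le: "r \<le> rec_env C E" by (auto simp: r_def le_fun_def)
    show "(case E Y of None \<Rightarrow> {} | Some u \<Rightarrow> den C u r) \<subseteq> r Y"
    proof (cases "E Y")
      case (Some u)
      have "no_div (den C u r)"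
      proof (rule Rec.IH)
        show "E Y \<in> range E" "u \<in> set_option (E Y)" using Some by (blast, simp)
        show "abs_free u" using Rec.prems(1) Some unfolding abs_free_Rec by (auto simp: ran_def)
      qed (auto simp: r_def no_div_def)
      moreover have "den C u r \<subseteq> rec_env C E Y"
        using den_mono[OF le, of C u] Some by (subst rec_env_unfold) simp
      ultimately show ?thesis using Some by (auto simp: r_def no_div_def)
    qed simp
  qed
  then have "rec_env C E X \<subseteq> r X" by (simp add: le_fun_def)
  then show ?case by (auto simp: no_div_def r_def)
qed (auto simp: no_div_binD no_div_tick_close)

section \<open>Head normal forms\<close>

lemma terms_mono: "t \<in> terms T A S \<Longrightarrow> S \<subseteq> S' \<Longrightarrow> t \<in> terms T A S'"
  by (induction rule: terms.induct) auto

lemma derives_mono: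
  assumes "derives T A \<gamma> S s t" "S \<subseteq> S'"
  shows "derives T A \<gamma> S' s t"
  using assms(1)
proof induction
  case (ax s t)
  then show ?case using derives.ax terms_mono[OF _ assms(2)] by blast
next
  case (RSP E f X)
  then show ?case using derives.RSP[of E S' T A \<gamma> f X] assms(2) by blast
qed (use assms(2) in \<open>auto intro: derives.intros terms_mono\<close>)

lemma subst_terms: "t \<in> terms T A S \<Longrightarrow> (\<And>X. f X \<in> terms T A S) \<Longrightarrow> subst f t \<in> terms T A S"
  by (induction rule: terms.induct) auto

lemma subst_subst: "subst g (subst f t) = subst (\<lambda>X. subst g (f X)) t"
  by (induction t) auto

lemma subst_closed: "vars t = {} \<Longrightarrow> subst f t = t"
  by (induction t) auto

lemma subst_vars_cong: "(\<And>X. X \<in> vars t \<Longrightarrow> f X = g X) \<Longrightarrow> subst f t = subst g t"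
  by (induction t) auto

lemma axiom_inst_subst: "axiom_inst \<gamma> s t \<Longrightarrow> axiom_inst \<gamma> (subst f s) (subst f t)"
  by (induction rule: axiom_inst.induct) (auto intro: axiom_inst.intros)

text \<open>The rewriting behind guardedness acts on open right-hand sides; this transports it to
  their closed instances. Recursion constants are closed, and an application of RSP is carried over
  by composing substitutions.\<close>

lemma derives_subst:
  assumes "derives T A \<gamma> S s t" and f: "\<And>X. f X \<in> terms T A S"
    and vars: "\<And>E X u. E \<in> S \<Longrightarrow> E X = Some u \<Longrightarrow> vars u \<subseteq> dom E"
  shows "derives T A \<gamma> S (subst f s) (subst f t)"
  using assms(1)
proof induction
  case (ax s t)
  then show ?case using axiom_inst_subst subst_terms f derives.ax by metis
next
  case (RDP E X t)
  have "subst f (rec_inst E t) = rec_inst E t"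
    unfolding rec_inst_def subst_subst by (rule subst_vars_cong) (use vars[OF RDP] in auto)
  then show ?case using derives.RDP[OF RDP] by simp
next
  case (RSP E g X)
  have "derives T A \<gamma> S (subst f (g Y)) (subst (\<lambda>Y. subst f (g Y)) u)" if "E Y = Some u" for Y u
    using RSP.IH[OF that] by (simp add: subst_subst)
  from derives.RSP[OF RSP(1) this, of X] RSP show ?case by simp
qed (auto intro: derives.intros subst_terms f)

lemma stage_terms: "E \<in> stage T A \<gamma> i \<Longrightarrow> E X = Some u \<Longrightarrow> u \<in> terms T A (stage T A \<gamma> i)"
proof (induction i)
  case (Suc i)
  then show ?case
    by (auto simp: spec_over_def ran_def intro: terms_mono)
qed simp

lemma stage_sub_rec_specs: "stage T A \<gamma> i \<subseteq> rec_specs T A \<gamma>"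
  by (auto simp: rec_specs_def)

lemma rec_specs_vars: "E \<in> rec_specs T A \<gamma> \<Longrightarrow> E X = Some u \<Longrightarrow> vars u \<subseteq> dom E"
  by (auto simp: rec_specs_def dest!: stage_vars)

lemma rec_inst_terms: "E \<in> S \<Longrightarrow> t \<in> terms T A S \<Longrightarrow> rec_inst E t \<in> terms T A S"
  unfolding rec_inst_def by (rule subst_terms) auto

lemma derives_terms:
  assumes "derives T A \<gamma> S s t" "\<And>E X u. E \<in> S \<Longrightarrow> E X = Some u \<Longrightarrow> u \<in> terms T A S"
  shows "s \<in> terms T A S \<and> t \<in> terms T A S"
  using assms(1)
proof induction
  case (RDP E X t)
  then show ?case using rec_inst_terms[OF RDP(1) assms(2)[OF RDP]] by (auto simp: domI)
next
  case (RSP E f X)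
  then show ?case by auto
qed auto

locale acp =
  fixes A :: "'a set" and \<gamma> :: "'a act \<Rightarrow> 'a act \<Rightarrow> 'a act"
  assumes finite_A: "finite A" and comm_fun: "comm_fun A \<gamma>"
begin

abbreviation eqv :: "('a, 'v) trm \<Rightarrow> ('a, 'v) trm \<Rightarrow> bool" (infix "\<approx>" 50) where
  "s \<approx> t \<equiv> REC_derives ACP A \<gamma> s t"

abbreviation tm :: "('a, 'v) trm \<Rightarrow> bool" where
  "tm t \<equiv> t \<in> terms ACP A (rec_specs ACP A \<gamma>)"

abbreviation closed_tms :: "('a, 'v) trm set" where
  "closed_tms \<equiv> closed_REC_terms ACP A \<gamma>"

lemma closed_tms_iff: "t \<in> closed_tms \<longleftrightarrow> tm t \<and> vars t = {}"
  by (simp add: closed_REC_terms_def)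

lemma eqv_refl: "tm t \<Longrightarrow> t \<approx> t"
  unfolding REC_derives_def by (rule derives.refl)

lemma eqv_sym: "s \<approx> t \<Longrightarrow> t \<approx> s"
  unfolding REC_derives_def by (rule derives.sym)

lemma eqv_trans [trans]: "s \<approx> t \<Longrightarrow> t \<approx> u \<Longrightarrow> s \<approx> u"
  unfolding REC_derives_def by (rule derives.trans)

lemma eqv_Unary: "s \<approx> t \<Longrightarrow> f \<in> unops ACP A \<Longrightarrow> Unary f s \<approx> Unary f t"
  unfolding REC_derives_def by (rule derives.cong_Unary)

lemma eqv_Binary: "s \<approx> t \<Longrightarrow> s' \<approx> t' \<Longrightarrow> Binary f s s' \<approx> Binary f t t'"
  unfolding REC_derives_def by (rule derives.cong_Binary) simp_all

lemma eqv_Binary1: "s \<approx> t \<Longrightarrow> tm y \<Longrightarrow> Binary f s y \<approx> Binary f t y"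
  by (intro eqv_Binary eqv_refl)

lemma eqv_Binary2: "s \<approx> t \<Longrightarrow> tm y \<Longrightarrow> Binary f y s \<approx> Binary f y t"
  by (intro eqv_Binary eqv_refl)

lemma eqv_ax: "axiom_inst \<gamma> s t \<Longrightarrow> tm s \<Longrightarrow> tm t \<Longrightarrow> s \<approx> t"
  unfolding REC_derives_def by (rule derives.ax)

lemma acts_Tau_Delta [simp]: "Tau \<in> acts A" "Delta \<in> acts A"
  by (simp_all add: acts_def)

lemma acts_Basic [simp]: "Basic a \<in> acts A \<longleftrightarrow> a \<in> A"
  by (auto simp: acts_def)

lemma acts_comm: "a \<in> acts A \<Longrightarrow> b \<in> acts A \<Longrightarrow> \<gamma> a b \<in> acts A"
  using comm_fun by (simp add: comm_fun_def)

section \<open>The axioms as derived equations\<close>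

lemma
  assumes "tm x" "tm y"
  shows alt_comm: "x \<oplus> y \<approx> y \<oplus> x"
    and alt_delta: "x \<oplus> Act Delta \<approx> x"
    and delta_seq: "Act Delta \<odot> x \<approx> Act Delta"
    and delay_alt: "\<sigma> x \<oplus> \<sigma> y \<approx> \<sigma> (x \<oplus> y)"
    and delay_seq: "\<sigma> x \<odot> y \<approx> \<sigma> (x \<odot> y)"
    and par_expand: "x \<parallel> y \<approx> ((x \<lhd> y) \<oplus> (y \<lhd> x)) \<oplus> (x \<bowtie> y)"
    and delay_lmerge_timeout: "\<sigma> x \<lhd> \<nu> y \<approx> Act Delta"
    and timeout_cmerge_delay: "\<nu> x \<bowtie> \<sigma> y \<approx> Act Delta"
    and delay_cmerge_timeout: "\<sigma> x \<bowtie> \<nu> y \<approx> Act Delta"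
    and delay_cmerge_delay: "\<sigma> x \<bowtie> \<sigma> y \<approx> \<sigma> (x \<bowtie> y)"
    and timeout_alt: "\<nu> (x \<oplus> y) \<approx> \<nu> x \<oplus> \<nu> y"
    and timeout_seq: "\<nu> (x \<odot> y) \<approx> \<nu> x \<odot> y"
    and timeout_delay: "\<nu> (\<sigma> x) \<approx> Act Delta"
  by (rule eqv_ax, rule axiom_inst.intros, use assms in simp_all)+

lemma
  assumes "tm x" "tm y" "tm z"
  shows alt_assoc: "(x \<oplus> y) \<oplus> z \<approx> x \<oplus> (y \<oplus> z)"
    and alt_seq: "(x \<oplus> y) \<odot> z \<approx> (x \<odot> z) \<oplus> (y \<odot> z)"
    and seq_assoc: "(x \<odot> y) \<odot> z \<approx> x \<odot> (y \<odot> z)"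
    and delay_lmerge_delay: "\<sigma> x \<lhd> (\<nu> y \<oplus> \<sigma> z) \<approx> \<sigma> (x \<lhd> z)"
    and alt_lmerge: "(x \<oplus> y) \<lhd> z \<approx> (x \<lhd> z) \<oplus> (y \<lhd> z)"
    and alt_cmerge: "(x \<oplus> y) \<bowtie> z \<approx> (x \<bowtie> z) \<oplus> (y \<bowtie> z)"
    and cmerge_alt: "x \<bowtie> (y \<oplus> z) \<approx> (x \<bowtie> y) \<oplus> (x \<bowtie> z)"
  by (rule eqv_ax, rule axiom_inst.intros, use assms in simp_all)+

lemma
  assumes "tm x" "tm y" "H \<subseteq> A"
  shows encap_alt: "\<partial> H (x \<oplus> y) \<approx> \<partial> H x \<oplus> \<partial> H y"
    and encap_seq: "\<partial> H (x \<odot> y) \<approx> \<partial> H x \<odot> \<partial> H y"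
    and encap_delay: "\<partial> H (\<sigma> x) \<approx> \<sigma> (\<partial> H x)"
    and abstr_alt: "\<tau> H (x \<oplus> y) \<approx> \<tau> H x \<oplus> \<tau> H y"
    and abstr_seq: "\<tau> H (x \<odot> y) \<approx> \<tau> H x \<odot> \<tau> H y"
    and abstr_delay: "\<tau> H (\<sigma> x) \<approx> \<sigma> (\<tau> H x)"
  by (rule eqv_ax, rule axiom_inst.intros, use assms in simp_all)+

lemma encap_act:
  assumes "a \<in> acts A" "H \<subseteq> A"
  shows "\<partial> H (Act a) \<approx> Act (if a \<in> Basic ` H then Delta else a)"
  by (rule eqv_ax) (use assms in \<open>auto intro: axiom_inst.intros\<close>)

lemma abstr_act:
  assumes "a \<in> acts A" "I \<subseteq> A"
  shows "\<tau> I (Act a) \<approx> Act (if a \<in> Basic ` I then Tau else a)"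
  by (rule eqv_ax) (use assms in \<open>auto intro: axiom_inst.intros\<close>)

lemma
  assumes "a \<in> acts A" "b \<in> acts A"
  shows act_cmerge_act: "Act a \<bowtie> Act b \<approx> Act (\<gamma> a b)"
  by (rule eqv_ax, rule axiom_inst.intros, rule HOL.refl, use assms acts_comm in simp_all)

lemma
  assumes "a \<in> acts A"
  shows timeout_act: "\<nu> (Act a) \<approx> Act a"
    and act_tau: "Act a \<odot> Act Tau \<approx> Act a"
  by (rule eqv_ax, rule axiom_inst.intros, use assms in simp_all)+

lemma
  assumes "a \<in> acts A" "tm x"
  shows act_lmerge: "Act a \<lhd> x \<approx> Act a \<odot> x"
  by (rule eqv_ax, rule axiom_inst.intros, use assms in simp_all)

lemma
  assumes "a \<in> acts A" "tm x" "tm y"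
  shows prefix_lmerge: "(Act a \<odot> x) \<lhd> y \<approx> Act a \<odot> (x \<parallel> y)"
  by (rule eqv_ax, rule axiom_inst.intros, use assms in simp_all)

lemma
  assumes "a \<in> acts A" "b \<in> acts A" "tm x"
  shows prefix_cmerge_act: "(Act a \<odot> x) \<bowtie> Act b \<approx> Act (\<gamma> a b) \<odot> x"
    and act_cmerge_prefix: "Act a \<bowtie> (Act b \<odot> x) \<approx> Act (\<gamma> a b) \<odot> x"
proof -
  have *: "(Act a \<bowtie> Act b) \<odot> x \<approx> Act (\<gamma> a b) \<odot> x"
    using eqv_Binary1[OF act_cmerge_act[OF assms(1,2)] assms(3)] .
  show "(Act a \<odot> x) \<bowtie> Act b \<approx> Act (\<gamma> a b) \<odot> x" "Act a \<bowtie> (Act b \<odot> x) \<approx> Act (\<gamma> a b) \<odot> x"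
    by (rule eqv_trans[OF eqv_ax *], rule axiom_inst.intros, use assms in simp_all)+
qed

lemma prefix_cmerge_prefix:
  assumes "a \<in> acts A" "b \<in> acts A" "tm x" "tm y"
  shows "(Act a \<odot> x) \<bowtie> (Act b \<odot> y) \<approx> Act (\<gamma> a b) \<odot> (x \<parallel> y)"
proof -
  have "(Act a \<odot> x) \<bowtie> (Act b \<odot> y) \<approx> (Act a \<bowtie> Act b) \<odot> (x \<parallel> y)"
    by (rule eqv_ax, rule axiom_inst.intros, use assms in simp_all)
  also have "\<dots> \<approx> Act (\<gamma> a b) \<odot> (x \<parallel> y)"
    by (rule eqv_Binary1[OF act_cmerge_act[OF assms(1,2)]]) (use assms in simp)
  finally show ?thesis .
qed

text \<open>
  \<open>nf T K\<close> are the head normal forms with residuals in \<open>T\<close> after \<open>\<tau>\<close> and in \<open>K\<close> otherwise. In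
  \<open>tree K\<close> the residuals after \<open>\<tau>\<close> are again trees, so that elements of \<open>K\<close> occur only guarded.
\<close>

inductive_set nf :: "('a, 'v) trm set \<Rightarrow> ('a, 'v) trm set \<Rightarrow> ('a, 'v) trm set" for T K where
  nf_act: "a \<in> acts A \<Longrightarrow> Act a \<in> nf T K"
| nf_prefix: "a \<in> A \<Longrightarrow> x \<in> K \<Longrightarrow> Act (Basic a) \<odot> x \<in> nf T K"
| nf_tau: "x \<in> T \<Longrightarrow> Act Tau \<odot> x \<in> nf T K"
| nf_delay: "x \<in> K \<Longrightarrow> \<sigma> x \<in> nf T K"
| nf_alt: "x \<in> nf T K \<Longrightarrow> y \<in> nf T K \<Longrightarrow> x \<oplus> y \<in> nf T K"

inductive_set tree :: "('a, 'v) trm set \<Rightarrow> ('a, 'v) trm set" for K where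
  tree_act: "a \<in> acts A \<Longrightarrow> Act a \<in> tree K"
| tree_prefix: "a \<in> A \<Longrightarrow> x \<in> K \<Longrightarrow> Act (Basic a) \<odot> x \<in> tree K"
| tree_tau: "x \<in> tree K \<Longrightarrow> Act Tau \<odot> x \<in> tree K"
| tree_delay: "x \<in> K \<Longrightarrow> \<sigma> x \<in> tree K"
| tree_alt: "x \<in> tree K \<Longrightarrow> y \<in> tree K \<Longrightarrow> x \<oplus> y \<in> tree K"

lemma nf_mono: "h \<in> nf T K \<Longrightarrow> T \<subseteq> T' \<Longrightarrow> K \<subseteq> K' \<Longrightarrow> h \<in> nf T' K'"
  by (induction rule: nf.induct) (auto intro: nf.intros)

lemma tree_mono: "h \<in> tree K \<Longrightarrow> K \<subseteq> K' \<Longrightarrow> h \<in> tree K'"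
  by (induction rule: tree.induct) (auto intro: tree.intros)

definition hnf :: "('a, 'v) trm set \<Rightarrow> ('a, 'v) trm set \<Rightarrow> ('a, 'v) trm \<Rightarrow> bool" where
  "hnf T K s \<longleftrightarrow> (\<exists>h\<in>nf T K. s \<approx> h)"

definition treelike :: "('a, 'v) trm set \<Rightarrow> ('a, 'v) trm \<Rightarrow> bool" where
  "treelike K s \<longleftrightarrow> (\<exists>h\<in>tree K. s \<approx> h)"

lemma hnf_cong: "s \<approx> t \<Longrightarrow> hnf T K t \<Longrightarrow> hnf T K s"
  unfolding hnf_def using eqv_trans by blast

lemma treelike_cong: "s \<approx> t \<Longrightarrow> treelike K t \<Longrightarrow> treelike K s"
  unfolding treelike_def using eqv_trans by blast

lemma hnf_mono: "hnf T K s \<Longrightarrow> T \<subseteq> T' \<Longrightarrow> K \<subseteq> K' \<Longrightarrow> hnf T' K' s"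
  unfolding hnf_def using nf_mono by blast

lemma treelike_mono: "treelike K s \<Longrightarrow> K \<subseteq> K' \<Longrightarrow> treelike K' s"
  unfolding treelike_def using tree_mono by blast

lemma hnf_alt: "hnf T K x \<Longrightarrow> hnf T K y \<Longrightarrow> hnf T K (x \<oplus> y)"
  unfolding hnf_def using nf_alt eqv_Binary by blast

lemma treelike_alt: "treelike K x \<Longrightarrow> treelike K y \<Longrightarrow> treelike K (x \<oplus> y)"
  unfolding treelike_def using tree_alt eqv_Binary by blast

lemma hnf_nf: "h \<in> nf T K \<Longrightarrow> tm h \<Longrightarrow> hnf T K h"
  unfolding hnf_def by (rule bexI[of _ h]) (simp_all add: eqv_refl)

lemma treelike_tree: "h \<in> tree K \<Longrightarrow> tm h \<Longrightarrow> treelike K h"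
  unfolding treelike_def by (rule bexI[of _ h]) (simp_all add: eqv_refl)

lemma hnf_act: "a \<in> acts A \<Longrightarrow> hnf T K (Act a)"
  by (rule hnf_nf) (simp_all add: nf_act)

lemma treelike_act: "a \<in> acts A \<Longrightarrow> treelike K (Act a)"
  by (rule treelike_tree) (simp_all add: tree_act)

lemma hnf_delay: "x \<in> K \<Longrightarrow> tm x \<Longrightarrow> hnf T K (\<sigma> x)"
  by (rule hnf_nf) (simp_all add: nf_delay)

lemma treelike_delay: "x \<in> K \<Longrightarrow> tm x \<Longrightarrow> treelike K (\<sigma> x)"
  by (rule treelike_tree) (simp_all add: tree_delay)

lemma hnf_prefix:
  assumes "a \<in> acts A" "x \<in> K" "a = Tau \<Longrightarrow> x \<in> T" "tm x"
  shows "hnf T K (Act a \<odot> x)"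
proof (cases a)
  case Delta
  then show ?thesis using hnf_cong[OF delta_seq[OF assms(4,4)] hnf_act] by simp
qed (use assms in \<open>auto intro!: hnf_nf nf.intros\<close>)

lemma treelike_prefix:
  assumes "a \<in> acts A" "x \<in> K" "a \<noteq> Tau" "tm x"
  shows "treelike K (Act a \<odot> x)"
proof (cases a)
  case Delta
  then show ?thesis using treelike_cong[OF delta_seq[OF assms(4,4)] treelike_act] by simp
qed (use assms in \<open>auto intro!: treelike_tree tree.intros\<close>)

lemma treelike_tau:
  assumes "treelike K x"
  shows "treelike K (Act Tau \<odot> x)"
proof -
  obtain h where "h \<in> tree K" "x \<approx> h" using assms unfolding treelike_def by blast
  then show ?thesis using tree_tau[of h K] eqv_Binary2[of x h "Act Tau" Seq]
    unfolding treelike_def by auto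
qed

lemma hnf_no_tau_treelike: "hnf {} K s \<Longrightarrow> treelike K s"
proof -
  have "h \<in> tree K" if "h \<in> nf {} K" for h
    using that by (induction rule: nf.induct) (auto intro: tree.intros)
  then show "hnf {} K s \<Longrightarrow> treelike K s" unfolding hnf_def treelike_def by blast
qed

end

section \<open>Operators on head normal forms\<close>

lemma wk_Dv_iff: "([], Dv) \<in> wk P \<longleftrightarrow> Run 0 None [] Dv \<in> P"
proof
  assume "([], Dv) \<in> wk P"
  then show "Run 0 None [] Dv \<in> P"
  proof (cases rule: wk_cases)
    case (3 k \<alpha> w e)
    then show ?thesis by (cases \<alpha>) auto
  qed auto
qed (use wk_RunI[of 0 None "[]" Dv P] in simp)

context acp
begin

text \<open>The trace that no tree has: behind the finitely nested \<tau> prefixes of a tree there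
  are only constants and terms that begin with a visible action or a time step.\<close>

definition diverges :: "('a, 'v) trm \<Rightarrow> bool" where
  "diverges s \<longleftrightarrow> Run 0 None [] Dv \<in> den (comm A \<gamma>) s (\<lambda>_. {})"

lemma eqv_den: "no_tau_comm A \<gamma> \<Longrightarrow> s \<approx> t \<Longrightarrow> den (comm A \<gamma>) s \<rho> = den (comm A \<gamma>) t \<rho>"
  using REC_derives_den finite_A comm_fun by blast

lemma diverges_cong: "no_tau_comm A \<gamma> \<Longrightarrow> s \<approx> t \<Longrightarrow> diverges s \<longleftrightarrow> diverges t"
  by (simp add: diverges_def eqv_den)

lemma diverges_alt [simp]: "diverges (x \<oplus> y) \<longleftrightarrow> diverges x \<or> diverges y"
  by (simp add: diverges_def)

lemma diverges_tau [simp]: "diverges (Act Tau \<odot> x) \<longleftrightarrow> diverges x"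
  by (simp add: diverges_def after_actD wk_Dv_iff del: actD.simps)

lemma diverges_encap [simp]: "diverges (\<partial> H x) \<longleftrightarrow> diverges x"
  by (auto simp: diverges_def)

lemma diverges_timeout [simp]: "diverges (\<nu> x) \<longleftrightarrow> diverges x"
  by (simp add: diverges_def)

lemma diverges_seq: "diverges x \<Longrightarrow> diverges (x \<odot> y)"
  by (simp add: diverges_def seqW_def)

lemma diverges_lmerge: "diverges x \<Longrightarrow> diverges (x \<lhd> y)"
  using mg.nil[of Dv Part "comm A \<gamma>"]
  by (auto simp: diverges_def intro: mgSI[of "([], Dv)" _ "([], Part)"])

lemma diverges_par: "diverges x \<or> diverges y \<Longrightarrow> diverges (x \<parallel> y)"
  using diverges_lmerge[of x y] diverges_lmerge[of y x]
  by (auto simp: diverges_def parD_def simp del: lmergeD_iff)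

definition op_closed :: "('a, 'v) trm set \<Rightarrow> bool" where
  "op_closed K \<longleftrightarrow> K \<subseteq> closed_tms \<and> (\<forall>a\<in>acts A. Act a \<in> K) \<and> (\<forall>x\<in>K. \<forall>y\<in>K. \<forall>f. Binary f x y \<in> K) \<and>
    (\<forall>x\<in>K. \<forall>f\<in>unops ACP A. (\<forall>I. f \<noteq> Abstr I) \<longrightarrow> Unary f x \<in> K)"

lemma op_closedD:
  assumes "op_closed K"
  shows "x \<in> K \<Longrightarrow> x \<in> closed_tms" "x \<in> K \<Longrightarrow> tm x" "a \<in> acts A \<Longrightarrow> Act a \<in> K"
    "x \<in> K \<Longrightarrow> y \<in> K \<Longrightarrow> Binary f x y \<in> K" "x \<in> K \<Longrightarrow> \<sigma> x \<in> K" "x \<in> K \<Longrightarrow> \<nu> x \<in> K"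
    "x \<in> K \<Longrightarrow> H \<subseteq> A \<Longrightarrow> \<partial> H x \<in> K"
  using assms unfolding op_closed_def by (auto simp: closed_tms_iff)

lemma nf_op_closed: "op_closed K \<Longrightarrow> h \<in> nf K K \<Longrightarrow> h \<in> K"
  by (erule nf.induct) (auto intro!: op_closedD(3-5))

lemma tree_op_closed: "op_closed K \<Longrightarrow> h \<in> tree K \<Longrightarrow> h \<in> K"
  by (erule tree.induct) (auto intro!: op_closedD(3-5))

lemma tree_nf: "op_closed K \<Longrightarrow> h \<in> tree K \<Longrightarrow> h \<in> nf K K"
  by (erule tree.induct) (auto intro: nf.intros tree_op_closed)

context
  fixes K :: "('a, 'v) trm set"
  assumes K: "op_closed K"
begin

lemmas K_D = op_closedD[OF K]

lemma nf_tm: "h \<in> nf K K \<Longrightarrow> tm h"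
  using nf_op_closed[OF K] K_D by blast

lemma tree_tm: "h \<in> tree K \<Longrightarrow> tm h"
  using tree_op_closed[OF K] K_D by blast

section \<open>Encapsulation, time-out and sequential composition\<close>

lemma hnf_encap:
  assumes "h \<in> nf K K" "H \<subseteq> A"
  shows "hnf K K (\<partial> H h)"
  using assms(1)
proof induction
  case (nf_act a)
  show ?case by (rule hnf_cong[OF encap_act[OF _ assms(2)] hnf_act]) (use nf_act  in simp_all)
next
  case (nf_prefix a x)
  have "\<partial> H (Act (Basic a) \<odot> x) \<approx> \<partial> H (Act (Basic a)) \<odot> \<partial> H x"
    by (rule encap_seq) (use nf_prefix assms(2) K_D in simp_all)
  also have "\<dots> \<approx> Act (if Basic a \<in> Basic ` H then Delta else Basic a) \<odot> \<partial> H x"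
    by (rule eqv_Binary1[OF encap_act]) (use nf_prefix assms(2) K_D in simp_all)
  finally show ?case by (rule hnf_cong) (use nf_prefix assms(2) K_D in \<open>auto intro!: hnf_prefix\<close>)
next
  case (nf_tau x)
  have "\<partial> H (Act Tau \<odot> x) \<approx> \<partial> H (Act Tau) \<odot> \<partial> H x"
    by (rule encap_seq) (use nf_tau assms(2) K_D in simp_all)
  also have "\<dots> \<approx> Act (if Tau \<in> Basic ` H then Delta else Tau) \<odot> \<partial> H x"
    by (rule eqv_Binary1[OF encap_act]) (use nf_tau assms(2) K_D in simp_all)
  finally show ?case by (rule hnf_cong) (use nf_tau assms(2) K_D in \<open>auto intro!: hnf_prefix\<close>)
next
  case (nf_delay x)
  show ?case by (rule hnf_cong[OF encap_delay hnf_delay]) (use nf_delay assms(2) K_D in simp_all)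
next
  case (nf_alt x y)
  show ?case by (rule hnf_cong[OF encap_alt hnf_alt]) (use nf_alt assms(2) nf_tm in simp_all)
qed

lemma treelike_encap:
  assumes "h \<in> tree K" "H \<subseteq> A"
  shows "treelike K (\<partial> H h)"
  using assms(1)
proof induction
  case (tree_act a)
  show ?case by (rule treelike_cong[OF encap_act[OF _ assms(2)] treelike_act]) (use tree_act  in simp_all)
next
  case (tree_prefix a x)
  have "\<partial> H (Act (Basic a) \<odot> x) \<approx> \<partial> H (Act (Basic a)) \<odot> \<partial> H x"
    by (rule encap_seq) (use tree_prefix assms(2) K_D in simp_all)
  also have "\<dots> \<approx> Act (if Basic a \<in> Basic ` H then Delta else Basic a) \<odot> \<partial> H x"
    by (rule eqv_Binary1[OF encap_act]) (use tree_prefix assms(2) K_D in simp_all)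
  finally show ?case by (rule treelike_cong) (use tree_prefix assms(2) K_D in \<open>auto intro!: treelike_prefix\<close>)
next
  case (tree_tau x)
  have "\<partial> H (Act Tau \<odot> x) \<approx> \<partial> H (Act Tau) \<odot> \<partial> H x"
    by (rule encap_seq) (use tree_tau tree_tm assms(2) in simp_all)
  also have "\<dots> \<approx> Act (if Tau \<in> Basic ` H then Delta else Tau) \<odot> \<partial> H x"
    by (rule eqv_Binary1[OF encap_act]) (use tree_tau tree_tm assms(2) in simp_all)
  finally show ?case by (rule treelike_cong) (use tree_tau in \<open>auto intro!: treelike_tau\<close>)
next
  case (tree_delay x)
  show ?case by (rule treelike_cong[OF encap_delay treelike_delay]) (use tree_delay assms(2) K_D in simp_all)
next
  case (tree_alt x y)
  show ?case by (rule treelike_cong[OF encap_alt treelike_alt]) (use tree_alt assms(2) tree_tm in simp_all)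
qed

lemma timeout_prefix: "a \<in> acts A \<Longrightarrow> tm x \<Longrightarrow> \<nu> (Act a \<odot> x) \<approx> Act a \<odot> x"
  using eqv_trans[OF timeout_seq eqv_Binary1[OF timeout_act]] by simp

lemma hnf_timeout: "h \<in> nf K K \<Longrightarrow> hnf K K (\<nu> h)"
proof (induction rule: nf.induct)
  case (nf_act a)
  show ?case by (rule hnf_cong[OF timeout_act hnf_act]) (use nf_act  in simp_all)
next
  case (nf_prefix a x)
  show ?case by (rule hnf_cong[OF timeout_prefix hnf_prefix]) (use nf_prefix K_D in simp_all)
next
  case (nf_tau x)
  show ?case by (rule hnf_cong[OF timeout_prefix hnf_prefix]) (use nf_tau K_D in simp_all)
next
  case (nf_delay x)
  show ?case by (rule hnf_cong[OF timeout_delay hnf_act]) (use nf_delay K_D in simp_all)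
next
  case (nf_alt x y)
  show ?case by (rule hnf_cong[OF timeout_alt hnf_alt]) (use nf_alt nf_tm in simp_all)
qed

lemma treelike_timeout: "h \<in> tree K \<Longrightarrow> treelike K (\<nu> h)"
proof (induction rule: tree.induct)
  case (tree_act a)
  show ?case by (rule treelike_cong[OF timeout_act treelike_act]) (use tree_act  in simp_all)
next
  case (tree_prefix a x)
  show ?case by (rule treelike_cong[OF timeout_prefix treelike_prefix]) (use tree_prefix K_D in simp_all)
next
  case (tree_tau x)
  show ?case by (rule treelike_cong[OF timeout_prefix treelike_tau[OF treelike_tree]]) (use tree_tau tree_tm in simp_all)
next
  case (tree_delay x)
  show ?case by (rule treelike_cong[OF timeout_delay treelike_act]) (use tree_delay K_D in simp_all)
next
  case (tree_alt x y)
  show ?case by (rule treelike_cong[OF timeout_alt treelike_alt]) (use tree_alt tree_tm in simp_all)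
qed

lemma hnf_seq:
  assumes "h \<in> nf K K" "y \<in> K"
  shows "hnf K K (h \<odot> y)"
  using assms(1)
proof induction
  case (nf_act a)
  then show ?case using assms(2) K_D by (intro hnf_prefix) simp_all
next
  case (nf_prefix a x)
  show ?case by (rule hnf_cong[OF seq_assoc hnf_prefix]) (use nf_prefix assms(2) K_D in simp_all)
next
  case (nf_tau x)
  show ?case by (rule hnf_cong[OF seq_assoc hnf_prefix]) (use nf_tau assms(2) K_D in simp_all)
next
  case (nf_delay x)
  show ?case by (rule hnf_cong[OF delay_seq hnf_delay]) (use nf_delay assms(2) K_D in simp_all)
next
  case (nf_alt x z)
  show ?case by (rule hnf_cong[OF alt_seq hnf_alt]) (use nf_alt assms(2) K_D nf_tm in simp_all)
qed

text \<open>If \<open>h\<close> can terminate by silent steps alone, \<open>y\<close> is exposed and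
  needs a tree of its own. In that case divergence of \<open>y\<close> would pass to the product, so
  \<open>y\<close> does not diverge.\<close>

lemma treelike_seq:
  assumes "h \<in> tree K" "y \<in> K" "no_tau_comm A \<gamma>" "\<not> diverges (h \<odot> y)" "\<not> diverges y \<Longrightarrow> treelike K y"
  shows "treelike K (h \<odot> y)"
  using assms(1,4)
proof induction
  case (tree_act a)
  then show ?case using treelike_tau[OF assms(5)] treelike_prefix[OF tree_act(1) assms(2)] assms(2) K_D(2)
    by (cases "a = Tau") simp_all
next
  case (tree_prefix a x)
  show ?case by (rule treelike_cong[OF seq_assoc treelike_prefix]) (use tree_prefix assms(2) K_D in simp_all)
next
  case (tree_tau x)
  have *: "(Act Tau \<odot> x) \<odot> y \<approx> Act Tau \<odot> (x \<odot> y)"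
    by (rule seq_assoc) (use tree_tau tree_tm assms(2) K_D in simp_all)
  have "\<not> diverges (x \<odot> y)"
    using diverges_cong[OF assms(3) *] tree_tau by simp
  then show ?case using treelike_cong[OF * treelike_tau] tree_tau by simp
next
  case (tree_delay x)
  show ?case by (rule treelike_cong[OF delay_seq treelike_delay]) (use tree_delay assms(2) K_D in simp_all)
next
  case (tree_alt x z)
  have *: "(x \<oplus> z) \<odot> y \<approx> (x \<odot> y) \<oplus> (z \<odot> y)"
    by (rule alt_seq) (use tree_alt tree_tm assms(2) K_D in simp_all)
  then show ?case using treelike_cong[OF * treelike_alt] diverges_cong[OF assms(3) *] tree_alt by simp
qed

text \<open>These are the two shapes of a right operand for which the left merge of a delayed
  process has an axiom. Delayed summands are collected into one by distributivity of
  \<sigma>.\<close>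

lemma nf_split: "h \<in> nf K K \<Longrightarrow> h \<approx> \<nu> h \<or> (\<exists>z\<in>K. h \<approx> \<nu> h \<oplus> \<sigma> z)"
proof (induction rule: nf.induct)
  case (nf_act a)
  from eqv_sym[OF timeout_act[OF this]] show ?case by blast
next
  case (nf_prefix a x)
  show ?case by (rule disjI1, rule eqv_sym[OF timeout_prefix]) (use nf_prefix K_D in simp_all)
next
  case (nf_tau x)
  show ?case by (rule disjI1, rule eqv_sym[OF timeout_prefix]) (use nf_tau K_D in simp_all)
next
  case (nf_delay x)
  have "\<sigma> x \<approx> \<sigma> x \<oplus> Act Delta" by (rule eqv_sym[OF alt_delta]) (use nf_delay K_D in simp_all)
  also have "\<dots> \<approx> Act Delta \<oplus> \<sigma> x" by (rule alt_comm) (use nf_delay K_D in simp_all)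
  also have "\<dots> \<approx> \<nu> (\<sigma> x) \<oplus> \<sigma> x"
    by (rule eqv_Binary1[OF eqv_sym[OF timeout_delay]]) (use nf_delay K_D in simp_all)
  finally show ?case using nf_delay by blast
next
  case (nf_alt x y)
  note tms = nf_tm[OF nf_alt(1)] nf_tm[OF nf_alt(2)]
  have nu: "\<nu> x \<oplus> \<nu> y \<approx> \<nu> (x \<oplus> y)" using eqv_sym[OF timeout_alt[OF tms]] .
  from nf_alt.IH show ?case
  proof (elim disjE bexE)
    assume "x \<approx> \<nu> x" "y \<approx> \<nu> y"
    then show ?thesis using eqv_trans[OF eqv_Binary nu] by blast
  next
    fix z assume z: "z \<in> K" "x \<approx> \<nu> x" "y \<approx> \<nu> y \<oplus> \<sigma> z"
    have "x \<oplus> y \<approx> \<nu> x \<oplus> (\<nu> y \<oplus> \<sigma> z)" by (rule eqv_Binary[OF z(2,3)])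
    also have "\<dots> \<approx> (\<nu> x \<oplus> \<nu> y) \<oplus> \<sigma> z" by (rule eqv_sym[OF alt_assoc]) (use tms z K_D in simp_all)
    also have "\<dots> \<approx> \<nu> (x \<oplus> y) \<oplus> \<sigma> z" by (rule eqv_Binary1[OF nu]) (use z K_D in simp)
    finally show ?thesis using z by blast
  next
    fix z assume z: "z \<in> K" "x \<approx> \<nu> x \<oplus> \<sigma> z" "y \<approx> \<nu> y"
    have "x \<oplus> y \<approx> (\<nu> x \<oplus> \<sigma> z) \<oplus> \<nu> y" by (rule eqv_Binary[OF z(2,3)])
    also have "\<dots> \<approx> \<nu> y \<oplus> (\<nu> x \<oplus> \<sigma> z)" by (rule alt_comm) (use tms z K_D in simp_all)
    also have "\<dots> \<approx> (\<nu> y \<oplus> \<nu> x) \<oplus> \<sigma> z" by (rule eqv_sym[OF alt_assoc]) (use tms z K_D in simp_all)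
    also have "\<dots> \<approx> (\<nu> x \<oplus> \<nu> y) \<oplus> \<sigma> z" by (rule eqv_Binary1[OF alt_comm]) (use tms z K_D in simp_all)
    also have "\<dots> \<approx> \<nu> (x \<oplus> y) \<oplus> \<sigma> z" by (rule eqv_Binary1[OF nu]) (use z K_D in simp)
    finally show ?thesis using z by blast
  next
    fix z z' assume z: "z \<in> K" "x \<approx> \<nu> x \<oplus> \<sigma> z" and z': "z' \<in> K" "y \<approx> \<nu> y \<oplus> \<sigma> z'"
    note tz = tms K_D(2)[OF z(1)] K_D(2)[OF z'(1)]
    have "x \<oplus> y \<approx> (\<nu> x \<oplus> \<sigma> z) \<oplus> (\<nu> y \<oplus> \<sigma> z')" by (rule eqv_Binary[OF z(2) z'(2)])
    also have "\<dots> \<approx> \<nu> x \<oplus> (\<sigma> z \<oplus> (\<nu> y \<oplus> \<sigma> z'))" by (rule alt_assoc) (use tz in simp_all)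
    also have "\<dots> \<approx> \<nu> x \<oplus> ((\<nu> y \<oplus> \<sigma> z') \<oplus> \<sigma> z)"
      by (rule eqv_Binary2[OF alt_comm]) (use tz in simp_all)
    also have "\<dots> \<approx> \<nu> x \<oplus> (\<nu> y \<oplus> (\<sigma> z' \<oplus> \<sigma> z))"
      by (rule eqv_Binary2[OF alt_assoc]) (use tz in simp_all)
    also have "\<dots> \<approx> \<nu> x \<oplus> (\<nu> y \<oplus> \<sigma> (z' \<oplus> z))"
      by (rule eqv_Binary2[OF eqv_Binary2[OF delay_alt]]) (use tz in simp_all)
    also have "\<dots> \<approx> (\<nu> x \<oplus> \<nu> y) \<oplus> \<sigma> (z' \<oplus> z)" by (rule eqv_sym[OF alt_assoc]) (use tz in simp_all)
    also have "\<dots> \<approx> \<nu> (x \<oplus> y) \<oplus> \<sigma> (z' \<oplus> z)" by (rule eqv_Binary1[OF nu]) (use tz in simp)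
    finally show ?thesis using z(1) z'(1) K_D by blast
  qed
qed

text \<open>The result is \<delta> or delayed and so has no initial \<tau>. This yields a tree even
  if \<open>y\<close> diverges.\<close>

lemma hnf_delay_lmerge:
  assumes "x \<in> K" "hnf K K y"
  shows "hnf {} K (\<sigma> x \<lhd> y)"
proof -
  from assms(2) obtain h where h: "h \<in> nf K K" "y \<approx> h" unfolding hnf_def by blast
  have 1: "\<sigma> x \<lhd> y \<approx> \<sigma> x \<lhd> h" by (rule eqv_Binary2[OF h(2)]) (use assms K_D in simp)
  from nf_split[OF h(1)] show ?thesis
  proof (elim disjE bexE)
    assume "h \<approx> \<nu> h"
    then have "\<sigma> x \<lhd> h \<approx> \<sigma> x \<lhd> \<nu> h" by (rule eqv_Binary2) (use assms K_D in simp)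
    also have "\<dots> \<approx> Act Delta" by (rule delay_lmerge_timeout) (use assms K_D h nf_tm in simp_all)
    finally show ?thesis using hnf_cong[OF eqv_trans[OF 1] hnf_act] by simp
  next
    fix z assume z: "z \<in> K" "h \<approx> \<nu> h \<oplus> \<sigma> z"
    from z(2) have "\<sigma> x \<lhd> h \<approx> \<sigma> x \<lhd> (\<nu> h \<oplus> \<sigma> z)" by (rule eqv_Binary2) (use assms K_D in simp)
    also have "\<dots> \<approx> \<sigma> (x \<lhd> z)" by (rule delay_lmerge_delay) (use assms z K_D h nf_tm in simp_all)
    finally show ?thesis using hnf_cong[OF eqv_trans[OF 1] hnf_delay] assms(1) z(1) K_D by simp
  qed
qed

lemma hnf_lmerge:
  assumes "h \<in> nf K K" "y \<in> K" "hnf K K y"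
  shows "hnf K K (h \<lhd> y)"
  using assms(1)
proof induction
  case (nf_act a)
  show ?case by (rule hnf_cong[OF act_lmerge hnf_prefix]) (use nf_act assms(2) K_D in simp_all)
next
  case (nf_prefix a x)
  show ?case by (rule hnf_cong[OF prefix_lmerge hnf_prefix]) (use nf_prefix assms(2) K_D in simp_all)
next
  case (nf_tau x)
  show ?case by (rule hnf_cong[OF prefix_lmerge hnf_prefix]) (use nf_tau assms(2) K_D in simp_all)
next
  case (nf_delay x)
  then show ?case using hnf_mono[OF hnf_delay_lmerge] assms(3) by blast
next
  case (nf_alt x z)
  show ?case by (rule hnf_cong[OF alt_lmerge hnf_alt]) (use nf_alt assms(2) K_D nf_tm in simp_all)
qed

lemma comm_Tau:
  assumes "a \<in> acts A" "b \<in> acts A" "\<gamma> a b = Tau"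
  shows "\<not> no_tau_comm A \<gamma>"
  using assms comm_fun_Tau_Delta[OF comm_fun] unfolding no_tau_comm_def
  by (cases a; cases b) auto

text \<open>An initial \<tau> of the result can only be a value of \<gamma>. Under
  \<open>no_tau_comm\<close> one may take \<open>T\<close> empty, and the head normal form is a tree
  whether or not the operands diverge.\<close>

lemma hnf_cmerge:
  assumes "h \<in> nf K K" "h' \<in> nf K K" and T: "T = K \<or> no_tau_comm A \<gamma>"
  shows "hnf T K (h \<bowtie> h')"
proof -
  have pre: "hnf T K (Act (\<gamma> a b) \<odot> x)" if "a \<in> acts A" "b \<in> acts A" "x \<in> K" for a b x
    using that T comm_Tau[of a b] K_D acts_comm by (intro hnf_prefix) auto
  have act: "hnf T K (Act a \<bowtie> h')" if "a \<in> acts A" for a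
    using assms(2)
  proof induction
    case (nf_act b)
    show ?case by (rule hnf_cong[OF act_cmerge_act hnf_act]) (use nf_act that acts_comm in simp_all)
  next
    case (nf_prefix b x)
    show ?case by (rule hnf_cong[OF act_cmerge_prefix pre]) (use nf_prefix that K_D in simp_all)
  next
    case (nf_tau x)
    show ?case by (rule hnf_cong[OF act_cmerge_prefix pre]) (use nf_tau that K_D in simp_all)
  next
    case (nf_delay x)
    have "Act a \<bowtie> \<sigma> x \<approx> \<nu> (Act a) \<bowtie> \<sigma> x"
      by (rule eqv_Binary1[OF eqv_sym[OF timeout_act]]) (use that nf_delay K_D in simp_all)
    also have "\<dots> \<approx> Act Delta" by (rule timeout_cmerge_delay) (use that nf_delay K_D in simp_all)
    finally show ?case by (rule hnf_cong) (simp add: hnf_act)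
  next
    case (nf_alt x y)
    show ?case by (rule hnf_cong[OF cmerge_alt hnf_alt]) (use nf_alt that nf_tm in simp_all)
  qed
  have prefix: "hnf T K ((Act a \<odot> z) \<bowtie> h')" if "a \<in> acts A" "z \<in> K" for a z
    using assms(2)
  proof induction
    case (nf_act b)
    show ?case by (rule hnf_cong[OF prefix_cmerge_act pre]) (use nf_act that K_D in simp_all)
  next
    case (nf_prefix b x)
    show ?case by (rule hnf_cong[OF prefix_cmerge_prefix pre]) (use nf_prefix that K_D in simp_all)
  next
    case (nf_tau x)
    show ?case by (rule hnf_cong[OF prefix_cmerge_prefix pre]) (use nf_tau that K_D in simp_all)
  next
    case (nf_delay x)
    have "(Act a \<odot> z) \<bowtie> \<sigma> x \<approx> \<nu> (Act a \<odot> z) \<bowtie> \<sigma> x"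
      by (rule eqv_Binary1[OF eqv_sym[OF timeout_prefix]]) (use that nf_delay K_D in simp_all)
    also have "\<dots> \<approx> Act Delta" by (rule timeout_cmerge_delay) (use that nf_delay K_D in simp_all)
    finally show ?case by (rule hnf_cong) (simp add: hnf_act)
  next
    case (nf_alt x y)
    show ?case by (rule hnf_cong[OF cmerge_alt hnf_alt]) (use nf_alt that nf_tm K_D in simp_all)
  qed
  have delay: "hnf T K (\<sigma> z \<bowtie> h')" if "z \<in> K" for z
    using assms(2)
  proof induction
    case (nf_act b)
    have "\<sigma> z \<bowtie> Act b \<approx> \<sigma> z \<bowtie> \<nu> (Act b)"
      by (rule eqv_Binary2[OF eqv_sym[OF timeout_act]]) (use that nf_act K_D in simp_all)
    also have "\<dots> \<approx> Act Delta" by (rule delay_cmerge_timeout) (use that nf_act K_D in simp_all)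
    finally show ?case by (rule hnf_cong) (simp add: hnf_act)
  next
    case (nf_prefix b x)
    have "\<sigma> z \<bowtie> (Act (Basic b) \<odot> x) \<approx> \<sigma> z \<bowtie> \<nu> (Act (Basic b) \<odot> x)"
      by (rule eqv_Binary2[OF eqv_sym[OF timeout_prefix]]) (use that nf_prefix K_D in simp_all)
    also have "\<dots> \<approx> Act Delta" by (rule delay_cmerge_timeout) (use that nf_prefix K_D in simp_all)
    finally show ?case by (rule hnf_cong) (simp add: hnf_act)
  next
    case (nf_tau x)
    have "\<sigma> z \<bowtie> (Act Tau \<odot> x) \<approx> \<sigma> z \<bowtie> \<nu> (Act Tau \<odot> x)"
      by (rule eqv_Binary2[OF eqv_sym[OF timeout_prefix]]) (use that nf_tau K_D in simp_all)
    also have "\<dots> \<approx> Act Delta" by (rule delay_cmerge_timeout) (use that nf_tau K_D in simp_all)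
    finally show ?case by (rule hnf_cong) (simp add: hnf_act)
  next
    case (nf_delay x)
    show ?case by (rule hnf_cong[OF delay_cmerge_delay hnf_delay]) (use nf_delay that K_D in simp_all)
  next
    case (nf_alt x y)
    show ?case by (rule hnf_cong[OF cmerge_alt hnf_alt]) (use nf_alt that nf_tm K_D in simp_all)
  qed
  show ?thesis
    using assms(1)
  proof induction
    case (nf_alt x y)
    show ?case by (rule hnf_cong[OF alt_cmerge hnf_alt]) (use nf_alt nf_tm[OF assms(2)] nf_tm in simp_all)
  qed (use act prefix delay in auto)
qed

lemma treelike_cmerge:
  assumes "h \<in> nf K K" "h' \<in> nf K K" "no_tau_comm A \<gamma>"
  shows "treelike K (h \<bowtie> h')"
  using hnf_no_tau_treelike[OF hnf_cmerge[OF assms(1,2)]] assms(3) by blast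

text \<open>A silent first step of \<open>h\<close> would lead to a parallel composition with the
  diverging \<open>y\<close> and make the whole diverge. Hence no summand of \<open>h\<close> starts
  with \<tau>, and \<open>y\<close> occurs only behind guards.\<close>

lemma treelike_lmerge_diverging:
  assumes "h \<in> tree K" "y \<in> K" "hnf K K y" "no_tau_comm A \<gamma>" "\<not> diverges (h \<lhd> y)" "diverges y"
  shows "treelike K (h \<lhd> y)"
  using assms(1,5)
proof induction
  case (tree_act a)
  have *: "Act a \<lhd> y \<approx> Act a \<odot> y" by (rule act_lmerge) (use tree_act assms(2) K_D in simp_all)
  then have "a \<noteq> Tau" using diverges_cong[OF assms(4) *] tree_act assms(6) by auto
  then show ?case using treelike_cong[OF * treelike_prefix] tree_act assms(2) K_D by simp
next
  case (tree_prefix a x)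
  show ?case by (rule treelike_cong[OF prefix_lmerge treelike_prefix]) (use tree_prefix assms(2) K_D in simp_all)
next
  case (tree_tau x)
  have "(Act Tau \<odot> x) \<lhd> y \<approx> Act Tau \<odot> (x \<parallel> y)"
    by (rule prefix_lmerge) (use tree_tau assms(2) K_D tree_tm in simp_all)
  from diverges_cong[OF assms(4) this] show ?case using tree_tau assms(6) diverges_par[of x y] by simp
next
  case (tree_delay x)
  then show ?case using hnf_no_tau_treelike hnf_delay_lmerge assms(3) by blast
next
  case (tree_alt x z)
  have *: "(x \<oplus> z) \<lhd> y \<approx> (x \<lhd> y) \<oplus> (z \<lhd> y)"
    by (rule alt_lmerge) (use tree_alt tree_tm assms(2) K_D in simp_all)
  then show ?case using treelike_cong[OF * treelike_alt] diverges_cong[OF assms(4) *] tree_alt by simp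
qed

text \<open>Below a silent step the parallel composition is expanded, and there the two trees also
  appear in exchanged roles; hence the induction on the sum of the sizes.\<close>

lemma treelike_lmerge_tree:
  assumes "h \<in> tree K" "h' \<in> tree K" "no_tau_comm A \<gamma>"
  shows "treelike K (h \<lhd> h')"
  using assms(1,2)
proof (induction "size h + size h'" arbitrary: h h' rule: less_induct)
  case less
  note h' = tree_op_closed[OF K less.prems(2)] tree_tm[OF less.prems(2)]
    hnf_nf[OF tree_nf[OF K less.prems(2)] tree_tm[OF less.prems(2)]]
  from less.prems(1) show ?case
  proof cases
    case (tree_act a)
    have *: "Act a \<lhd> h' \<approx> Act a \<odot> h'" by (rule act_lmerge) (use tree_act h' in simp_all)
    show ?thesis unfolding tree_act(1)
      by (rule treelike_cong[OF *], cases "a = Tau")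
        (use treelike_tau[OF treelike_tree[OF less.prems(2)]] treelike_prefix[OF _ h'(1)] tree_act h' in simp_all)
  next
    case (tree_prefix a x)
    show ?thesis unfolding tree_prefix(1)
      by (rule treelike_cong[OF prefix_lmerge treelike_prefix]) (use tree_prefix h' K_D in simp_all)
  next
    case (tree_tau x)
    have "treelike K (x \<lhd> h')" "treelike K (h' \<lhd> x)"
      using less.hyps[of x h'] less.hyps[of h' x] tree_tau less.prems by simp_all
    moreover have "treelike K (x \<bowtie> h')" 
      using treelike_cmerge[OF _ _ assms(3)] tree_nf[OF K] tree_tau less.prems by blast
    ultimately have "treelike K (x \<parallel> h')"
      by (intro treelike_cong[OF par_expand] treelike_alt) (use tree_tm tree_tau h' in simp_all)
    then show ?thesis unfolding tree_tau(1)
      by (intro treelike_cong[OF prefix_lmerge treelike_tau]) (use tree_tau h' tree_tm in simp_all)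
  next
    case (tree_delay x)
    then show ?thesis using hnf_no_tau_treelike hnf_delay_lmerge h' by blast
  next
    case (tree_alt x y)
    show ?thesis unfolding tree_alt(1)
      by (rule treelike_cong[OF alt_lmerge treelike_alt])
        (use tree_alt less.hyps[of x h'] less.hyps[of y h'] less.prems h' tree_tm in simp_all)
  qed
qed

end

end

section \<open>Head normal forms of all closed terms\<close>

lemma wk_prefixI: "(v, e) \<in> wk P \<Longrightarrow> (Some a # v, e) \<in> wk (seqD (actD (Basic a)) P)"
  using wk_RunI[of 0 "Some a" v e "seqD (actD (Basic a)) P"] by (simp add: after_actD del: actD.simps)

lemma terms_rec_specs_stage: "t \<in> terms T A (rec_specs T A \<gamma>) \<Longrightarrow> \<exists>i. t \<in> terms T A (stage T A \<gamma> i)"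
proof (induction rule: terms.induct)
  case (4 f s t)
  then obtain i j where "s \<in> terms T A (stage T A \<gamma> i)" "t \<in> terms T A (stage T A \<gamma> j)" by blast
  then have "s \<in> terms T A (stage T A \<gamma> (max i j))" "t \<in> terms T A (stage T A \<gamma> (max i j))"
    using terms_mono[OF _ stage_mono] max.cobounded1 max.cobounded2 by blast+
  then show ?case using 4 by auto
next
  case (5 E X)
  then show ?case by (auto simp: rec_specs_def)
qed auto

lemma replace1_terms: "replace1 Y u s s' \<Longrightarrow> s \<in> terms T A S \<Longrightarrow> u \<in> terms T A S \<Longrightarrow> s' \<in> terms T A S"
  by (induction rule: replace1.induct) auto

context acp
begin

text \<open>The head normal form is kept for diverging terms too: such a term may be an operand of a
  non-diverging one, for instance on the right of a left merge, whose tree is then computed from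
  that head normal form.\<close>

definition regular :: "('a, 'v) trm set \<Rightarrow> ('a, 'v) trm \<Rightarrow> bool" where
  "regular K s \<longleftrightarrow> hnf K K s \<and> (no_tau_comm A \<gamma> \<longrightarrow> \<not> diverges s \<longrightarrow> treelike K s)"

lemma regular_cong: "s \<approx> t \<Longrightarrow> regular K t \<Longrightarrow> regular K s"
  unfolding regular_def using hnf_cong treelike_cong diverges_cong by blast

lemma regular_mono: "regular K s \<Longrightarrow> K \<subseteq> K' \<Longrightarrow> regular K' s"
  unfolding regular_def using hnf_mono treelike_mono by blast

lemma regular_act: "a \<in> acts A \<Longrightarrow> regular K (Act a)"
  by (simp add: regular_def hnf_act treelike_act)

lemma regular_delay: "x \<in> K \<Longrightarrow> tm x \<Longrightarrow> regular K (\<sigma> x)"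
  by (simp add: regular_def hnf_delay treelike_delay)

lemma regular_prefix: "x \<in> K \<Longrightarrow> tm x \<Longrightarrow> a \<in> A \<Longrightarrow> regular K (Act (Basic a) \<odot> x)"
  by (simp add: regular_def hnf_prefix treelike_prefix)

lemma regular_alt: "regular K x \<Longrightarrow> regular K y \<Longrightarrow> regular K (x \<oplus> y)"
  by (simp add: regular_def hnf_alt treelike_alt)

lemma regular_Unary:
  assumes "op_closed K" "x \<in> K" "regular K x" "f \<in> unops ACP A" "\<And>I. f \<noteq> Abstr I"
  shows "regular K (Unary f x)"
proof -
  obtain h where h: "h \<in> nf K K" "x \<approx> h" using assms(3) unfolding regular_def hnf_def by blast
  have tree: "\<exists>h'\<in>tree K. x \<approx> h'" if "no_tau_comm A \<gamma>" "\<not> diverges x"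
    using assms(3) that unfolding regular_def treelike_def by blast
  note cong = eqv_Unary[OF _ assms(4)]
  show ?thesis
  proof (cases f)
    case Delay
    then show ?thesis using regular_delay assms(2) op_closedD[OF assms(1)] by blast
  next
    case (Encap H)
    then have H: "H \<subseteq> A" using assms(4) by auto
    have "hnf K K (\<partial> H x)" using hnf_cong[OF cong[OF h(2)]] hnf_encap[OF assms(1) h(1) H] Encap by blast
    moreover have "treelike K (\<partial> H x)" if "no_tau_comm A \<gamma>" "\<not> diverges (\<partial> H x)"
      using tree that treelike_cong[OF cong] treelike_encap[OF assms(1) _ H] Encap by (metis diverges_encap)
    ultimately show ?thesis unfolding regular_def Encap by blast
  next
    case Timeout
    have "hnf K K (\<nu> x)" using hnf_cong[OF cong[OF h(2)]] hnf_timeout[OF assms(1) h(1)] Timeout by blast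
    moreover have "treelike K (\<nu> x)" if "no_tau_comm A \<gamma>" "\<not> diverges (\<nu> x)"
      using tree that treelike_cong[OF cong] treelike_timeout[OF assms(1)] Timeout by (metis diverges_timeout)
    ultimately show ?thesis unfolding regular_def Timeout by blast
  qed (use assms(5) in simp)
qed

lemma regular_Binary:
  assumes K: "op_closed K" and "x \<in> K" "y \<in> K" "regular K x" "regular K y"
  shows "regular K (Binary f x y)"
proof -
  have hx: "hnf K K x" and hy: "hnf K K y" using assms(4,5) unfolding regular_def by blast+
  obtain h where h: "h \<in> nf K K" "x \<approx> h" using hx unfolding hnf_def by blast
  obtain g where g: "g \<in> nf K K" "y \<approx> g" using hy unfolding hnf_def by blast
  have tx: "\<exists>h\<in>tree K. x \<approx> h" if "no_tau_comm A \<gamma>" "\<not> diverges x"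
    using assms(4) that unfolding regular_def treelike_def by blast
  have ty: "\<exists>h\<in>tree K. y \<approx> h" if "no_tau_comm A \<gamma>" "\<not> diverges y"
    using assms(5) that unfolding regular_def treelike_def by blast
  note tms = op_closedD(2)[OF K assms(2)] op_closedD(2)[OF K assms(3)]
  have seq: "regular K (x \<odot> y)"
    unfolding regular_def
  proof (intro conjI impI)
    show "hnf K K (x \<odot> y)" using hnf_cong[OF eqv_Binary1[OF h(2) tms(2)] hnf_seq[OF K h(1) assms(3)]] .
    assume nt: "no_tau_comm A \<gamma>" and nd: "\<not> diverges (x \<odot> y)"
    then obtain t where t: "t \<in> tree K" "x \<approx> t" using tx diverges_seq by blast
    have *: "x \<odot> y \<approx> t \<odot> y" using eqv_Binary1[OF t(2) tms(2)] .
    show "treelike K (x \<odot> y)"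
      by (rule treelike_cong[OF * treelike_seq[OF K t(1) assms(3) nt]])
        (use nd diverges_cong[OF nt *] assms(5) nt in \<open>simp_all add: regular_def\<close>)
  qed
  have lm: "regular K (x \<lhd> y)" if xy: "x \<in> K" "y \<in> K" "regular K x" "regular K y" for x y
    unfolding regular_def
  proof (intro conjI impI)
    note tms = op_closedD(2)[OF K xy(1)] op_closedD(2)[OF K xy(2)]
    have hx: "hnf K K x" and hy: "hnf K K y" using xy(3,4) unfolding regular_def by blast+
    obtain h where h: "h \<in> nf K K" "x \<approx> h" using hx unfolding hnf_def by blast
    show "hnf K K (x \<lhd> y)" using hnf_cong[OF eqv_Binary1[OF h(2) tms(2)] hnf_lmerge[OF K h(1) xy(2) hy]] .
    assume nt: "no_tau_comm A \<gamma>" and nd: "\<not> diverges (x \<lhd> y)"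
    then obtain t where t: "t \<in> tree K" "x \<approx> t"
      using xy(3) diverges_lmerge unfolding regular_def treelike_def by blast
    have *: "x \<lhd> y \<approx> t \<lhd> y" using eqv_Binary1[OF t(2) tms(2)] .
    show "treelike K (x \<lhd> y)"
    proof (cases "diverges y")
      case True
      then show ?thesis
        using treelike_cong[OF * treelike_lmerge_diverging[OF K t(1) xy(2) hy nt]] nd diverges_cong[OF nt *] by simp
    next
      case False
      then obtain t' where t': "t' \<in> tree K" "y \<approx> t'"
        using xy(4) nt unfolding regular_def treelike_def by blast
      show ?thesis
        using treelike_cong[OF eqv_Binary[OF t(2) t'(2)] treelike_lmerge_tree[OF K t(1) t'(1) nt]] .
    qed
  qed
  have cm: "hnf K K (x \<bowtie> y)" "no_tau_comm A \<gamma> \<Longrightarrow> treelike K (x \<bowtie> y)"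
    using hnf_cong[OF eqv_Binary[OF h(2) g(2)] hnf_cmerge[OF K h(1) g(1)]]
      treelike_cong[OF eqv_Binary[OF h(2) g(2)] treelike_cmerge[OF K h(1) g(1)]] by blast+
  have par: "regular K (x \<parallel> y)"
  proof (rule regular_cong[OF par_expand[OF tms]], intro regular_alt lm assms)
    show "regular K (x \<bowtie> y)" using cm unfolding regular_def by blast
  qed
  show ?thesis
    using seq lm[OF assms(2-5)] cm par regular_alt[OF assms(4,5)]
    by (cases f) (simp_all add: regular_def)
qed

text \<open>
  The greatest set of closed terms that is regular with residuals in itself. The coinductive
  definition is needed for abstraction: a tree for \<open>\<tau>\<^sub>I(x)\<close> is composed of trees for the residuals
  of \<open>x\<close> after actions in \<open>I\<close>, which are not subterms of \<open>x\<close>.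
\<close>

definition Reg :: "('a, 'v) trm set" where
  "Reg = \<Union> {K. K \<subseteq> closed_tms \<and> (\<forall>s\<in>K. regular K s)}"

lemma Reg_upper: "K \<subseteq> closed_tms \<Longrightarrow> (\<And>s. s \<in> K \<Longrightarrow> regular K s) \<Longrightarrow> K \<subseteq> Reg"
  unfolding Reg_def by blast

lemma Reg_closed: "s \<in> Reg \<Longrightarrow> s \<in> closed_tms"
  unfolding Reg_def by blast

lemma Reg_regular: "s \<in> Reg \<Longrightarrow> regular Reg s"
proof -
  assume "s \<in> Reg"
  then obtain K where K: "s \<in> K" "K \<subseteq> closed_tms" "\<forall>s\<in>K. regular K s" unfolding Reg_def by blast
  then have "K \<subseteq> Reg" using Reg_upper by blast
  then show "regular Reg s" using K regular_mono by blast
qed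

lemma Reg_act: "a \<in> acts A \<Longrightarrow> Act a \<in> Reg"
  using Reg_upper[of "{Act a}"] by (simp add: closed_tms_iff regular_act)

section \<open>Coinduction up to operators\<close>

inductive_set op_closure :: "('a, 'v) trm set \<Rightarrow> ('a, 'v) trm set" for R where
  op_base: "x \<in> R \<Longrightarrow> x \<in> op_closure R"
| op_Unary: "x \<in> op_closure R \<Longrightarrow> f \<in> unops ACP A \<Longrightarrow> (\<forall>I. f \<noteq> Abstr I) \<Longrightarrow> Unary f x \<in> op_closure R"
| op_Binary: "x \<in> op_closure R \<Longrightarrow> y \<in> op_closure R \<Longrightarrow> Binary f x y \<in> op_closure R"

text \<open>The shape of a guarded right-hand side after its variables have been replaced by
  recursion constants from \<open>R\<close>. Closed parts known from earlier stages enter through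
  \<open>gc_Reg\<close>.\<close>

inductive_set guarded_closure :: "('a, 'v) trm set \<Rightarrow> ('a, 'v) trm set" for R where
  gc_Reg: "x \<in> Reg \<Longrightarrow> x \<in> guarded_closure R"
| gc_prefix: "x \<in> op_closure R \<Longrightarrow> a \<in> A \<Longrightarrow> Act (Basic a) \<odot> x \<in> guarded_closure R"
| gc_delay: "x \<in> op_closure R \<Longrightarrow> \<sigma> x \<in> guarded_closure R"
| gc_Unary: "x \<in> guarded_closure R \<Longrightarrow> f \<in> unops ACP A \<Longrightarrow> (\<forall>I. f \<noteq> Abstr I) \<Longrightarrow> Unary f x \<in> guarded_closure R"
| gc_Binary: "x \<in> guarded_closure R \<Longrightarrow> y \<in> guarded_closure R \<Longrightarrow> Binary f x y \<in> guarded_closure R"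

lemma op_closure_closed: "x \<in> op_closure R \<Longrightarrow> R \<subseteq> closed_tms \<Longrightarrow> x \<in> closed_tms"
  by (induction rule: op_closure.induct) (auto simp: closed_tms_iff)

text \<open>Coinduction up to contexts: after one unfolding of the members of \<open>R\<close>
  inside a context, every new residual is again a context filled with members of
  \<open>R\<close>.\<close>

lemma op_closure_Reg:
  assumes R: "Reg \<subseteq> R" "R \<subseteq> closed_tms" and unf: "\<And>r. r \<in> R \<Longrightarrow> \<exists>g\<in>guarded_closure R. r \<approx> g"
  shows "op_closure R \<subseteq> Reg"
proof (rule Reg_upper)
  show "op_closure R \<subseteq> closed_tms" using op_closure_closed R(2) by blast
  have K: "op_closed (op_closure R)"
    unfolding op_closed_def using op_closure_closed R Reg_act by (blast intro: op_closure.intros)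
  have sub: "g \<in> op_closure R" if "g \<in> guarded_closure R" for g
    using that
  proof induction
    case (gc_prefix x a)
    then show ?case by (intro op_closedD(4)[OF K] op_closedD(3)[OF K]) simp_all
  qed (use R(1) op_closedD(5)[OF K] in \<open>auto intro: op_base op_Unary op_Binary simp del: unops.simps\<close>)
  have reg: "regular (op_closure R) g" if "g \<in> guarded_closure R" for g
    using that
  proof induction
    case (gc_Reg x)
    then show ?case using Reg_regular regular_mono[of Reg x "op_closure R"] R(1) op_base by blast
  next
    case (gc_prefix x a)
    then show ?case using regular_prefix op_closedD(2)[OF K] by blast
  next
    case (gc_delay x)
    then show ?case using regular_delay op_closedD(2)[OF K] by blast
  next
    case (gc_Unary x f)
    then show ?case using regular_Unary[OF K sub] by blast
  next
    case (gc_Binary x y f)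
    then show ?case using regular_Binary[OF K sub sub] by blast
  qed
  fix s assume "s \<in> op_closure R"
  then have "\<exists>g\<in>guarded_closure R. s \<approx> g"
  proof induction
    case (op_Unary x f)
    then show ?case using eqv_Unary gc_Unary by blast
  next
    case (op_Binary x y f)
    then show ?case using eqv_Binary gc_Binary by blast
  qed (rule unf)
  then show "regular (op_closure R) s" using regular_cong reg by blast
qed

lemma op_closed_Reg: "op_closed Reg"
proof -
  have "op_closure Reg \<subseteq> Reg"
  proof (rule op_closure_Reg)
    show "\<exists>g\<in>guarded_closure Reg. r \<approx> g" if "r \<in> Reg" for r
      using that gc_Reg eqv_refl Reg_closed closed_tms_iff by blast
  qed (use Reg_closed in auto)
  then show ?thesis
    unfolding op_closed_def using Reg_closed Reg_act by (blast intro: op_closure.intros)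
qed

lemma Reg_Abstr:
  fixes x :: "('a, 'v) trm"
  assumes x: "x \<in> Reg" and I: "I \<subseteq> A"
  shows "\<tau> I x \<in> Reg"
proof -
  let ?K = "\<tau> I ` Reg \<union> Reg :: ('a, 'v) trm set"
  have Kc: "?K \<subseteq> closed_tms" using I by (auto simp: closed_tms_iff dest!: Reg_closed)
  have Ktm: "tm y" if "y \<in> Reg" for y :: "('a, 'v) trm" using Reg_closed[OF that] closed_tms_iff by blast
  have Kt: "\<tau> I y \<in> ?K" "tm (\<tau> I y)" if "y \<in> Reg" for y :: "('a, 'v) trm" using that I Ktm by auto
  have pre: "\<tau> I (Act a \<odot> y) \<approx> Act (if a \<in> Basic ` I then Tau else a) \<odot> \<tau> I y" if "a \<in> acts A" "tm y" for a and y :: "('a, 'v) trm"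
  proof -
    have "\<tau> I (Act a \<odot> y) \<approx> \<tau> I (Act a) \<odot> \<tau> I y" by (rule abstr_seq) (use that I in simp_all)
    also have "\<dots> \<approx> Act (if a \<in> Basic ` I then Tau else a) \<odot> \<tau> I y"
      by (rule eqv_Binary1[OF abstr_act]) (use that I in simp_all)
    finally show ?thesis .
  qed
  have preI: "\<tau> I (Act (Basic a) \<odot> y) \<approx> Act Tau \<odot> \<tau> I y" if "a \<in> I" "tm y" for a and y :: "('a, 'v) trm"
    using pre[of "Basic a" y] that I by auto
  have un: "Abstr I \<in> unops ACP A" using I by simp
  have hn: "hnf ?K ?K (\<tau> I h)" if "h \<in> nf Reg Reg" for h :: "('a, 'v) trm"
    using that
  proof induction
    case (nf_act a)
    show ?case by (rule hnf_cong[OF abstr_act hnf_act]) (use nf_act I in simp_all)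
  next
    case (nf_prefix a y)
    show ?case by (rule hnf_cong[OF pre hnf_prefix]) (use nf_prefix Ktm Kt in simp_all)
  next
    case (nf_tau y)
    show ?case by (rule hnf_cong[OF pre hnf_prefix]) (use nf_tau Ktm Kt in \<open>simp_all split: if_splits\<close>)
  next
    case (nf_delay y)
    show ?case by (rule hnf_cong[OF abstr_delay hnf_delay]) (use nf_delay Ktm Kt I in simp_all)
  next
    case (nf_alt y z)
    show ?case by (rule hnf_cong[OF abstr_alt hnf_alt])
        (use nf_alt(3,4) I nf_op_closed[OF op_closed_Reg nf_alt(1)] nf_op_closed[OF op_closed_Reg nf_alt(2)] in \<open>simp_all add: Ktm\<close>)
  qed
  have tree_tm: "tm h" if "h \<in> tree Reg" for h :: "('a, 'v) trm"
    using that tree_op_closed[OF op_closed_Reg] Ktm by blast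
  \<comment> \<open>Each tree accounts for its own \<tau> prefixes; \<open>n\<close> limits how
    often a hidden action leads from one tree to the next, so that assembling the trees comes to an
    end. Excluding \<open>Dv\<close> keeps the residuals on the way non-diverging.\<close>
  define bd where "bd n y \<longleftrightarrow> (\<forall>v e. (v, e) \<in> wk (den (comm A \<gamma>) y (\<lambda>_. {})) \<longrightarrow>
      set v \<subseteq> Some ` I \<longrightarrow> length v \<le> n \<and> e \<noteq> Dv)"
    for n and y :: "('a, 'v) trm"
  have bounded: "treelike ?K (\<tau> I y)" if nt: "no_tau_comm A \<gamma>" and "y \<in> Reg" "bd n y" for n and y :: "('a, 'v) trm"
    using that(2,3)
  \<comment> \<open>A hidden guard lowers \<open>n\<close>. A \<tau> prefix preserves it and is
    treated by the inner induction on the tree.\<close>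
  proof (induction n arbitrary: y rule: less_induct)
    case (less n)
    have "\<not> diverges y"
      using less.prems(2)[unfolded bd_def, rule_format, of "[]" Dv] unfolding diverges_def wk_Dv_iff[symmetric] by auto
    then obtain h where h: "h \<in> tree Reg" "y \<approx> h"
      using Reg_regular[OF less.prems(1)] nt unfolding regular_def treelike_def by blast
    have "bd n h" using less.prems(2) eqv_den[OF nt h(2)] unfolding bd_def by simp
    with h(1) have "treelike ?K (\<tau> I h)"
    proof induction
      case (tree_act a)
      show ?case by (rule treelike_cong[OF abstr_act treelike_act]) (use tree_act I in simp_all)
    next
      case (tree_prefix a z)
      show ?case
      proof (cases "a \<in> I")
        case False
        show ?thesis by (rule treelike_cong[OF pre treelike_prefix]) (use tree_prefix False Kt Ktm in auto)
      next
        case True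
        have b: "set v \<subseteq> Some ` I \<longrightarrow> Suc (length v) \<le> n \<and> e \<noteq> Dv"
          if "(v, e) \<in> wk (den (comm A \<gamma>) z (\<lambda>_. {}))" for v e
          using tree_prefix(3)[unfolded bd_def, rule_format, of "Some a # v" e] wk_prefixI[OF that, of a] True
          by (auto simp del: actD.simps)
        have "0 < n" using b[OF wk_Nil] by simp
        have "bd (n - 1) z" using b unfolding bd_def by fastforce
        then have "treelike ?K (\<tau> I z)" using less.IH[of "n - 1" z] \<open>0 < n\<close> tree_prefix by simp
        then show ?thesis
          by (intro treelike_cong[OF preI treelike_tau]) (use True tree_prefix Ktm in simp_all)
      qed
    next
      case (tree_tau z)
      have "bd n z" using tree_tau(3) wk_seqD_Tau[of "den (comm A \<gamma>) z (\<lambda>_. {})"] unfolding bd_def by simp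
      with tree_tau have "treelike ?K (Act Tau \<odot> \<tau> I z)" using treelike_tau by blast
      moreover have "\<tau> I (Act Tau \<odot> z) \<approx> Act Tau \<odot> \<tau> I z"
        using pre[of Tau z] tree_tau(1) tree_tm by (simp add: image_iff)
      ultimately show ?case using treelike_cong by blast
    next
      case (tree_delay z)
      show ?case by (rule treelike_cong[OF abstr_delay treelike_delay]) (use tree_delay Ktm Kt I in simp_all)
    next
      case (tree_alt z z')
      then have "bd n z" "bd n z'" unfolding bd_def by (auto simp: wk_Un)
      then show ?case
        by (intro treelike_cong[OF abstr_alt treelike_alt]) (use tree_alt I tree_tm in simp_all)
    qed
    then show ?case using treelike_cong[OF eqv_Unary[OF h(2) un]] by blast
  qed
  have tr: "treelike ?K (\<tau> I h)" if nt: "no_tau_comm A \<gamma>" and "h \<in> tree Reg" "\<not> diverges (\<tau> I h)" for h :: "('a, 'v) trm"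
    using that(2,3)
  proof induction
    case (tree_act a)
    show ?case by (rule treelike_cong[OF abstr_act treelike_act]) (use tree_act I in simp_all)
  next
    case (tree_prefix a z)
    show ?case
    proof (cases "a \<in> I")
      case False
      show ?thesis by (rule treelike_cong[OF pre treelike_prefix]) (use tree_prefix False Kt Ktm in auto)
    next
      case True
      let ?Z = "wk (den (comm A \<gamma>) z (\<lambda>_. {}))"
      \<comment> \<open>The hidden prefix is itself a silent first step, so \<open>Dv\<close>
        directly after it would be divergence at the root. Its absence rules out both sources of
        \<open>Dv\<close>: a hidden trace of \<open>z\<close> that already ends with it, and hidden
        traces of unbounded length. The latter provides the bound for
        \<open>bounded\<close>.\<close>
      have "([], Dv) \<notin> abstrW I ?Z"
      proof
        assume *: "([], Dv) \<in> abstrW I ?Z"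
        have "after (seqD (actD (Basic a)) (den (comm A \<gamma>) z (\<lambda>_. {}))) 0 (Some a) = ?Z"
          by (simp add: after_actD insert_absorb del: actD.simps)
        with * True have "Run 0 None [] Dv \<in> abstrD I (seqD (actD (Basic a)) (den (comm A \<gamma>) z (\<lambda>_. {})))"
          unfolding abstrD_iff by (intro exI[of _ "Some a"]) (simp add: hide_lab_def del: after_seqD)
        then show False using tree_prefix(3) unfolding diverges_def by (simp del: abstrD_iff actD.simps)
      qed
      note Z = this
      have nd: "(v, Dv) \<notin> ?Z" if "set v \<subseteq> Some ` I" for v
        using Z abstrWI[of v Dv ?Z I] hide_hidden[OF that] by auto
      have "\<not> unbounded I ?Z []"
        using Z unfolding abstrW_def by (auto; metis hide_Nil)
      then obtain n where "\<And>v e. (v, e) \<in> ?Z \<Longrightarrow> set v \<subseteq> Some ` I \<Longrightarrow> \<not> n \<le> length v"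
        unfolding unbounded_def by auto
      then have "bd n z" using nd unfolding bd_def by (metis nat_le_linear)
      then have "treelike ?K (\<tau> I z)" using bounded[OF nt] tree_prefix by blast
      then show ?thesis
        by (intro treelike_cong[OF preI treelike_tau]) (use True tree_prefix Ktm in simp_all)
    qed
  next
    case (tree_tau z)
    have *: "\<tau> I (Act Tau \<odot> z) \<approx> Act Tau \<odot> \<tau> I z"
      using pre[of Tau z] tree_tau(1) tree_tm by (simp add: image_iff)
    have "\<not> diverges (\<tau> I z)" using diverges_cong[OF nt *] tree_tau by simp
    with tree_tau have "treelike ?K (Act Tau \<odot> \<tau> I z)" using treelike_tau by blast
    then show ?case using treelike_cong[OF *] by blast
  next
    case (tree_delay z)
    show ?case by (rule treelike_cong[OF abstr_delay treelike_delay]) (use tree_delay Ktm Kt I in simp_all)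
  next
    case (tree_alt z z')
    have *: "\<tau> I (z \<oplus> z') \<approx> \<tau> I z \<oplus> \<tau> I z'" by (rule abstr_alt) (use tree_alt I tree_tm in simp_all)
    have "\<not> diverges (\<tau> I z)" "\<not> diverges (\<tau> I z')" using diverges_cong[OF nt *] tree_alt by simp_all
    then show ?case using treelike_cong[OF * treelike_alt] tree_alt by blast
  qed
  have "regular ?K (\<tau> I y)" if y: "y \<in> Reg" for y :: "('a, 'v) trm"
    unfolding regular_def
  proof (intro conjI impI)
    obtain h where h: "h \<in> nf Reg Reg" "y \<approx> h"
      using Reg_regular[OF y] unfolding regular_def hnf_def by blast
    show "hnf ?K ?K (\<tau> I y)" using hnf_cong[OF eqv_Unary[OF h(2) un] hn[OF h(1)]] .
    assume nt: "no_tau_comm A \<gamma>" and nd: "\<not> diverges (\<tau> I y)"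
    have "\<not> diverges y"
    proof
      assume "diverges y"
      then have "(hide I [], Dv) \<in> abstrW I (after (den (comm A \<gamma>) y (\<lambda>_. {})) 0 None)"
        unfolding diverges_def by (intro abstrWI) simp
      then have "diverges (\<tau> I y)" unfolding diverges_def
        by (auto simp: hide_lab_def intro!: exI[of _ None])
      then show False using nd by simp
    qed
    then obtain t where t: "t \<in> tree Reg" "y \<approx> t"
      using Reg_regular[OF y] nt unfolding regular_def treelike_def by blast
    have *: "\<tau> I y \<approx> \<tau> I t" using eqv_Unary[OF t(2) un] .
    show "treelike ?K (\<tau> I y)"
      using treelike_cong[OF * tr[OF nt t(1)]] nd diverges_cong[OF nt *] by simp
  qed
  moreover have "regular ?K y" if "y \<in> Reg" for y :: "('a, 'v) trm"
    using regular_mono[OF Reg_regular[OF that]] by blast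
  ultimately have "?K \<subseteq> Reg" using Kc by (intro Reg_upper) auto
  then show ?thesis using x by blast
qed

section \<open>Recursion constants and all closed terms\<close>

lemma eqv_replace1:
  assumes "replace1 Y u s s'" "tm s" "\<And>X. tm (f X)" "f Y \<approx> subst f u"
  shows "subst f s \<approx> subst f s'"
  using assms(1,2)
proof induction
  case (2 s s' g)
  then show ?case by (auto intro!: eqv_Unary simp del: unops.simps)
next
  case (3 s s' g t)
  then show ?case using subst_terms[of t, OF _ assms(3)] by (auto intro!: eqv_Binary1)
next
  case (4 t t' g s)
  then show ?case using subst_terms[of s, OF _ assms(3)] by (auto intro!: eqv_Binary2)
qed (use assms(4) in simp)

lemma Reg_Rec:
  fixes E :: "('a, 'v) spec"
  assumes IH: "\<And>s :: ('a, 'v) trm. s \<in> terms ACP A (stage ACP A \<gamma> i) \<Longrightarrow> vars s = {} \<Longrightarrow> s \<in> Reg"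
    and E: "E \<in> stage ACP A \<gamma> (Suc i)" and X: "X \<in> dom E"
  shows "Rec X E \<in> Reg"
proof (cases "E \<in> stage ACP A \<gamma> i")
  case True
  then show ?thesis using IH[of "Rec X E"] X by simp
next
  case False
  let ?S = "stage ACP A \<gamma> i"
  let ?R = "Reg \<union> {Rec Y E |Y. Y \<in> dom E}"
  \<comment> \<open>Variables outside \<open>E\<close> are sent to \<delta>, because derivation
    steps may introduce them, for instance \<delta>\<cdot>x = \<delta> read backwards, and the
    instances have to be closed.\<close>
  let ?f = "\<lambda>Y. if Y \<in> dom E then Rec Y E else Act Delta"
  have spec: "spec_over ACP A ?S E" and gm: "guarded_modulo ACP A \<gamma> ?S E" using False E by auto
  have ES: "E \<in> rec_specs ACP A \<gamma>" using E stage_sub_rec_specs by blast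
  have ftm: "tm (?f Y)" for Y using ES by simp
  have unf: "Rec Y E \<approx> subst ?f u" if "E Y = Some u" for Y u
  proof -
    have "subst ?f u = rec_inst E u"
      unfolding rec_inst_def by (rule subst_vars_cong) (use rec_specs_vars[OF ES that] in auto)
    then show ?thesis using derives.RDP[OF ES that] unfolding REC_derives_def by simp
  qed
  have oc: "subst ?f s \<in> op_closure ?R" if "s \<in> terms ACP A ?S" "abs_free s" for s
    using that
  proof induction
    case (1 Y)
    then show ?case using Reg_act[of Delta] by (auto intro: op_base)
  next
    case (2 a)
    then show ?case using Reg_act by (auto intro: op_base)
  next
    case (3 g t)
    then show ?case by (auto intro!: op_Unary)
  next
    case (4 g s t)
    then show ?case by (auto intro!: op_Binary)
  next
    case (5 F Y)
    then show ?case using IH[of "Rec Y F"] by (auto intro!: op_base)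
  qed
  have gc: "subst ?f s \<in> guarded_closure ?R" if "s \<in> terms ACP A ?S" "abs_free s" "exposed s = {}" for s
    using that
  proof induction
    case (2 a)
    then show ?case using Reg_act by (auto intro: gc_Reg)
  next
    case (3 g t)
    then show ?case
      by (cases g) (auto intro!: gc_delay oc gc_Unary)
  next
    case (4 g s t)
    show ?case
    proof (cases "\<exists>a. g = Seq \<and> s = Act (Basic a)")
      case True
      then show ?thesis using 4 oc by (auto intro!: gc_prefix)
    next
      case False
      then have "exposed (Binary g s t) = exposed s \<union> exposed t"
      proof (cases s)
        case (Act a)
        then show ?thesis using False by (cases g; cases a) simp_all
      qed (cases g; simp)+
      then show ?thesis using 4 by (auto intro!: gc_Binary)
    qed
  next
    case (5 F Y)
    then show ?case using IH[of "Rec Y F"] by (auto intro!: gc_Reg)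
  qed simp
  have "op_closure ?R \<subseteq> Reg"
  proof (rule op_closure_Reg)
    show "?R \<subseteq> closed_tms" using ES by (auto simp: closed_tms_iff dest!: Reg_closed)
    fix r assume "r \<in> ?R"
    then consider "r \<in> Reg" | Y where "r = Rec Y E" "Y \<in> dom E" by blast
    then show "\<exists>g\<in>guarded_closure ?R. r \<approx> g"
    proof cases
      case 1
      then show ?thesis using gc_Reg eqv_refl Reg_closed closed_tms_iff by blast
    next
      case 2
      then obtain u where u: "E Y = Some u" by blast
      then obtain t' where t': "(rewrite_step ACP A \<gamma> ?S E Y)\<^sup>*\<^sup>* u t'" "guarded t'"
        using gm unfolding guarded_modulo_def by blast
      have uS: "u \<in> terms ACP A ?S" using spec u unfolding spec_over_def by (auto simp: ran_def)
      have "t' \<in> terms ACP A ?S \<and> subst ?f u \<approx> subst ?f t'"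
        using t'(1)
      proof (induction rule: rtranclp_induct)
        case base
        have "tm (subst ?f u)" using subst_terms[OF terms_mono[OF uS stage_sub_rec_specs] ftm] .
        then show ?case using uS eqv_refl by blast
      next
        case (step y z)
        from step(2) consider "derives ACP A \<gamma> ?S y z" | Z v where "E Z = Some v" "replace1 Z v y z"
          unfolding rewrite_step_def by blast
        then have "z \<in> terms ACP A ?S \<and> subst ?f y \<approx> subst ?f z"
        proof cases
          case 1
          have "z \<in> terms ACP A ?S" by (rule derives_terms[OF 1, THEN conjunct2]) (rule stage_terms)
          moreover have "subst ?f y \<approx> subst ?f z"
            unfolding REC_derives_def
            by (rule derives_subst[OF derives_mono[OF 1 stage_sub_rec_specs] ftm]) (rule rec_specs_vars)
          ultimately show ?thesis by blast
        next
          case 2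
          have "v \<in> terms ACP A ?S" using spec 2 unfolding spec_over_def by (auto simp: ran_def)
          then have "z \<in> terms ACP A ?S" using replace1_terms[OF 2(2)] step by blast
          moreover have "tm y" using step terms_mono[OF _ stage_sub_rec_specs] by blast
          then have "subst ?f y \<approx> subst ?f z"
            by (rule eqv_replace1[OF 2(2) _ ftm]) (use unf[OF 2(1)] 2(1) in auto)
          ultimately show ?thesis by blast
        qed
        then show ?case using step eqv_trans by blast
      qed
      then have t'S: "t' \<in> terms ACP A ?S" and eq: "subst ?f u \<approx> subst ?f t'" by blast+
      have "subst ?f t' \<in> guarded_closure ?R"
      proof (cases "vars t' = {}")
        \<comment> \<open>A closed witness may contain abstraction. It is covered because the
          induction over the stages concerns all closed terms, not only the abstraction-free
          ones.\<close>
        case True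
        then show ?thesis using IH[OF t'S] by (simp add: subst_closed gc_Reg)
      next
        case False
        then show ?thesis using t'(2) by (intro gc t'S) (auto simp: guarded_def)
      qed
      then show ?thesis using eqv_trans[OF unf[OF u] eq] unfolding 2(1) by blast
    qed
  qed auto
  then show ?thesis using X by (auto intro: op_base)
qed

theorem closed_Reg: "s \<in> closed_tms \<Longrightarrow> s \<in> Reg"
proof -
  have "s \<in> terms ACP A (stage ACP A \<gamma> i) \<Longrightarrow> vars s = {} \<Longrightarrow> s \<in> Reg" for s i
  proof (induction i arbitrary: s)
    case 0
    then show ?case
    proof induction
      case (3 f t)
      then show ?case using op_closed_Reg Reg_Abstr unfolding op_closed_def by (cases f) auto
    qed (use op_closed_Reg in \<open>auto simp: op_closed_def\<close>)
  next
    case (Suc i)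
    from Suc.prems show ?case
    proof induction
      case (3 f t)
      then show ?case using op_closed_Reg Reg_Abstr unfolding op_closed_def by (cases f) auto
    next
      case (5 E X)
      then show ?case using Reg_Rec[OF Suc.IH] by blast
    qed (use op_closed_Reg in \<open>auto simp: op_closed_def\<close>)
  qed
  then show "s \<in> closed_tms \<Longrightarrow> s \<in> Reg"
    using terms_rec_specs_stage[of s ACP A \<gamma>] unfolding closed_tms_iff by blast
qed

end

section \<open>Elimination\<close>

lemma no_div_prefix:
  assumes "no_div (seqD (actD a) P)" "a \<noteq> Delta"
  shows "no_div P"
  unfolding no_div_def
proof (intro allI notI)
  fix k \<alpha> w assume "Run k \<alpha> w Dv \<in> P"
  then obtain v where "(v, Dv) \<in> wk P" using wk_RunI by blast
  moreover define \<beta> where "\<beta> = (case a of Basic b \<Rightarrow> Some b | _ \<Rightarrow> None)"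
  ultimately have "Run 0 \<beta> v Dv \<in> seqD (actD a) P"
    using assms(2) by (cases a) (simp_all add: after_actD \<beta>_def del: actD.simps)
  then show False using assms(1) unfolding no_div_def by blast
qed

lemma no_div_delay: "no_div (delayD P) \<Longrightarrow> no_div P"
  unfolding no_div_def by (meson delayD_iff(4))

lemma infinite_imp_inj_countable:
  assumes "infinite (UNIV :: 'v set)" "countable R"
  obtains \<iota> :: "'b \<Rightarrow> 'v" where "inj_on \<iota> R"
proof -
  obtain f :: "nat \<Rightarrow> 'v" where f: "inj f" using infinite_countable_subset[OF assms(1)] by blast
  have "inj_on (f \<circ> to_nat_on R) R"
    using inj_on_to_nat_on[OF assms(2)] f by (auto intro!: comp_inj_on inj_on_subset[OF f])
  then show thesis using that by blast
qed

context acp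
begin

text \<open>With finitely many leaves per tree, only countably many terms are reachable from a given
  one.\<close>

lemma tree_finite: "h \<in> tree K \<Longrightarrow> \<exists>L. finite L \<and> L \<subseteq> K \<and> h \<in> tree L"
proof (induction rule: tree.induct)
  case (tree_act a)
  then show ?case by (intro exI[of _ "{}"]) (auto intro: tree.intros)
next
  case (tree_prefix a x)
  then show ?case by (intro exI[of _ "{x}"]) (auto intro: tree.intros)
next
  case (tree_tau x)
  then show ?case by (auto intro: tree.intros)
next
  case (tree_delay x)
  then show ?case by (intro exI[of _ "{x}"]) (auto intro: tree.intros)
next
  case (tree_alt x y)
  then obtain L M where "finite L" "L \<subseteq> K" "x \<in> tree L" "finite M" "M \<subseteq> K" "y \<in> tree M" by blast
  then show ?case by (intro exI[of _ "L \<union> M"]) (auto intro!: tree.intros intro: tree_mono)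
qed

text \<open>A tree with variables for its leaves is guarded by construction. Its operators are
  common to both signatures and it has no recursion constants, so one and the same specification
  enters at the first stage of both hierarchies.\<close>

lemma tree_template:
  fixes \<iota> :: "('a, 'v) trm \<Rightarrow> 'v"
  assumes "h \<in> tree L" "inj_on \<iota> R" "L \<subseteq> R"
  shows "\<exists>g. (\<forall>T. g \<in> terms T A {}) \<and> abs_free g \<and> exposed g = {} \<and> vars g \<subseteq> \<iota> ` L \<and> subst (inv_into R \<iota>) g = h"
proof -
  have bin: "Alt \<in> binops T" "Seq \<in> binops T" "Delay \<in> unops T A" for T by (cases T; simp)+
  have leaf: "inv_into R \<iota> (\<iota> x) = x" if "x \<in> L" for x using that assms by (simp add: subset_iff)
  show ?thesis
    using assms(1)
  proof induction
    case (tree_act a)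
    then show ?case by (intro exI[of _ "Act a"]) simp
  next
    case (tree_prefix a x)
    then show ?case by (intro exI[of _ "Act (Basic a) \<odot> Var (\<iota> x)"]) (simp add: leaf bin)
  next
    case (tree_tau x)
    then obtain g where "(\<forall>T. g \<in> terms T A {}) \<and> abs_free g \<and> exposed g = {} \<and> vars g \<subseteq> \<iota> ` L \<and>
      subst (inv_into R \<iota>) g = x" by blast
    then show ?case by (intro exI[of _ "Act Tau \<odot> g"]) (simp add: bin)
  next
    case (tree_delay x)
    then show ?case by (intro exI[of _ "\<sigma> (Var (\<iota> x))"]) (simp add: leaf bin)
  next
    case (tree_alt x y)
    then obtain g g' where "(\<forall>T. g \<in> terms T A {}) \<and> abs_free g \<and> exposed g = {} \<and> vars g \<subseteq> \<iota> ` L \<and>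
      subst (inv_into R \<iota>) g = x" "(\<forall>T. g' \<in> terms T A {}) \<and> abs_free g' \<and> exposed g' = {} \<and> vars g' \<subseteq> \<iota> ` L \<and>
      subst (inv_into R \<iota>) g' = y" by blast
    then show ?case by (intro exI[of _ "g \<oplus> g'"]) (simp add: bin)
  qed
qed

lemma guarded_spec_rec_specs:
  assumes "\<And>X u. E X = Some u \<Longrightarrow> u \<in> terms T A {} \<and> vars u \<subseteq> dom E \<and> abs_free u \<and> exposed u = {}"
  shows "E \<in> rec_specs T A \<gamma>"
proof -
  have "guarded u" if "E X = Some u" for X u using assms[OF that] by (simp add: guarded_def)
  then have "guarded_modulo T A \<gamma> {} E" unfolding guarded_modulo_def by blast
  moreover have "spec_over T A {} E" unfolding spec_over_def ran_def using assms by blast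
  ultimately have "E \<in> stage T A \<gamma> (Suc 0)" by simp
  then show ?thesis using stage_sub_rec_specs by blast
qed

theorem treelike_BPA:
  fixes N :: "('a, 'v) trm set"
  assumes inf: "infinite (UNIV :: 'v set)" and N: "\<And>s. s \<in> N \<Longrightarrow> treelike N s" and t: "t \<in> N"
  shows "\<exists>t'. t' \<in> closed_tms \<and> t' \<in> closed_REC_terms BPA A \<gamma> \<and> t \<approx> t'"
proof -
  have "\<exists>h L. finite L \<and> L \<subseteq> N \<and> h \<in> tree L \<and> s \<approx> h" if "s \<in> N" for s
  proof -
    obtain h where h: "h \<in> tree N" "s \<approx> h" using N[OF \<open>s \<in> N\<close>] unfolding treelike_def by blast
    then show ?thesis using tree_finite[OF h(1)] by blast
  qed
  then obtain h L where hL: "\<And>s. s \<in> N \<Longrightarrow> finite (L s) \<and> L s \<subseteq> N \<and> h s \<in> tree (L s) \<and> s \<approx> h s"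
    by metis
  \<comment> \<open>Only what is reachable from \<open>t\<close> is used: \<open>N\<close> may be
    larger than the set of variables, whereas a countable set embeds into it.\<close>
  define Rn where "Rn n = ((\<lambda>M. \<Union> (L ` M)) ^^ n) {t}" for n
  define R where "R = (\<Union>n. Rn n)"
  have Rn: "finite (Rn n) \<and> Rn n \<subseteq> N" for n
  proof (induction n)
    case (Suc n)
    have "Rn (Suc n) = \<Union> (L ` Rn n)" by (simp add: Rn_def)
    then show ?case using Suc hL by auto
  qed (simp add: Rn_def t)
  then have "R \<subseteq> N" "countable R" unfolding R_def by (auto intro: countable_finite)
  have "t \<in> Rn 0" by (simp add: Rn_def)
  then have tR: "t \<in> R" unfolding R_def by blast
  have LR: "L s \<subseteq> R" if "s \<in> R" for s
  proof -
    obtain n where "s \<in> Rn n" using \<open>s \<in> R\<close> unfolding R_def by blast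
    then have "L s \<subseteq> Rn (Suc n)" by (auto simp: Rn_def)
    then show ?thesis unfolding R_def by blast
  qed
  obtain \<iota> :: "('a, 'v) trm \<Rightarrow> 'v" where \<iota>: "inj_on \<iota> R"
    using infinite_imp_inj_countable[OF inf \<open>countable R\<close>] by blast
  have "\<exists>g. (\<forall>T. g \<in> terms T A {}) \<and> abs_free g \<and> exposed g = {} \<and> vars g \<subseteq> \<iota> ` R \<and> subst (inv_into R \<iota>) g = h s"
    if "s \<in> R" for s
  proof -
    have "h s \<in> tree (L s)" using hL \<open>R \<subseteq> N\<close> that by blast
    from tree_template[OF this \<iota> LR[OF that]] show ?thesis using LR[OF that] by blast
  qed
  then obtain g where g: "\<And>s. s \<in> R \<Longrightarrow> (\<forall>T. g s \<in> terms T A {}) \<and> abs_free (g s) \<and> exposed (g s) = {} \<and>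
      vars (g s) \<subseteq> \<iota> ` R \<and> subst (inv_into R \<iota>) (g s) = h s"
    by metis
  define E where "E Y = (if Y \<in> \<iota> ` R then Some (g (inv_into R \<iota> Y)) else None)" for Y
  have dom: "dom E = \<iota> ` R" by (auto simp: E_def split: if_splits)
  have E: "\<exists>s\<in>R. Y = \<iota> s \<and> u = g s" if "E Y = Some u" for Y u
    using that \<iota> by (auto simp: E_def split: if_splits)
  have ES: "E \<in> rec_specs T A \<gamma>" for T
    by (rule guarded_spec_rec_specs) (use g dom in \<open>auto dest!: E\<close>)
  \<comment> \<open>\<open>inv_into R \<iota>\<close> sends every variable back to the term it
    stands for; under this substitution the equations of \<open>E\<close> become
    \<open>s \<approx> h s\<close>, which are the premises of RSP.\<close>
  have "derives ACP A \<gamma> (rec_specs ACP A \<gamma>) (inv_into R \<iota> (\<iota> t)) (Rec (\<iota> t) E)"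
  proof (rule derives.RSP[OF ES])
    fix Y u assume "E Y = Some u"
    then obtain s where s: "s \<in> R" "Y = \<iota> s" "u = g s" using E by blast
    then have "inv_into R \<iota> Y = s" "subst (inv_into R \<iota>) u = h s" using \<iota> g by simp_all
    moreover have "s \<approx> h s" using hL s \<open>R \<subseteq> N\<close> by blast
    ultimately show "derives ACP A \<gamma> (rec_specs ACP A \<gamma>) (inv_into R \<iota> Y) (subst (inv_into R \<iota>) u)"
      unfolding REC_derives_def by simp
  qed (use tR dom in simp)
  then have "t \<approx> Rec (\<iota> t) E" using \<iota> tR unfolding REC_derives_def by simp
  moreover have "Rec (\<iota> t) E \<in> closed_REC_terms T A \<gamma>" for T
    using ES dom tR by (simp add: closed_REC_terms_def)
  ultimately show ?thesis by blast
qed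

text \<open>
  The equation \<open>X = a\<cdot>X | b\<close> is guarded, although its right-hand side equals \<open>\<tau>\<cdot>X\<close> if \<open>a\<close> and \<open>b\<close>
  communicate to \<open>\<tau>\<close>; every \<open>\<tau>\<cdot>r\<close> solves it.
\<close>

lemma tau_collapse:
  fixes r :: "('a, 'v) trm"
  assumes "a \<in> A" "b \<in> A" "\<gamma> (Basic a) (Basic b) = Tau" "tm r"
  shows "Act Tau \<odot> r \<approx> Act Tau \<odot> Act Delta"
proof -
  fix X :: 'v
  define E :: "('a, 'v) spec" where "E = [X \<mapsto> (Act (Basic a) \<odot> Var X) \<bowtie> Act (Basic b)]"
  have ES: "E \<in> rec_specs ACP A \<gamma>"
    by (rule guarded_spec_rec_specs) (use assms in \<open>auto simp: E_def split: if_splits\<close>)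
  have "Act Tau \<odot> r \<approx> Rec X E" if "tm r" for r
  proof -
    let ?f = "\<lambda>_. Act Tau \<odot> r"
    have "(Act (Basic a) \<odot> (Act Tau \<odot> r)) \<bowtie> Act (Basic b) \<approx> Act (\<gamma> (Basic a) (Basic b)) \<odot> (Act Tau \<odot> r)"
      by (rule prefix_cmerge_act) (use assms that in simp_all)
    also have "\<dots> = Act Tau \<odot> (Act Tau \<odot> r)" using assms by simp
    also have "\<dots> \<approx> (Act Tau \<odot> Act Tau) \<odot> r" by (rule eqv_sym[OF seq_assoc]) (use that in simp_all)
    also have "\<dots> \<approx> Act Tau \<odot> r" by (rule eqv_Binary1[OF act_tau]) (use that in simp_all)
    finally have "Act Tau \<odot> r \<approx> subst ?f ((Act (Basic a) \<odot> Var X) \<bowtie> Act (Basic b))"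
      using eqv_sym by fastforce
    then have "derives ACP A \<gamma> (rec_specs ACP A \<gamma>) (?f X) (Rec X E)"
      by (intro derives.RSP[OF ES]) (auto simp: E_def REC_derives_def split: if_splits)
    then show ?thesis by (simp add: REC_derives_def)
  qed
  from eqv_trans[OF this[OF assms(4)] eqv_sym[OF this]] show ?thesis by simp
qed

theorem abs_free_BPA:
  fixes t :: "('a, 'v) trm"
  assumes inf: "infinite (UNIV :: 'v set)" and t: "t \<in> closed_tms" and "abs_free t"
  shows "\<exists>t'. t' \<in> closed_tms \<and> t' \<in> closed_REC_terms BPA A \<gamma> \<and> t \<approx> t'"
proof (cases "no_tau_comm A \<gamma>")
  case True
  let ?D = "\<lambda>s :: ('a, 'v) trm. den (comm A \<gamma>) s (\<lambda>_. {})"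
  \<comment> \<open>\<open>Reg\<close> gives trees at non-diverging roots only, and a residual
    behind a guard might diverge again. Absence of \<open>Dv\<close> from all traces passes to the
    residuals, which closes the set under unfolding.\<close>
  let ?N = "{s \<in> Reg. no_div (?D s)} :: ('a, 'v) trm set"
  have tree: "h \<in> tree ?N" if "h \<in> tree Reg" "no_div (?D h)" for h
    using that
  proof induction
    case (tree_prefix a x)
    then show ?case using no_div_prefix[of "Basic a" "?D x"] by (auto intro!: tree.tree_prefix)
  next
    case (tree_tau x)
    then show ?case using no_div_prefix[of Tau "?D x"] by (auto intro!: tree.tree_tau)
  next
    case (tree_delay x)
    then show ?case using no_div_delay[of "?D x"] by (auto intro!: tree.tree_delay)
  next
    case (tree_alt x y)
    then show ?case by (auto intro!: tree.tree_alt simp: no_div_Un)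
  qed (rule tree.tree_act)
  have "treelike ?N s" if s: "s \<in> ?N" for s
  proof -
    have "\<not> diverges s" using s unfolding diverges_def no_div_def by blast
    then obtain h where h: "h \<in> tree Reg" "s \<approx> h"
      using Reg_regular[of s] \<open>s \<in> ?N\<close> True unfolding regular_def treelike_def by blast
    then have "no_div (?D h)" using s eqv_den[OF True h(2)] by simp
    then show ?thesis using tree h unfolding treelike_def by blast
  qed
  moreover have "t \<in> ?N"
    using closed_Reg[OF t] abs_free_no_div[OF assms(3), of "\<lambda>_. {}"] by (simp add: no_div_def)
  ultimately show ?thesis using treelike_BPA[OF inf] by blast
next
  case False
  then obtain a b where ab: "a \<in> A" "b \<in> A" "\<gamma> (Basic a) (Basic b) = Tau" unfolding no_tau_comm_def by blast
  let ?Reg = "Reg :: ('a, 'v) trm set"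
  have tms: "tm x" if "x \<in> ?Reg" for x using Reg_closed[OF that] closed_tms_iff by blast
  have "treelike ?Reg h" if "h \<in> nf ?Reg ?Reg" for h
    using that
  proof induction
    case (nf_act a)
    then show ?case by (rule treelike_act)
  next
    case (nf_prefix a x)
    then show ?case using tms by (intro treelike_prefix) simp_all
  next
    case (nf_tau x)
    then show ?case using treelike_cong[OF tau_collapse[OF ab tms] treelike_tau[OF treelike_act]] by simp
  next
    case (nf_delay x)
    then show ?case using tms by (intro treelike_delay) simp_all
  next
    case (nf_alt x y)
    then show ?case by (intro treelike_alt)
  qed
  then have "treelike ?Reg s" if "s \<in> ?Reg" for s
    using Reg_regular[OF that] treelike_cong unfolding regular_def hnf_def by blast
  then show ?thesis using treelike_BPA[OF inf] closed_Reg[OF t] by blast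
qed

end

theorem theorem15:
  fixes A :: "'a set" and \<gamma> :: "'a act \<Rightarrow> 'a act \<Rightarrow> 'a act" and t :: "('a, 'v) trm"
  assumes "finite A"
    and "comm_fun A \<gamma>"
    and "infinite (UNIV :: 'v set)"
    and "t \<in> closed_REC_terms ACP A \<gamma>"
    and "abs_free t"
  shows "\<exists>t'. t' \<in> closed_REC_terms ACP A \<gamma> \<and> t' \<in> closed_REC_terms BPA A \<gamma> \<and>
    REC_derives ACP A \<gamma> t t'"
proof -
  interpret acp A \<gamma> using assms(1,2) by unfold_locales
  show ?thesis using abs_free_BPA[OF assms(3-5)] .
qed

end
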